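(* Let $n\ge 1$ and $k\in\{1,\dots,n\}$. Then the map \[ \varphi_4:\mathbb{R}^{n\times k}_k/\mathrm{GL}(k)\to\{Q\in \mathrm{O}(n): Q^{\mathsf T}=Q,\ \operatorname{tr}(Q)=2k-n\},\qquad \varphi_4([A])=2Y_AY_A^{\mathsf T}-I, \] is a (well-defined) diffeomorphism, with inverse $\varphi_4^{-1}(Q)=[Y_Q]$.
   Context: $\mathbb{R}^{n\times k}_k=\{A\in\mathbb{R}^{n\times k}:\operatorname{rank}(A)=k\}$, on which $\mathrm{GL}(k)$ (invertible real $k\times k$ matrices) acts by right multiplication; $[A]=\{AX:X\in\mathrm{GL}(k)\}$ is the class of $A$ in the quotient manifold. For $A\in\mathbb{R}^{n\times k}_k$, $A=Y_AR_A$ denotes a QR factorization, i.e. $Y_A\in\mathbb{R}^{n\times k}$ has orthonormal columns and $R_A\in\mathbb{R}^{k\times k}$ is upper triangular. The target set carries the smooth structure of an embedded submanifold of $\mathrm{O}(n)$; each $Q$ in it is symmetric with eigenvalue $1$ of multiplicity $k$ and $-1$ of multiplicity $n-k$, and $Y_Q\in\mathbb{R}^{n\times k}$ denotes any matrix whose columns form an orthonormal basis of the $1$-eigenspace of $Q$. *)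

theory Defs
  imports "HOL-Analysis.Analysis"
begin

section \<open>Smooth maps between subsets of Euclidean spaces\<close>

text \<open>On an open set \<open>S\<close> of a Euclidean space this is the class \<open>C\<^sup>m\<close>: all
  directional derivatives of order up to \<open>m\<close> exist and are continuous.\<close>

fun Cm_on :: "nat \<Rightarrow> 'a::euclidean_space set \<Rightarrow> ('a \<Rightarrow> 'b::euclidean_space) \<Rightarrow> bool" where
  "Cm_on 0 S f \<longleftrightarrow> continuous_on S f"
| "Cm_on (Suc m) S f \<longleftrightarrow>
     (\<forall>x\<in>S. f differentiable (at x)) \<and>
     (\<forall>v. Cm_on m S (\<lambda>x. frechet_derivative f (at x) v))"

text \<open>On an arbitrary set, smoothness means that there are local smooth extensions to open
  subsets of the ambient space. For relatively open subsets of a linear subspace this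
  agrees with the intrinsic notion.\<close>

definition smooth_on :: "'a::euclidean_space set \<Rightarrow> ('a \<Rightarrow> 'b::euclidean_space) \<Rightarrow> bool" where
  "smooth_on S f \<longleftrightarrow>
     (\<forall>x\<in>S. \<exists>T g. open T \<and> x \<in> T \<and> (\<forall>m. Cm_on m T g) \<and> (\<forall>y\<in>S \<inter> T. g y = f y))"

section \<open>Smooth manifolds\<close>

text \<open>The charts of a manifold take values in one linear subspace, its model, of a Euclidean
  space. The model plays the role of \<open>\<real>\<^sup>d\<close>, where \<open>d\<close> is the dimension of the subspace. This
  allows \<open>d\<close> to depend on the sizes of index types and to be \<open>0\<close>, which the type class
  \<open>euclidean_space\<close> excludes.\<close>

record ('p, 'e) manifold =
  mtop :: "'p topology"
  model :: "'e set"
  atlas :: "('p set \<times> ('p \<Rightarrow> 'e)) set"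

definition is_chart :: "('p, 'e::euclidean_space) manifold \<Rightarrow> 'p set \<Rightarrow> ('p \<Rightarrow> 'e) \<Rightarrow> bool" where
  "is_chart M U \<psi> \<longleftrightarrow>
     openin (mtop M) U \<and>
     openin (top_of_set (model M)) (\<psi> ` U) \<and>
     homeomorphic_map (subtopology (mtop M) U) (top_of_set (\<psi> ` U)) \<psi>"

definition smooth_manifold :: "('p, 'e::euclidean_space) manifold \<Rightarrow> bool" where
  "smooth_manifold M \<longleftrightarrow>
     Hausdorff_space (mtop M) \<and> second_countable (mtop M) \<and> subspace (model M) \<and>
     (\<forall>(U, \<psi>)\<in>atlas M. is_chart M U \<psi>) \<and>
     (\<Union>(U, \<psi>)\<in>atlas M. U) = topspace (mtop M) \<and>
     (\<forall>(U, \<psi>)\<in>atlas M. \<forall>(W, \<theta>)\<in>atlas M. smooth_on (\<psi> ` (U \<inter> W)) (\<theta> \<circ> inv_into U \<psi>))"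

definition smooth_map ::
  "('p, 'e::euclidean_space) manifold \<Rightarrow> ('q, 'f::euclidean_space) manifold \<Rightarrow> ('p \<Rightarrow> 'q) \<Rightarrow> bool" where
  "smooth_map M N f \<longleftrightarrow>
     continuous_map (mtop M) (mtop N) f \<and>
     (\<forall>(U, \<psi>)\<in>atlas M. \<forall>(W, \<theta>)\<in>atlas N.
        smooth_on (\<psi> ` (U \<inter> f -` W)) (\<theta> \<circ> f \<circ> inv_into U \<psi>))"

definition diffeomorphism ::
  "('p, 'e::euclidean_space) manifold \<Rightarrow> ('q, 'f::euclidean_space) manifold \<Rightarrow> ('p \<Rightarrow> 'q) \<Rightarrow> bool" where
  "diffeomorphism M N f \<longleftrightarrow>
     bij_betw f (topspace (mtop M)) (topspace (mtop N)) \<and>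
     smooth_map M N f \<and> smooth_map N M (inv_into (topspace (mtop M)) f)"

text \<open>\<open>D\<close> is the differential of \<open>f\<close> at \<open>p\<close> read in the charts \<open>(U, \<psi>)\<close> and \<open>(W, \<theta>)\<close>. Only its
  values on the model of the domain are determined.\<close>

definition differential_in_charts ::
  "('p \<Rightarrow> 'q) \<Rightarrow> 'p \<Rightarrow> 'p set \<times> ('p \<Rightarrow> 'e::euclidean_space) \<Rightarrow>
   'q set \<times> ('q \<Rightarrow> 'f::euclidean_space) \<Rightarrow> ('e \<Rightarrow> 'f) \<Rightarrow> bool" where
  "differential_in_charts f p = (\<lambda>(U, \<psi>) (W, \<theta>) D.
     ((\<theta> \<circ> f \<circ> inv_into U \<psi>) has_derivative D) (at (\<psi> p) within \<psi> ` (U \<inter> f -` W)))"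

definition smooth_submersion ::
  "('p, 'e::euclidean_space) manifold \<Rightarrow> ('q, 'f::euclidean_space) manifold \<Rightarrow> ('p \<Rightarrow> 'q) \<Rightarrow> bool" where
  "smooth_submersion M N f \<longleftrightarrow>
     smooth_map M N f \<and>
     (\<forall>(U, \<psi>)\<in>atlas M. \<forall>(W, \<theta>)\<in>atlas N. \<forall>p\<in>U \<inter> f -` W.
        \<exists>D. differential_in_charts f p (U, \<psi>) (W, \<theta>) D \<and> D ` model M = model N)"

definition smooth_immersion ::
  "('p, 'e::euclidean_space) manifold \<Rightarrow> ('q, 'f::euclidean_space) manifold \<Rightarrow> ('p \<Rightarrow> 'q) \<Rightarrow> bool" where
  "smooth_immersion M N f \<longleftrightarrow>
     smooth_map M N f \<and>
     (\<forall>(U, \<psi>)\<in>atlas M. \<forall>(W, \<theta>)\<in>atlas N. \<forall>p\<in>U \<inter> f -` W.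
        \<exists>D. differential_in_charts f p (U, \<psi>) (W, \<theta>) D \<and> inj_on D (model M))"

text \<open>The standard manifold structure of an open subset of a Euclidean space.\<close>

definition open_manifold :: "'a::euclidean_space set \<Rightarrow> ('a, 'a) manifold" where
  "open_manifold S = \<lparr>mtop = top_of_set S, model = UNIV, atlas = {(S, id)}\<rparr>"

text \<open>\<open>N\<close> is a smooth structure on the subset \<open>S\<close>, with the subspace topology, that makes \<open>S\<close> an
  embedded submanifold of \<open>M\<close>.\<close>

definition embedded_submanifold ::
  "('p, 'e::euclidean_space) manifold \<Rightarrow> 'p set \<Rightarrow> ('p, 'f::euclidean_space) manifold \<Rightarrow> bool" where
  "embedded_submanifold M S N \<longleftrightarrow>
     S \<subseteq> topspace (mtop M) \<and> smooth_manifold N \<and> mtop N = subtopology (mtop M) S \<and>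
     smooth_immersion N M id"

text \<open>\<open>N\<close> is a quotient manifold of \<open>M\<close> along \<open>q\<close>: it carries the quotient topology and a smooth
  structure (unique, up to the choice of an atlas) for which \<open>q\<close> is a smooth submersion.\<close>

definition quotient_manifold ::
  "('p, 'e::euclidean_space) manifold \<Rightarrow> ('p \<Rightarrow> 'q) \<Rightarrow> ('q, 'f::euclidean_space) manifold \<Rightarrow> bool" where
  "quotient_manifold M q N \<longleftrightarrow>
     smooth_manifold N \<and> quotient_map (mtop M) (mtop N) q \<and> smooth_submersion M N q"

section \<open>The two models of the Grassmannian\<close>

type_synonym ('n, 'k) rmat = "real^'k^'n"

definition full_rank_matrices :: "('n::finite, 'k::finite) rmat set" where
  "full_rank_matrices = {A. rank A = CARD('k)}"

definition gl_class :: "('n::finite, 'k::finite) rmat \<Rightarrow> ('n, 'k) rmat set" where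
  "gl_class A = {A ** X | X. invertible X}"

definition orthonormal_columns :: "('n::finite, 'k::finite) rmat \<Rightarrow> bool" where
  "orthonormal_columns Y \<longleftrightarrow> (\<forall>i j. column i Y \<bullet> column j Y = (if i = j then 1 else 0))"

definition qr_factorization ::
  "('n::finite, 'k::{finite,linorder}) rmat \<Rightarrow> ('n, 'k) rmat \<Rightarrow> ('k, 'k) rmat \<Rightarrow> bool" where
  "qr_factorization A Y R \<longleftrightarrow>
     A = Y ** R \<and> orthonormal_columns Y \<and> (\<forall>i j. j < i \<longrightarrow> R $ i $ j = 0)"

definition orthogonal_group :: "('n::finite, 'n) rmat set" where
  "orthogonal_group = {Q. orthogonal_matrix Q}"

text \<open>The number \<open>k\<close> of the mathematical notation is passed as an argument here, since it cannot be
  read off the type.\<close>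

definition involution_model :: "nat \<Rightarrow> ('n::finite, 'n) rmat set" where
  "involution_model k =
     {Q \<in> orthogonal_group. transpose Q = Q \<and> trace Q = 2 * real k - real CARD('n)}"

definition eigenspace_basis :: "('n::finite, 'n) rmat \<Rightarrow> ('n, 'k::finite) rmat \<Rightarrow> bool" where
  "eigenspace_basis Q Y \<longleftrightarrow>
     orthonormal_columns Y \<and> span (columns Y) = {x. Q *v x = x}"

text \<open>The value is meaningful only once all representatives of a class and all their QR
  factorizations are known to give the same matrix.\<close>

definition phi4 :: "('n::finite, 'k::{finite,linorder}) rmat set \<Rightarrow> ('n, 'n) rmat" where
  "phi4 c = (THE Q. \<exists>A\<in>c. \<exists>Y R. qr_factorization A Y R \<and>
     Q = 2 *\<^sub>R (Y ** transpose Y) - mat 1)"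

end

theory Submission
  imports Defs
begin

text \<open>The map \<open>\<phi>\<^sub>4\<close> sends the class of \<open>A\<close> to \<open>F A = 2 A (A\<^sup>T A)\<^sup>-\<^sup>1 A\<^sup>T - I\<close>, the reflection along the column
  space of \<open>A\<close>; this is smooth in \<open>A\<close> and determines the class. By the inverse function theorem the
  submersion onto the quotient has smooth local sections, and a chart of an embedded submanifold is
  locally the restriction of a smooth map on the ambient space. Hence smoothness of \<open>\<phi>\<^sub>4\<close> for arbitrary
  structures reduces to smoothness of \<open>F\<close>, and smoothness of its inverse to the smooth local section
  \<open>Q \<mapsto> (I + Q) Y / 2\<close> of \<open>F\<close>.

  For existence, write subspaces near a given one as images of \<open>P\<^sup>-\<^sup>1 (E + H)\<close> with \<open>E\<close> a fixed frame, \<open>P\<close>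
  invertible and \<open>E\<^sup>T H = 0\<close>. In terms of the reflection \<open>Q = 2 \<Pi> - I\<close> and \<open>C = P\<^sup>T E\<close> the coordinate is
  \<open>H = P \<Pi> C (C\<^sup>T \<Pi> C)\<^sup>-\<^sup>1 - E\<close>. The orthogonal group is covered by translates of the Cayley transform.\<close>

section \<open>Calculus of maps of class \<open>C\<^sup>m\<close>\<close>

text \<open>The smooth structures are universally quantified, so none of their charts is known; all
  that can be used is that the projection is a submersion and each inclusion an immersion. Both
  properties concern differentials between linear models lying inside larger Euclidean spaces, where
  a derivative is determined only along the model. The inverse function theorem is therefore applied
  to maps of the ambient space that are padded by the identity transversally to the model. As
  smoothness means all orders, the local inverse must be shown to be of class C^m for every m; this
  rests on the smooth dependence of the inverse of a linear operator, which also yields smoothness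
  of matrix inversion. The formula for \<open>F\<close> involves no choice, whereas a QR
  factorization does; QR factorizations serve to identify \<open>phi4\<close> with \<open>F\<close>.
  The existence parts keep the universally quantified part from being vacuous. One atlas, written in
  the coordinate Q, serves both the reflections and the classes: \<open>phi4\<close> carries it to
  the quotient.\<close>

lemma Cm_on_subset: "Cm_on m S f \<Longrightarrow> T \<subseteq> S \<Longrightarrow> Cm_on m T f"
  by (induction m arbitrary: f) (auto intro: continuous_on_subset)

lemma Cm_on_imp_continuous_on: "Cm_on m S f \<Longrightarrow> continuous_on S f"
  by (cases m) (auto intro!: differentiable_imp_continuous_on simp: differentiable_on_def
      differentiable_at_withinI)

text \<open>Openness makes the derivative at a point of \<open>S\<close> depend only on the values
  in \<open>S\<close>, so the agreement passes to all directional derivatives.\<close>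

lemma Cm_on_cong:
  assumes "open S" "\<And>x. x \<in> S \<Longrightarrow> f x = g x" "Cm_on m S f"
  shows "Cm_on m S g"
  using assms(2,3)
proof (induction m arbitrary: f g)
  case 0
  then show ?case by (simp cong: continuous_on_cong)
next
  case (Suc m)
  have d: "(g has_derivative frechet_derivative f (at x)) (at x)" if "x \<in> S" for x
  proof (rule has_derivative_transform_within_open[OF _ assms(1) that])
    show "(f has_derivative frechet_derivative f (at x)) (at x)"
      using Suc.prems(2) that frechet_derivative_works by auto
  qed (use Suc.prems in auto)
  then have e: "frechet_derivative f (at x) = frechet_derivative g (at x)" if "x \<in> S" for x
    using frechet_derivative_at that by blast
  have "Cm_on m S (\<lambda>x. frechet_derivative g (at x) v)" for v
    by (rule Suc.IH[where f = "\<lambda>x. frechet_derivative f (at x) v"]) (use Suc.prems e in auto)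
  moreover have "\<forall>x\<in>S. g differentiable (at x)" using d differentiable_def by blast
  ultimately show ?case by simp
qed

text \<open>Lets an explicit formula for the derivative replace \<open>frechet_derivative\<close>;
  the closure properties below are proved through it.\<close>

lemma Cm_on_SucI:
  assumes "open S" "\<And>x. x \<in> S \<Longrightarrow> (f has_derivative D x) (at x)"
    and "\<And>v. Cm_on m S (\<lambda>x. D x v)"
  shows "Cm_on (Suc m) S f"
proof -
  have e: "D x = frechet_derivative f (at x)" if "x \<in> S" for x
    using assms(2) frechet_derivative_at that by blast
  have "Cm_on m S (\<lambda>x. frechet_derivative f (at x) v)" for v
    by (rule Cm_on_cong[OF assms(1) _ assms(3)[of v]]) (simp add: e)
  moreover have "\<forall>x\<in>S. f differentiable (at x)" using assms(2) differentiable_def by blast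
  ultimately show ?thesis by simp
qed

lemma Cm_on_Suc_has_derivative:
  "Cm_on (Suc m) S f \<Longrightarrow> x \<in> S \<Longrightarrow> (f has_derivative frechet_derivative f (at x)) (at x)"
  using frechet_derivative_works by auto

lemma Cm_on_Suc_imp: "Cm_on (Suc m) S f \<Longrightarrow> Cm_on m S f"
proof (induction m arbitrary: f)
  case 0
  then show ?case using Cm_on_imp_continuous_on by fastforce
qed auto

lemma Cm_on_const: "Cm_on m S (\<lambda>x. c)"
  by (induction m arbitrary: c) auto

lemma Cm_on_local:
  assumes "\<And>x. x \<in> S \<Longrightarrow> \<exists>T. open T \<and> x \<in> T \<and> Cm_on m T f"
  shows "Cm_on m S f"
  using assms
proof (induction m arbitrary: f)
  case 0
  have "continuous (at x within S) f" if "x \<in> S" for x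
  proof -
    from 0[OF that] obtain T where "open T" "x \<in> T" "continuous_on T f" by auto
    then have "isCont f x" by (simp add: continuous_on_eq_continuous_at)
    then show ?thesis by (rule continuous_at_imp_continuous_at_within)
  qed
  then show ?case by (simp add: continuous_on_eq_continuous_within)
next
  case (Suc m)
  have "f differentiable (at x)" if "x \<in> S" for x
    using Suc.prems[OF that] unfolding Cm_on.simps by blast
  moreover have "Cm_on m S (\<lambda>x. frechet_derivative f (at x) v)" for v
  proof (rule Suc.IH)
    fix x assume "x \<in> S"
    from Suc.prems[OF this] obtain T where "open T" "x \<in> T" "Cm_on (Suc m) T f" by blast
    then show "\<exists>T. open T \<and> x \<in> T \<and> Cm_on m T (\<lambda>x. frechet_derivative f (at x) v)"
      by (intro exI[of _ T]) simp
  qed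
  ultimately show ?case by simp
qed

lemma Cm_on_bounded_linear:
  assumes "bounded_linear L" "open S" "Cm_on m S f"
  shows "Cm_on m S (\<lambda>x. L (f x))"
  using assms(3)
proof (induction m arbitrary: f)
  case 0
  then show ?case using assms(1) by (auto intro: bounded_linear.continuous_on)
next
  case (Suc m)
  show ?case
  proof (rule Cm_on_SucI[OF assms(2)])
    show "((\<lambda>x. L (f x)) has_derivative (\<lambda>v. L (frechet_derivative f (at x) v))) (at x)" if "x \<in> S" for x
      using Cm_on_Suc_has_derivative[OF Suc.prems that] bounded_linear.has_derivative[OF assms(1)]
      by blast
    show "Cm_on m S (\<lambda>x. L (frechet_derivative f (at x) v))" for v
      using Suc by simp
  qed
qed

lemma Cm_on_ident: "Cm_on m S (\<lambda>x. x)"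
proof -
  \<comment> \<open>\<open>Cm_on_SucI\<close> needs an open set, so the claim is shown on
    \<open>UNIV\<close> and then restricted.\<close>
  have "Cm_on m UNIV (\<lambda>x :: 'a. x)"
  proof (cases m)
    case (Suc n)
    have "Cm_on (Suc n) UNIV (\<lambda>x :: 'a. x)"
      by (rule Cm_on_SucI[where D = "\<lambda>_ v. v"]) (auto intro: Cm_on_const)
    then show ?thesis using Suc by simp
  qed (simp add: continuous_on_id)
  then show ?thesis using Cm_on_subset by blast
qed

lemma Cm_on_linear:
  fixes L :: "'a::euclidean_space \<Rightarrow> 'b::euclidean_space"
  assumes "linear L"
  shows "Cm_on m S L"
  using Cm_on_bounded_linear[OF linear_conv_bounded_linear[THEN iffD1, OF assms] open_UNIV Cm_on_ident]
    Cm_on_subset by blast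

lemma Cm_on_add:
  assumes "open S" "Cm_on m S f" "Cm_on m S g"
  shows "Cm_on m S (\<lambda>x. f x + g x)"
  using assms(2,3)
proof (induction m arbitrary: f g)
  case 0
  then show ?case by (auto intro: continuous_intros)
next
  case (Suc m)
  show ?case
  proof (rule Cm_on_SucI[OF assms(1)])
    show "((\<lambda>x. f x + g x) has_derivative
      (\<lambda>v. frechet_derivative f (at x) v + frechet_derivative g (at x) v)) (at x)" if "x \<in> S" for x
      by (intro has_derivative_add Cm_on_Suc_has_derivative[OF Suc.prems(1) that]
          Cm_on_Suc_has_derivative[OF Suc.prems(2) that])
    show "Cm_on m S (\<lambda>x. frechet_derivative f (at x) v + frechet_derivative g (at x) v)" for v
      using Suc by simp
  qed
qed

lemma Cm_on_sum:
  assumes "open S" "\<And>i. i \<in> I \<Longrightarrow> Cm_on m S (f i)"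
  shows "Cm_on m S (\<lambda>x. \<Sum>i\<in>I. f i x)"
  using assms(2)
  by (induction I rule: infinite_finite_induct) (auto intro: Cm_on_const Cm_on_add[OF assms(1)])

lemma Cm_on_bilinear:
  assumes "bounded_bilinear prd" "open S" "Cm_on m S f" "Cm_on m S g"
  shows "Cm_on m S (\<lambda>x. prd (f x) (g x))"
  using assms(3,4)
proof (induction m arbitrary: f g)
  case 0
  then show ?case using bounded_bilinear.continuous_on[OF assms(1)] by auto
next
  case (Suc m)
  show ?case
  proof (rule Cm_on_SucI[OF assms(2)])
    show "((\<lambda>x. prd (f x) (g x)) has_derivative
      (\<lambda>v. prd (f x) (frechet_derivative g (at x) v) + prd (frechet_derivative f (at x) v) (g x))) (at x)"
      if "x \<in> S" for x
      by (intro bounded_bilinear.FDERIV[OF assms(1)] Cm_on_Suc_has_derivative[OF Suc.prems(1) that]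
          Cm_on_Suc_has_derivative[OF Suc.prems(2) that])
    show "Cm_on m S (\<lambda>x. prd (f x) (frechet_derivative g (at x) v) + prd (frechet_derivative f (at x) v) (g x))" for v
      by (intro Cm_on_add[OF assms(2)] Suc.IH) (use Suc.prems Cm_on_Suc_imp in \<open>simp_all only: Cm_on.simps\<close>)
  qed
qed

lemma linear_basis_expansion:
  fixes L :: "'a::euclidean_space \<Rightarrow> 'b::real_vector"
  assumes "linear L"
  shows "L u = (\<Sum>b\<in>Basis. (u \<bullet> b) *\<^sub>R L b)"
proof -
  have "L u = L (\<Sum>b\<in>Basis. (u \<bullet> b) *\<^sub>R b)" by (simp add: euclidean_representation)
  then show ?thesis by (simp add: linear_sum[OF assms] linear_cmul[OF assms])
qed

text \<open>Operators are controlled only through their values at fixed vectors. Expanding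
  \<open>u x\<close> in the basis turns the application to a moving vector into a finite sum of
  products. The chain rule needs this, since there a moving derivative acts on a moving
  vector.\<close>

lemma Cm_on_apply_operator:
  fixes L :: "'c::euclidean_space \<Rightarrow> 'a::euclidean_space \<Rightarrow> 'b::euclidean_space"
  assumes "open S" "\<And>x. x \<in> S \<Longrightarrow> linear (L x)" "\<And>b. Cm_on m S (\<lambda>x. L x b)" "Cm_on m S u"
  shows "Cm_on m S (\<lambda>x. L x (u x))"
proof -
  have "Cm_on m S (\<lambda>x. \<Sum>b\<in>Basis. (u x \<bullet> b) *\<^sub>R L x b)"
    by (intro Cm_on_sum[OF assms(1)] Cm_on_bilinear[OF bounded_bilinear_scaleR assms(1)] assms
        Cm_on_bilinear[OF bounded_bilinear_inner] Cm_on_const)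
  then show ?thesis
    by (rule Cm_on_cong[OF assms(1), rotated])
      (erule linear_basis_expansion[OF assms(2), symmetric])
qed

lemma Cm_on_compose:
  assumes "open S" "open T" "f ` S \<subseteq> T" "Cm_on m S f" "Cm_on m T g"
  shows "Cm_on m S (\<lambda>x. g (f x))"
  using assms(4,5)
proof (induction m arbitrary: g)
  case 0
  then show ?case using assms(3) by (auto intro: continuous_on_compose2)
next
  case (Suc m)
  show ?case
  proof (rule Cm_on_SucI[OF assms(1)])
    show "((\<lambda>x. g (f x)) has_derivative
      (\<lambda>v. frechet_derivative g (at (f x)) (frechet_derivative f (at x) v))) (at x)" if "x \<in> S" for x
      using diff_chain_at[OF Cm_on_Suc_has_derivative[OF Suc.prems(1) that]
          Cm_on_Suc_has_derivative[OF Suc.prems(2)]] assms(3) that by (auto simp: o_def)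
    have fm: "Cm_on m S f" using Suc.prems(1) by (rule Cm_on_Suc_imp)
    show "Cm_on m S (\<lambda>x. frechet_derivative g (at (f x)) (frechet_derivative f (at x) v))" for v
    proof (rule Cm_on_apply_operator[OF assms(1), where L = "\<lambda>x. frechet_derivative g (at (f x))"])
      show "linear (frechet_derivative g (at (f x)))" if "x \<in> S" for x
        using Suc.prems(2) that assms(3) by (auto intro!: linear_frechet_derivative)
      show "Cm_on m S (\<lambda>x. frechet_derivative g (at (f x)) b)" for b
        using Suc.IH[of "\<lambda>y. frechet_derivative g (at y) b"] fm Suc.prems(2) by auto
    qed (use Suc.prems in auto)
  qed
qed

text \<open>A product rule in which one factor is merely continuous: at a zero of \<open>f\<close>
  the derivative of \<open>c\<close> would be multiplied by 0. It makes it possible to differentiate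
  the inverse of an operator when only its continuity is known.\<close>

lemma has_derivative_scaleR_vanishing:
  fixes f :: "'a::real_normed_vector \<Rightarrow> 'b::real_normed_vector"
  assumes f: "(f has_derivative f') (at x)" "f x = 0" and c: "isCont c x"
  shows "((\<lambda>y. c y *\<^sub>R f y) has_derivative (\<lambda>h. c x *\<^sub>R f' h)) (at x)"
proof -
  have bl: "bounded_linear f'" using f(1) has_derivative_bounded_linear by blast
  then obtain K where K: "\<And>h. norm (f' h) \<le> norm h * K" using bounded_linear.bounded by blast
  have lim: "((\<lambda>y. (f y - f' (y - x)) /\<^sub>R norm (y - x)) \<longlongrightarrow> 0) (at x)"
    using f by (simp add: has_derivative_at_within)
  have cl: "(c \<longlongrightarrow> c x) (at x)" using c by (simp add: isCont_def)
  \<comment> \<open>The difference quotient splits into \<open>c y\<close> times the remainder of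
    \<open>f\<close>, which vanishes by differentiability, and \<open>c y - c x\<close> times
    \<open>f'\<close> of a unit direction, which vanishes because \<open>f'\<close> is bounded
    there.\<close>
  have 1: "((\<lambda>y. c y *\<^sub>R ((f y - f' (y - x)) /\<^sub>R norm (y - x))) \<longlongrightarrow> 0) (at x)"
    using tendsto_scaleR[OF cl lim] by simp
  have 2: "((\<lambda>y. (c y - c x) *\<^sub>R (f' (y - x) /\<^sub>R norm (y - x))) \<longlongrightarrow> 0) (at x)"
  proof (rule Lim_null_comparison)
    have "norm ((c y - c x) *\<^sub>R (f' (y - x) /\<^sub>R norm (y - x))) \<le> \<bar>c y - c x\<bar> * K" if "y \<noteq> x" for y
    proof -
      have "norm (f' (y - x) /\<^sub>R norm (y - x)) \<le> K"
        using K[of "y - x"] that by (simp add: field_simps)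
      then show ?thesis unfolding norm_scaleR[of "c y - c x"] real_norm_def by (rule mult_left_mono) simp
    qed
    then show "\<forall>\<^sub>F y in at x. norm ((c y - c x) *\<^sub>R (f' (y - x) /\<^sub>R norm (y - x))) \<le> \<bar>c y - c x\<bar> * K"
      by (auto simp: eventually_at_filter)
    have "((\<lambda>y. \<bar>c y - c x\<bar> * K) \<longlongrightarrow> \<bar>c x - c x\<bar> * K) (at x)"
      by (intro tendsto_intros cl)
    then show "((\<lambda>y. \<bar>c y - c x\<bar> * K) \<longlongrightarrow> 0) (at x)" by simp
  qed
  have "((\<lambda>y. (c y *\<^sub>R f y - c x *\<^sub>R f' (y - x)) /\<^sub>R norm (y - x)) \<longlongrightarrow> 0) (at x)"
    using tendsto_add[OF 1 2] by (simp add: algebra_simps)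
  then show ?thesis
    using f(2) bl by (simp add: has_derivative_at_within bounded_linear_const_scaleR)
qed

text \<open>For \<open>y\<close> near \<open>x\<close> the operators \<open>A y\<close> are bounded
  below by a common constant, because \<open>A x\<close> is. Applying this to
  \<open>w = B y v - B x v\<close>, where \<open>A y w = A x u - A y u\<close> with
  \<open>u = B x v\<close>, reduces continuity of \<open>B\<close> to that of \<open>A\<close> at
  the fixed vector \<open>u\<close>.\<close>

lemma isCont_operator_inverse:
  fixes A B :: "'c::euclidean_space \<Rightarrow> 'a::euclidean_space \<Rightarrow> 'a"
  assumes "open S" "x \<in> S" and lin: "\<And>y. y \<in> S \<Longrightarrow> linear (A y)"
    and inv: "\<And>y v. y \<in> S \<Longrightarrow> B y (A y v) = v" "\<And>y v. y \<in> S \<Longrightarrow> A y (B y v) = v"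
    and cont: "\<And>v. isCont (\<lambda>y. A y v) x"
  shows "isCont (\<lambda>y. B y v) x"
proof -
  have linB: "linear (B x)"
    by (rule left_inverse_linear[OF lin[OF assms(2)]]) (use inv assms(2) in \<open>auto simp: fun_eq_iff\<close>)
  then obtain K where K: "K > 0" "\<And>h. norm (B x h) \<le> K * norm h"
    using linear_bounded_pos by blast
  \<comment> \<open>Bounds the operator norm of \<open>A y - A x\<close> by finitely many values at
    basis vectors.\<close>
  define e where "e y = (\<Sum>b\<in>Basis. norm (A y b - A x b))" for y
  have e0: "(e \<longlongrightarrow> 0) (at x)"
  proof -
    have "(e \<longlongrightarrow> (\<Sum>b\<in>Basis. norm (A x b - A x b))) (at x)"
      unfolding e_def by (intro tendsto_intros) (use cont in \<open>simp add: isCont_def\<close>)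
    then show ?thesis by simp
  qed
  have diff: "norm (A y w - A x w) \<le> norm w * e y" if "y \<in> S" for y w
  proof -
    have "A y w - A x w = (\<Sum>b\<in>Basis. (w \<bullet> b) *\<^sub>R (A y b - A x b))"
      using linear_basis_expansion[OF lin[OF that], of w] linear_basis_expansion[OF lin[OF assms(2)], of w]
      by (simp add: scaleR_diff_right sum_subtractf)
    also have "norm \<dots> \<le> (\<Sum>b\<in>Basis. norm w * norm (A y b - A x b))"
      by (rule sum_norm_le) (auto intro!: mult_right_mono Basis_le_norm)
    finally show ?thesis by (simp add: e_def sum_distrib_left)
  qed
  define u where "u = B x v"
  have "\<forall>\<^sub>F y in at x. y \<in> S" using assms(1,2) by (simp add: eventually_at_in_open')
  \<comment> \<open>With this threshold the perturbation costs at most half of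
    \<open>norm w\<close>, which is then absorbed on the left-hand side.\<close>
  moreover have "\<forall>\<^sub>F y in at x. e y < 1 / (2 * K)"
    using e0 K(1) by (intro order_tendstoD(2)[OF e0]) auto
  ultimately have ev: "\<forall>\<^sub>F y in at x. norm (B y v - B x v) \<le> 2 * K * norm (A y u - A x u)"
  proof eventually_elim
    case (elim y)
    define w where "w = B y v - B x v"
    have Aw: "A y w = A x u - A y u"
      using elim(1) inv assms(2) by (simp add: w_def u_def linear_diff[OF lin])
    have "norm w = norm (B x (A x w))" using inv assms(2) by simp
    also have "\<dots> \<le> K * norm (A x w)" by (rule K)
    also have "\<dots> \<le> K * (norm (A y w) + norm (A y w - A x w))"
      using K(1) norm_triangle_sub[of "A x w" "A y w"] by (simp add: norm_minus_commute)
    also have "\<dots> \<le> K * (norm (A y w) + norm w * e y)"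
      using K(1) diff[OF elim(1)] by simp
    also have "\<dots> \<le> K * (norm (A y w) + norm w * (1 / (2 * K)))"
      using K(1) elim(2) by (intro mult_left_mono add_left_mono) auto
    also have "\<dots> = K * norm (A y w) + norm w / 2" using K(1) by (simp add: field_simps)
    finally have "norm w \<le> 2 * K * norm (A y w)" by simp
    then show ?case by (simp add: w_def[symmetric] Aw norm_minus_commute)
  qed
  have "((\<lambda>y. 2 * K * norm (A y u - A x u)) \<longlongrightarrow> 2 * K * norm (A x u - A x u)) (at x)"
    by (intro tendsto_intros) (use cont in \<open>simp add: isCont_def\<close>)
  then have "((\<lambda>y. B y v - B x v) \<longlongrightarrow> 0) (at x)"
    by (intro Lim_null_comparison[OF ev]) simp
  then show ?thesis unfolding isCont_def using Lim_null by blast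
qed

text \<open>The resolvent identity \<open>B y v = B x v - B x ((A y - A x) (B y v))\<close>,
  expanded in the basis, consists of terms in which a continuous coefficient multiplies a
  differentiable factor vanishing at \<open>x\<close>.\<close>

lemma has_derivative_operator_inverse:
  fixes A B :: "'c::euclidean_space \<Rightarrow> 'a::euclidean_space \<Rightarrow> 'a"
  assumes "open S" "x \<in> S" and lin: "\<And>y. y \<in> S \<Longrightarrow> linear (A y)" "linear (B x)"
    and inv: "\<And>y v. y \<in> S \<Longrightarrow> B y (A y v) = v" "\<And>y v. y \<in> S \<Longrightarrow> A y (B y v) = v"
    and der: "\<And>v. ((\<lambda>y. A y v) has_derivative A' v) (at x)"
  shows "((\<lambda>y. B y v) has_derivative (\<lambda>h. - (\<Sum>b\<in>Basis. (B x v \<bullet> b) *\<^sub>R B x (A' b h)))) (at x)"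
proof -
  have blB: "bounded_linear (B x)" using lin(2) linear_conv_bounded_linear by blast
  have cB: "isCont (\<lambda>y. B y v) x"
    by (rule isCont_operator_inverse[OF assms(1,2) lin(1) inv]) (auto intro: has_derivative_continuous der)
  have t: "((\<lambda>y. (B y v \<bullet> b) *\<^sub>R B x (A y b - A x b)) has_derivative
     (\<lambda>h. (B x v \<bullet> b) *\<^sub>R B x (A' b h))) (at x)" for b
  proof (rule has_derivative_scaleR_vanishing)
    have "((\<lambda>y. A y b - A x b) has_derivative (\<lambda>h. A' b h - 0)) (at x)"
      by (intro has_derivative_diff der has_derivative_const)
    then show "((\<lambda>y. B x (A y b - A x b)) has_derivative (\<lambda>h. B x (A' b h))) (at x)"
      using bounded_linear.has_derivative[OF blB] by fastforce
    show "isCont (\<lambda>y. B y v \<bullet> b) x" using cB by (intro continuous_intros)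
  qed (simp add: linear_0[OF lin(2)])
  have "((\<lambda>y. B x v - (\<Sum>b\<in>Basis. (B y v \<bullet> b) *\<^sub>R B x (A y b - A x b))) has_derivative
     (\<lambda>h. 0 - (\<Sum>b\<in>Basis. (B x v \<bullet> b) *\<^sub>R B x (A' b h)))) (at x)"
    by (intro has_derivative_diff has_derivative_const has_derivative_sum t)
  moreover have "B x v - (\<Sum>b\<in>Basis. (B y v \<bullet> b) *\<^sub>R B x (A y b - A x b)) = B y v" if "y \<in> S" for y
  proof -
    define z where "z = B y v"
    have "(\<Sum>b\<in>Basis. (z \<bullet> b) *\<^sub>R B x (A y b - A x b)) = B x (A y z - A x z)"
      using linear_basis_expansion[of "\<lambda>w. B x (A y w - A x w)" z]
        linear_compose[OF linear_compose_sub[OF lin(1)[OF that] lin(1)[OF assms(2)]] lin(2)]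
      by (simp add: o_def)
    also have "\<dots> = B x v - z" using inv that assms(2) by (simp add: z_def linear_diff[OF lin(2)])
    finally show ?thesis by (simp add: z_def)
  qed
  ultimately show ?thesis
    using has_derivative_transform_within_open[OF _ assms(1,2)] by fastforce
qed

text \<open>The derivative of the inverse is an expression in the inverse itself and the derivatives
  of \<open>A\<close>. If the inverse is of class C^m and \<open>A\<close> of class C^(m+1), that
  expression is of class C^m, so the order rises by one.\<close>

lemma Cm_on_operator_inverse:
  fixes A B :: "'c::euclidean_space \<Rightarrow> 'a::euclidean_space \<Rightarrow> 'a"
  assumes "open S" and linA: "\<And>y. y \<in> S \<Longrightarrow> linear (A y)" and linB: "\<And>y. y \<in> S \<Longrightarrow> linear (B y)"
    and inv: "\<And>y v. y \<in> S \<Longrightarrow> B y (A y v) = v" "\<And>y v. y \<in> S \<Longrightarrow> A y (B y v) = v"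
    and C: "\<And>v. Cm_on m S (\<lambda>y. A y v)"
  shows "Cm_on m S (\<lambda>y. B y v)"
  using C
proof (induction m arbitrary: v)
  case 0
  then have "isCont (\<lambda>y. A y v) x" if "x \<in> S" for x v
    using that assms(1) by (auto simp: continuous_on_eq_continuous_at)
  then show ?case
    using isCont_operator_inverse[OF assms(1) _ linA inv]
    by (auto simp: continuous_on_eq_continuous_at[OF assms(1)])
next
  case (Suc m)
  have IH: "Cm_on m S (\<lambda>y. B y v)" for v using Suc.IH[OF Cm_on_Suc_imp[OF Suc.prems]] .
  let ?A' = "\<lambda>x v. frechet_derivative (\<lambda>y. A y v) (at x)"
  show ?case
  proof (rule Cm_on_SucI[OF assms(1)])
    show "((\<lambda>y. B y v) has_derivative (\<lambda>h. - (\<Sum>b\<in>Basis. (B x v \<bullet> b) *\<^sub>R B x (?A' x b h)))) (at x)"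
      if "x \<in> S" for x
      by (rule has_derivative_operator_inverse[OF assms(1) that linA linB[OF that] inv
            Cm_on_Suc_has_derivative[OF Suc.prems that]])
    show "Cm_on m S (\<lambda>x. - (\<Sum>b\<in>Basis. (B x v \<bullet> b) *\<^sub>R B x (?A' x b h)))" for h
    proof (rule Cm_on_bounded_linear[OF bounded_linear_minus[OF bounded_linear_ident] assms(1)],
        rule Cm_on_sum[OF assms(1)], rule Cm_on_bilinear[OF bounded_bilinear_scaleR assms(1)])
      fix b :: 'a
      show "Cm_on m S (\<lambda>x. B x v \<bullet> b)"
        by (rule Cm_on_bilinear[OF bounded_bilinear_inner assms(1) IH Cm_on_const])
      show "Cm_on m S (\<lambda>x. B x (?A' x b h))"
        by (rule Cm_on_apply_operator[OF assms(1) linB IH]) (use Suc.prems in auto)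
    qed
  qed
qed

abbreviation Cinf_on :: "'a::euclidean_space set \<Rightarrow> ('a \<Rightarrow> 'b::euclidean_space) \<Rightarrow> bool" where
  "Cinf_on S f \<equiv> \<forall>m. Cm_on m S f"

text \<open>\<open>inverse_function_theorem\<close> yields a differentiable local inverse
  \<open>g\<close> whose derivative at \<open>y\<close> is the inverse operator of
  \<open>D (g y)\<close>. Once \<open>g\<close> is of class C^m, so is this operator family, hence
  so is its inverse, and \<open>g\<close> is of class C^(m+1).\<close>

lemma smooth_inverse_function:
  fixes f :: "'a::euclidean_space \<Rightarrow> 'a"
  assumes "open U" "Cinf_on U f" "x0 \<in> U" "(f has_derivative L) (at x0)" "inj L"
  obtains U' V g where "open U'" "U' \<subseteq> U" "x0 \<in> U'" "open V" "f x0 \<in> V" "homeomorphism U' V f g"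
    "Cinf_on V g"
proof -
  define D where "D x = frechet_derivative f (at x)" for x
  have D: "(f has_derivative D x) (at x)" if "x \<in> U" for x
    unfolding D_def using assms(2) that Cm_on_Suc_has_derivative by blast
  have blD: "bounded_linear (D x)" if "x \<in> U" for x
    using D that has_derivative_bounded_linear by blast
  have CD: "Cm_on m U (\<lambda>x. D x v)" for m v
    using assms(2)[rule_format, of "Suc m"] by (simp add: D_def)
  define f' where "f' x = Blinfun (D x)" for x
  have f': "blinfun_apply (f' x) = D x" if "x \<in> U" for x
    using blD[OF that] by (simp add: f'_def bounded_linear_Blinfun_apply)
  have "L = D x0" using assms(3,4) D has_derivative_unique by blast
  then have "inj (D x0)" using assms(5) by simp
  then obtain g0 where g0: "linear g0" "g0 \<circ> D x0 = id"
    using linear_injective_left_inverse blD[OF assms(3)] bounded_linear.linear by blast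
  define invf where "invf = Blinfun g0"
  have invf: "blinfun_apply invf = g0"
    unfolding invf_def
    by (rule bounded_linear_Blinfun_apply[OF linear_conv_bounded_linear[THEN iffD1, OF g0(1)]])
  have *: "invf o\<^sub>L f' x0 = id_blinfun"
    using g0(2) invf f'[OF assms(3)] by (intro blinfun_eqI) (auto simp: fun_eq_iff)
  have contf': "continuous_on U f'"
  proof (rule continuous_on_blinfun_componentwise)
    fix i :: 'a
    have "continuous_on U (\<lambda>x. D x i)" using CD Cm_on_imp_continuous_on by blast
    then show "continuous_on U (\<lambda>x. blinfun_apply (f' x) i)"
      by (simp add: f' cong: continuous_on_cong)
  qed
  have "\<And>x. x \<in> U \<Longrightarrow> (f has_derivative (blinfun_apply (f' x))) (at x)" using D f' by simp
  from inverse_function_theorem[OF assms(1) this contf' assms(3) *]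
  obtain U' V g g' where V: "open U'" "U' \<subseteq> U" "x0 \<in> U'" "open V" "f x0 \<in> V" "homeomorphism U' V f g"
    "\<And>y. y \<in> V \<Longrightarrow> (g has_derivative (g' y)) (at y)"
    "\<And>y. y \<in> V \<Longrightarrow> g' y = inv (blinfun_apply (f'(g y)))"
    "\<And>y. y \<in> V \<Longrightarrow> bij (blinfun_apply (f'(g y)))" by blast
  have gU: "g y \<in> U" if "y \<in> V" for y using V(2,6) that by (auto simp: homeomorphism_def)
  have bijD: "bij (D (g y))" if "y \<in> V" for y using V(9) gU f' that by metis
  have g': "g' y = inv (D (g y))" if "y \<in> V" for y using V(8) gU f' that by metis
  have "Cm_on m V g" for m
  proof (induction m)
    case 0
    then show ?case using V(6) by (simp add: homeomorphism_def)
  next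
    case (Suc m)
    show ?case
    proof (rule Cm_on_SucI[OF V(4) V(7)])
      fix v
      show "Cm_on m V (\<lambda>x. g' x v)"
      proof (rule Cm_on_operator_inverse[OF V(4), where A = "\<lambda>y. D (g y)"])
        fix y v assume y: "y \<in> V"
        show "linear (D (g y))" using blD[OF gU[OF y]] bounded_linear.linear by blast
        show "linear (g' y)" using V(7)[OF y] has_derivative_linear by blast
        show "g' y (D (g y) v) = v" using g'[OF y] bijD[OF y] by (simp add: bij_is_inj)
        show "D (g y) (g' y v) = v" using g'[OF y] bijD[OF y] by (simp add: bij_is_surj surj_f_inv_f)
      next
        fix v
        show "Cm_on m V (\<lambda>y. D (g y) v)"
          by (rule Cm_on_compose[OF V(4) assms(1) _ Suc.IH CD]) (use gU in auto)
      qed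
    qed
  qed
  then show ?thesis using that V by blast
qed

section \<open>Smooth maps on subsets, submersions and immersions\<close>

lemma smooth_on_open_iff: "open S \<Longrightarrow> smooth_on S f \<longleftrightarrow> Cinf_on S f"
proof
  assume S: "open S" and f: "smooth_on S f"
  show "Cinf_on S f"
  proof (intro allI Cm_on_local)
    fix m x assume "x \<in> S"
    then obtain T g where T: "open T" "x \<in> T" "Cinf_on T g" "\<forall>y\<in>S \<inter> T. g y = f y"
      using f unfolding smooth_on_def by blast
    have "Cm_on m (S \<inter> T) f"
      by (rule Cm_on_cong[where f = g]) (use S T Cm_on_subset[of m T g] in auto)
    then show "\<exists>T. open T \<and> x \<in> T \<and> Cm_on m T f" using S T \<open>x \<in> S\<close> by blast
  qed
next
  assume "open S" "Cinf_on S f"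
  then show "smooth_on S f" unfolding smooth_on_def by blast
qed

lemma smooth_on_subset: 
  assumes f: "smooth_on S f" and sub: "T \<subseteq> S"
  shows "smooth_on T f"
proof -
  have "\<exists>U g. open U \<and> x \<in> U \<and> (\<forall>m. Cm_on m U g) \<and> (\<forall>y\<in>T \<inter> U. g y = f y)" if x: "x \<in> T" for x
  proof -
    obtain U g where "open U" "x \<in> U" "\<forall>m. Cm_on m U g" "\<forall>y\<in>S \<inter> U. g y = f y"
      using f x sub unfolding smooth_on_def by (meson subsetD)
    then have "open U \<and> x \<in> U \<and> (\<forall>m. Cm_on m U g) \<and> (\<forall>y\<in>T \<inter> U. g y = f y)" using sub by auto
    then show ?thesis by blast
  qed
  then show ?thesis by (simp add: smooth_on_def)
qed

lemma smooth_on_cong: "smooth_on S f \<Longrightarrow> (\<And>x. x \<in> S \<Longrightarrow> f x = g x) \<Longrightarrow> smooth_on S g"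
  by (simp add: smooth_on_def)

lemma smooth_on_compose:
  assumes "smooth_on S f" "smooth_on T g" "f ` S \<subseteq> T"
  shows "smooth_on S (\<lambda>x. g (f x))"
  unfolding smooth_on_def
proof
  fix x assume x: "x \<in> S"
  then obtain T1 f1 where T1: "open T1" "x \<in> T1" "Cinf_on T1 f1" "\<forall>y\<in>S \<inter> T1. f1 y = f y"
    using assms(1) unfolding smooth_on_def by blast
  have "f x \<in> T" using x assms(3) by auto
  then obtain T2 g2 where T2: "open T2" "f x \<in> T2" "Cinf_on T2 g2" "\<forall>y\<in>T \<inter> T2. g2 y = g y"
    using assms(2) unfolding smooth_on_def by blast
  let ?U = "T1 \<inter> f1 -` T2"
  have "continuous_on T1 f1" using T1(3) Cm_on_imp_continuous_on by blast
  then have U: "open ?U" using T1(1) T2(1) continuous_open_preimage by blast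
  have "Cm_on m ?U (\<lambda>x. g2 (f1 x))" for m
    by (rule Cm_on_compose[OF U T2(1)]) (use T1(3) T2(3) Cm_on_subset[of m T1 f1] in auto)
  moreover have "x \<in> ?U" "\<forall>y\<in>S \<inter> ?U. g2 (f1 y) = g (f y)"
    using x T1 T2 assms(3) by auto
  ultimately show "\<exists>T ga. open T \<and> x \<in> T \<and> (\<forall>m. Cm_on m T ga) \<and> (\<forall>y\<in>S \<inter> T. ga y = g (f y))"
    using U by blast
qed

lemma smooth_on_has_derivative:
  assumes "smooth_on S f" "x \<in> S"
  obtains D where "(f has_derivative D) (at x within S)"
proof -
  obtain T g where T: "open T" "x \<in> T" "Cinf_on T g" "\<forall>y\<in>S \<inter> T. g y = f y"
    using assms unfolding smooth_on_def by blast
  then have "(g has_derivative frechet_derivative g (at x)) (at x within S)"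
    using Cm_on_Suc_has_derivative[of 0 T g x] has_derivative_at_withinI by blast
  then have "(f has_derivative frechet_derivative g (at x)) (at x within S)"
    by (rule has_derivative_transform_eventually)
      (use T assms(2) in \<open>auto simp: eventually_at_topological\<close>)
  then show ?thesis using that by blast
qed

lemma smooth_on_imp_continuous_on: "smooth_on S f \<Longrightarrow> continuous_on S f"
  by (metis continuous_on_eq_continuous_within has_derivative_continuous smooth_on_has_derivative)

lemma smooth_on_linear:
  fixes f :: "'a::euclidean_space \<Rightarrow> 'b::euclidean_space"
  shows "linear f \<Longrightarrow> smooth_on S f"
  using smooth_on_open_iff[OF open_UNIV] Cm_on_linear smooth_on_subset by blast

lemma smooth_on_ident: "smooth_on S (\<lambda>x. x)"
  using smooth_on_linear[OF linear_ident] .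

text \<open>Relative openness keeps a short segment through \<open>x\<close> in direction
  \<open>v\<close> inside \<open>X\<close>, so the claim reduces to uniqueness of derivatives on an
  open set of real parameters.\<close>

lemma has_derivative_within_subspace_unique:
  fixes f :: "'a::euclidean_space \<Rightarrow> 'b::euclidean_space"
  assumes "subspace V" "openin (top_of_set V) X" "x \<in> X"
    and D: "(f has_derivative D) (at x within X)" "(f has_derivative D') (at x within X)"
    and v: "v \<in> V"
  shows "D v = D' v"
proof -
  obtain T where T: "open T" "X = V \<inter> T" using assms(2) by (auto simp: openin_open)
  let ?c = "\<lambda>t::real. x + t *\<^sub>R v"
  let ?N = "?c -` T"
  have N: "open ?N" by (rule continuous_open_vimage[OF T(1)]) (intro continuous_intros)
  have sub: "?c ` ?N \<subseteq> X"
    using T assms(1,3) v by (auto intro: subspace_add subspace_scale)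
  have c: "(?c has_derivative (\<lambda>t. t *\<^sub>R v)) (at 0 within ?N)"
    by (auto intro!: derivative_eq_intros)
  have at: "at (0::real) within ?N = at 0"
    using N T assms(3) by (intro at_within_open) auto
  have "((f \<circ> ?c) has_derivative (D \<circ> (\<lambda>t. t *\<^sub>R v))) (at 0 within ?N)"
    by (rule diff_chain_within[OF c]) (use has_derivative_subset[OF D(1) sub] in simp)
  moreover have "((f \<circ> ?c) has_derivative (D' \<circ> (\<lambda>t. t *\<^sub>R v))) (at 0 within ?N)"
    by (rule diff_chain_within[OF c]) (use has_derivative_subset[OF D(2) sub] in simp)
  ultimately have "D \<circ> (\<lambda>t. t *\<^sub>R v) = D' \<circ> (\<lambda>t. t *\<^sub>R v)"
    unfolding at by (rule has_derivative_unique)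
  then have "(D \<circ> (\<lambda>t. t *\<^sub>R v)) 1 = (D' \<circ> (\<lambda>t. t *\<^sub>R v)) 1" by simp
  then show ?thesis by simp
qed

text \<open>Differentiates the identity \<open>g (f y) = y\<close>. It serves in both directions: it
  makes the differential of an inclusion injective, and it makes the differential of a quotient map
  surjective by way of a smooth lift.\<close>

lemma has_derivative_left_inverse:
  fixes f :: "'a::euclidean_space \<Rightarrow> 'b::euclidean_space"
  assumes "subspace V" "openin (top_of_set V) X" "x \<in> X"
    and D: "(f has_derivative D) (at x within X)"
    and G: "(g has_derivative G) (at (f x) within f ` X)"
    and gf: "\<And>y. y \<in> X \<Longrightarrow> g (f y) = y" and v: "v \<in> V"
  shows "G (D v) = v"
proof -
  have "((g \<circ> f) has_derivative (G \<circ> D)) (at x within X)" by (rule diff_chain_within[OF D G])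
  then have "((\<lambda>y. y) has_derivative (G \<circ> D)) (at x within X)"
    by (rule has_derivative_transform[rotated 2]) (use assms(3) gf in auto)
  from has_derivative_within_subspace_unique[OF assms(1-3) this has_derivative_ident v]
  show ?thesis by simp
qed

text \<open>A right inverse \<open>R\<close> of \<open>D\<close> on \<open>V\<close> gives a slice
  through \<open>a\<close> along which \<open>f\<close> is a local diffeomorphism onto
  \<open>V\<close>; the section is the slice composed with the local inverse.\<close>

lemma submersion_local_section:
  fixes f :: "'a::euclidean_space \<Rightarrow> 'e::euclidean_space"
  assumes "open S" "smooth_on S f" "subspace V" "f ` S \<subseteq> V" "a \<in> S"
    and D: "(f has_derivative D) (at a)" and surj: "V \<subseteq> range D"
  obtains T \<sigma> where "open T" "f a \<in> T" "smooth_on T \<sigma>" "\<sigma> (f a) = a" "\<sigma> ` T \<subseteq> S"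
    "\<And>y. y \<in> T \<inter> V \<Longrightarrow> f (\<sigma> y) = y"
proof -
  have Cf: "Cinf_on S f" using assms(1,2) smooth_on_open_iff by blast
  have linD: "linear D" using D has_derivative_linear by blast
  obtain R where R: "linear R" "\<And>v. v \<in> V \<Longrightarrow> D (R v) = v"
    using linear_exists_right_inverse_on[OF linD subspace_UNIV] surj by blast
  obtain \<pi> where p: "linear \<pi>" "range \<pi> \<subseteq> V" "\<And>v. v \<in> V \<Longrightarrow> \<pi> v = v"
    using linear_exists_left_inverse_on[OF linear_id assms(3)] by auto
  txt \<open>Off \<open>V\<close> the composition \<open>f \<circ> s\<close> is corrected by the component transverse to \<open>V\<close>, so that the
    derivative of \<open>h\<close> at \<open>f a\<close> is the identity of the ambient space.\<close>
  define s where "s y = a + R (\<pi> (y - f a))" for y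
  define h where "h y = f (s y) + ((y - f a) - \<pi> (y - f a))" for y
  have lin: "linear (\<lambda>y. R (\<pi> y))" using linear_compose[OF p(1) R(1)] by (simp add: o_def)
  have s_alt: "s = (\<lambda>y. R (\<pi> y) + (a - R (\<pi> (f a))))"
    by (auto simp: s_def linear_diff[OF p(1)] linear_diff[OF R(1)])
  have Cs: "Cm_on m UNIV s" for m
    unfolding s_alt by (rule Cm_on_add[OF open_UNIV Cm_on_linear[OF lin] Cm_on_const])
  let ?U = "s -` S"
  have U: "open ?U"
    using continuous_open_vimage[OF assms(1)] Cs Cm_on_imp_continuous_on
    by (metis continuous_on_eq_continuous_at open_UNIV UNIV_I)
  have Ch: "Cm_on m ?U h" for m
  proof -
    have "linear (\<lambda>y. y - \<pi> y)" by (intro linear_compose_sub linear_ident p)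
    then have "Cm_on m ?U (\<lambda>y. (y - \<pi> y) + (\<pi> (f a) - f a))"
      by (rule Cm_on_add[OF U Cm_on_linear Cm_on_const])
    moreover have "Cm_on m ?U (\<lambda>y. f (s y))"
      by (rule Cm_on_compose[OF U assms(1)]) (use Cs Cm_on_subset[of m UNIV s] Cf in auto)
    ultimately have "Cm_on m ?U (\<lambda>y. f (s y) + ((y - \<pi> y) + (\<pi> (f a) - f a)))"
      using Cm_on_add[OF U] by blast
    moreover have "h = (\<lambda>y. f (s y) + ((y - \<pi> y) + (\<pi> (f a) - f a)))"
      by (auto simp: h_def linear_diff[OF p(1)])
    ultimately show ?thesis by simp
  qed
  have s0: "s (f a) = a" by (simp add: s_def linear_0[OF p(1)] linear_0[OF R(1)])
  have blp: "bounded_linear \<pi>" "bounded_linear (\<lambda>y. R (\<pi> y))"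
    using p(1) lin linear_conv_bounded_linear by auto
  have "(s has_derivative (\<lambda>v. R (\<pi> v))) (at (f a))"
    unfolding s_alt using has_derivative_add[OF bounded_linear_imp_has_derivative[OF blp(2)] has_derivative_const]
    by fastforce
  then have "((f \<circ> s) has_derivative (D \<circ> (\<lambda>v. R (\<pi> v)))) (at (f a))"
    by (rule diff_chain_at) (simp add: s0 D)
  moreover have "((\<lambda>y. (y - f a) - \<pi> (y - f a)) has_derivative (\<lambda>v. v - \<pi> v)) (at (f a))"
    by (auto intro!: derivative_eq_intros bounded_linear.has_derivative[OF blp(1)])
  ultimately have "((\<lambda>y. (f \<circ> s) y + ((y - f a) - \<pi> (y - f a))) has_derivative
      (\<lambda>v. (D \<circ> (\<lambda>v. R (\<pi> v))) v + (v - \<pi> v))) (at (f a))"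
    by (rule has_derivative_add)
  moreover have "(\<lambda>v. (D \<circ> (\<lambda>v. R (\<pi> v))) v + (v - \<pi> v)) = (\<lambda>v. v)"
    using R(2) p(2) by (auto simp: fun_eq_iff image_subset_iff)
  ultimately have dh: "(h has_derivative (\<lambda>v. v)) (at (f a))" by (simp add: h_def[abs_def] o_def)
  have h0: "h (f a) = f a" by (simp add: h_def s0 linear_0[OF p(1)])
  from smooth_inverse_function[OF U _ _ dh] Ch s0 assms(5)
  obtain U' V' g where g: "open U'" "U' \<subseteq> ?U" "f a \<in> U'" "open V'" "f a \<in> V'" "homeomorphism U' V' h g"
    "Cinf_on V' g" by (auto simp: h0)
  define \<sigma> where "\<sigma> y = s (g y)" for y
  have "Cm_on m V' \<sigma>" for m
    unfolding \<sigma>_def by (rule Cm_on_compose[OF g(4) open_UNIV _ _ Cs]) (use g(7) in auto)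
  then have "smooth_on V' \<sigma>" using smooth_on_open_iff g(4) by blast
  moreover have "g (f a) = f a" using g(3,6) h0 by (metis homeomorphism_def)
  then have "\<sigma> (f a) = a" by (simp add: \<sigma>_def s0)
  moreover have S: "\<sigma> ` V' \<subseteq> S" using g(2,6) by (auto simp: \<sigma>_def homeomorphism_def)
  moreover have "f (\<sigma> y) = y" if "y \<in> V' \<inter> V" for y
  proof -
    \<comment> \<open>\<open>w\<close> is the transverse correction, so \<open>\<pi> w = 0\<close>;
      as a difference of two points of \<open>V\<close> it is also fixed by \<open>\<pi>\<close>,
      hence it is 0.\<close>
    define w where "w = (g y - f a) - \<pi> (g y - f a)"
    have e: "f (\<sigma> y) + w = y"
      using g(6) that by (auto simp: homeomorphism_def h_def \<sigma>_def w_def)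
    have "f (\<sigma> y) \<in> V" using S assms(4) that by blast
    moreover have "w = y - f (\<sigma> y)" using e by (simp add: algebra_simps)
    ultimately have "w \<in> V" using that subspace_diff[OF assms(3)] by simp
    then have "\<pi> w = w" by (rule p(3))
    moreover have "\<pi> w = 0"
      using p(2,3) by (simp add: w_def linear_diff[OF p(1)] image_subset_iff)
    ultimately show ?thesis using e by simp
  qed
  ultimately show ?thesis using that[OF g(4,5)] by blast
qed

text \<open>A left inverse \<open>L\<close> of the differential makes \<open>L\<close> composed with
  \<open>f\<close> a local diffeomorphism of \<open>V\<close>; padding by \<open>x - \<pi> x\<close>
  makes it one of the ambient space. If \<open>g\<close> inverts the padded map, then
  \<open>g\<close> after \<open>L\<close> is the required left inverse.\<close>

lemma immersion_local_left_inverse: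
  fixes f :: "'e::euclidean_space \<Rightarrow> 'a::euclidean_space"
  assumes "subspace V" "openin (top_of_set V) X" "x0 \<in> X" "smooth_on X f"
    and D: "(f has_derivative D) (at x0 within X)" and inj: "inj_on D V"
  obtains T r N where "open T" "f x0 \<in> T" "smooth_on T r" "open N" "x0 \<in> N"
    "\<And>x. x \<in> X \<inter> N \<Longrightarrow> f x \<in> T \<and> r (f x) = x"
proof -
  have XV: "X \<subseteq> V" using assms(2) openin_subset by fastforce
  obtain T1 k where T1: "open T1" "x0 \<in> T1" "Cinf_on T1 k" "\<forall>y\<in>X \<inter> T1. k y = f y"
    using assms(3,4) unfolding smooth_on_def by blast
  define D' where "D' = frechet_derivative k (at x0)"
  have D': "(k has_derivative D') (at x0)"
    using Cm_on_Suc_has_derivative[of 0 T1 k x0] T1 unfolding D'_def by blast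
  have linD': "linear D'" using D' has_derivative_linear by blast
  have "(f has_derivative D') (at x0 within X)"
    by (rule has_derivative_transform_eventually[OF has_derivative_at_withinI[OF D']])
      (use T1 assms(3) in \<open>auto simp: eventually_at_topological\<close>)
  then have "D v = D' v" if "v \<in> V" for v
    using has_derivative_within_subspace_unique[OF assms(1-3) D _ that] by blast
  then have "inj_on D' V" using inj by (auto simp: inj_on_def)
  then obtain L where L: "linear L" "\<And>v. v \<in> V \<Longrightarrow> L (D' v) = v"
    using linear_exists_left_inverse_on[OF linD' assms(1)] by blast
  obtain \<pi> where p: "linear \<pi>" "range \<pi> \<subseteq> V" "\<And>v. v \<in> V \<Longrightarrow> \<pi> v = v"
    using linear_exists_left_inverse_on[OF linear_id assms(1)] by auto
  have px0: "\<pi> x0 = x0" using p XV assms(3) by blast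
  have bl: "bounded_linear L" "bounded_linear \<pi>" using L(1) p(1) linear_conv_bounded_linear by auto
  define h where "h x = L (k (\<pi> x)) + (x - \<pi> x)" for x
  let ?U = "\<pi> -` T1"
  have U: "open ?U"
    by (rule continuous_open_vimage[OF T1(1)]) (use bl(2) in \<open>simp add: linear_continuous_at\<close>)
  have "linear (\<lambda>y. y - \<pi> y)" by (intro linear_compose_sub linear_ident p)
  moreover have "Cm_on m ?U (\<lambda>x. k (\<pi> x))" for m
    by (rule Cm_on_compose[OF U T1(1) _ Cm_on_linear[OF p(1)]]) (use T1(3) in auto)
  ultimately have Ch: "Cm_on m ?U h" for m
    unfolding h_def using Cm_on_add[OF U Cm_on_bounded_linear[OF bl(1) U] Cm_on_linear] by blast
  have "((k \<circ> \<pi>) has_derivative (D' \<circ> \<pi>)) (at x0)"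
    by (rule diff_chain_at[OF bounded_linear_imp_has_derivative[OF bl(2)]]) (simp add: px0 D')
  then have "((\<lambda>x. L ((k \<circ> \<pi>) x) + (x - \<pi> x)) has_derivative (\<lambda>v. L ((D' \<circ> \<pi>) v) + (v - \<pi> v))) (at x0)"
    by (intro has_derivative_add bounded_linear.has_derivative[OF bl(1)] has_derivative_diff
        has_derivative_ident bounded_linear_imp_has_derivative[OF bl(2)])
  moreover have "(\<lambda>v. L ((D' \<circ> \<pi>) v) + (v - \<pi> v)) = (\<lambda>v. v)"
    using L(2) p(2) by (auto simp: fun_eq_iff image_subset_iff)
  ultimately have dh: "(h has_derivative (\<lambda>v. v)) (at x0)" by (simp add: h_def[abs_def] o_def)
  from smooth_inverse_function[OF U _ _ dh] Ch px0 T1(2)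
  obtain U' V' g where g: "open U'" "U' \<subseteq> ?U" "x0 \<in> U'" "open V'" "h x0 \<in> V'" "homeomorphism U' V' h g"
    "Cinf_on V' g" by auto
  have hx: "h x = L (f x)" if "x \<in> X \<inter> T1" for x
    using that XV p(3) T1(4) by (auto simp: h_def)
  have T: "open (L -` V')"
    by (rule continuous_open_vimage[OF g(4)]) (use bl(1) in \<open>simp add: linear_continuous_at\<close>)
  show ?thesis
  proof (rule that[of "L -` V'" "\<lambda>x. g (L x)" "U' \<inter> T1"])
    show "f x0 \<in> L -` V'" using hx[of x0] g(5) T1(2) assms(3) by simp
    have "Cm_on m (L -` V') (\<lambda>x. g (L x))" for m
      by (rule Cm_on_compose[OF T g(4) _ Cm_on_linear[OF L(1)]]) (use g(7) in auto)
    then show "smooth_on (L -` V') (\<lambda>x. g (L x))" using smooth_on_open_iff T by blast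
    show "f x \<in> L -` V' \<and> g (L (f x)) = x" if "x \<in> X \<inter> (U' \<inter> T1)" for x
    proof -
      have "h x \<in> V' \<and> g (h x) = x" using that g(6) by (auto simp: homeomorphism_def)
      then show ?thesis using hx[of x] that by simp
    qed
  qed (use T g T1 in auto)
qed

section \<open>Manifolds with globally parametrized charts\<close>

text \<open>One construction for the classes and for sets of matrices: \<open>h\<close> places the
  points in a Euclidean space, and the chart formulas \<open>c i\<close> live on open sets there.
  For sets of matrices \<open>h\<close> is the identity.\<close>

definition param_manifold ::
  "'p set \<Rightarrow> ('p \<Rightarrow> 'a::euclidean_space) \<Rightarrow> 'e set \<Rightarrow> 'i set \<Rightarrow> ('i \<Rightarrow> 'a set) \<Rightarrow> ('i \<Rightarrow> 'a \<Rightarrow> 'e) \<Rightarrow>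
   ('p, 'e::euclidean_space) manifold" where
  "param_manifold G h V I D c =
    \<lparr>mtop = pullback_topology G h euclidean, model = V, atlas = (\<lambda>i. (G \<inter> h -` D i, c i \<circ> h)) ` I\<rparr>"

lemma param_manifold_simps [simp]:
  "mtop (param_manifold G h V I D c) = pullback_topology G h euclidean"
  "model (param_manifold G h V I D c) = V"
  "atlas (param_manifold G h V I D c) = (\<lambda>i. (G \<inter> h -` D i, c i \<circ> h)) ` I"
  by (simp_all add: param_manifold_def)

lemma pullback_topology_id: "pullback_topology S id euclidean = top_of_set S"
  unfolding topology_eq by (auto simp: openin_pullback_topology openin_open)

lemma continuous_map_pullback_topology: "continuous_map (pullback_topology A f T) T f"
  using continuous_map_pullback[OF continuous_map_id] by simp

text \<open>The points of the manifold are identified through \<open>h\<close> with a subset of a Euclidean space. Every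
  chart is onto the whole model, so its inverse \<open>p i\<close> is defined on all of \<open>V\<close>.\<close>

locale param_atlas =
  fixes G :: "'p set" and h :: "'p \<Rightarrow> 'a::euclidean_space" and V :: "'e::euclidean_space set"
    and I :: "'i set" and D :: "'i \<Rightarrow> 'a set" and c :: "'i \<Rightarrow> 'a \<Rightarrow> 'e" and p :: "'i \<Rightarrow> 'e \<Rightarrow> 'a"
  assumes inj: "inj_on h G" and V: "subspace V"
    and D: "i \<in> I \<Longrightarrow> open (D i)" and cover: "h ` G \<subseteq> (\<Union>i\<in>I. D i)"
    and c: "i \<in> I \<Longrightarrow> smooth_on (D i) (c i)" and p: "i \<in> I \<Longrightarrow> smooth_on V (p i)"
    and cV: "i \<in> I \<Longrightarrow> x \<in> h ` G \<inter> D i \<Longrightarrow> c i x \<in> V"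
    and pD: "i \<in> I \<Longrightarrow> v \<in> V \<Longrightarrow> p i v \<in> h ` G \<inter> D i"
    and cp: "i \<in> I \<Longrightarrow> v \<in> V \<Longrightarrow> c i (p i v) = v"
    and pc: "i \<in> I \<Longrightarrow> x \<in> h ` G \<inter> D i \<Longrightarrow> p i (c i x) = x"
begin

abbreviation "U i \<equiv> G \<inter> h -` D i"
abbreviation "chart i \<equiv> c i \<circ> h"
abbreviation "mfd \<equiv> param_manifold G h V I D c"

lemma chart_image: "i \<in> I \<Longrightarrow> chart i ` U i = V"
proof
  assume i: "i \<in> I"
  show "chart i ` U i \<subseteq> V" using cV[OF i] by auto
  show "V \<subseteq> chart i ` U i"
  proof
    fix v assume v: "v \<in> V"
    then obtain g where "g \<in> G" "h g = p i v" "h g \<in> D i" using pD[OF i v] by auto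
    then show "v \<in> chart i ` U i" using cp[OF i v] by (intro image_eqI[of _ _ g]) auto
  qed
qed

lemma inv_chart:
  assumes i: "i \<in> I" and v: "v \<in> V"
  shows "inv_into (U i) (chart i) v \<in> U i" "h (inv_into (U i) (chart i) v) = p i v"
proof -
  let ?u = "inv_into (U i) (chart i) v"
  have v': "v \<in> chart i ` U i" using chart_image[OF i] v by simp
  show u: "?u \<in> U i" by (rule inv_into_into[OF v'])
  have "chart i ?u = v" by (rule f_inv_into_f[OF v'])
  then have "c i (h ?u) = v" by simp
  moreover have "p i (c i (h ?u)) = h ?u" using u by (intro pc[OF i]) auto
  ultimately show "h ?u = p i v" by simp
qed

text \<open>Through \<open>h\<close> the manifold inherits the Hausdorff property and second
  countability from Euclidean space.\<close>

lemma homeomorphic_h: "homeomorphic_map (mtop mfd) (top_of_set (h ` G)) h"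
  unfolding homeomorphic_map_maps homeomorphic_maps_def
proof (intro exI conjI)
  show "continuous_map (mtop mfd) (top_of_set (h ` G)) h"
    by (auto simp: continuous_map_in_subtopology continuous_map_pullback_topology topspace_pullback_topology)
  show "continuous_map (top_of_set (h ` G)) (mtop mfd) (inv_into G h)"
    unfolding param_manifold_simps
  proof (rule continuous_map_pullback')
    show "continuous_map (top_of_set (h ` G)) euclidean (h \<circ> inv_into G h)"
      by (rule continuous_map_eq[where f = id])
        (auto simp: f_inv_into_f simp del: continuous_map_iff_continuous intro: continuous_map_from_subtopology)
  qed (auto simp: inv_into_into)
qed (auto simp: topspace_pullback_topology inj f_inv_into_f)

lemma openin_U: "i \<in> I \<Longrightarrow> openin (mtop mfd) (U i)"
  using D by (auto simp: openin_pullback_topology)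

lemma is_chart: 
  assumes i: "i \<in> I"
  shows "is_chart mfd (U i) (chart i)"
  unfolding is_chart_def chart_image[OF i] param_manifold_simps
proof (intro conjI)
  show "openin (pullback_topology G h euclidean) (U i)" using openin_U[OF i] by simp
  show "homeomorphic_map (subtopology (pullback_topology G h euclidean) (U i)) (top_of_set V) (chart i)"
    unfolding homeomorphic_map_maps homeomorphic_maps_def
  proof (intro exI conjI)
    let ?X = "subtopology (pullback_topology G h euclidean) (U i)"
    have h: "continuous_map ?X (top_of_set (D i)) h"
      by (auto simp: continuous_map_in_subtopology continuous_map_from_subtopology
          continuous_map_pullback_topology topspace_pullback_topology)
    have "continuous_map (top_of_set (D i)) euclidean (c i)"
      using smooth_on_imp_continuous_on[OF c[OF i]] by simp
    then have "continuous_map ?X euclidean (chart i)" by (rule continuous_map_compose[OF h])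
    then show "continuous_map ?X (top_of_set V) (chart i)"
      using chart_image[OF i] by (auto simp: continuous_map_in_subtopology topspace_pullback_topology)
    show "continuous_map (top_of_set V) ?X (inv_into (U i) (chart i))"
      unfolding continuous_map_in_subtopology
    proof
      show "continuous_map (top_of_set V) (pullback_topology G h euclidean) (inv_into (U i) (chart i))"
      proof (rule continuous_map_pullback')
        have "continuous_map (top_of_set V) euclidean (p i)"
          using smooth_on_imp_continuous_on[OF p[OF i]] by simp
        then show "continuous_map (top_of_set V) euclidean (h \<circ> inv_into (U i) (chart i))"
          by (rule continuous_map_eq) (use inv_chart[OF i] in auto)
      qed (use inv_chart[OF i] in auto)
    qed (use inv_chart[OF i] in auto)
    have "inj_on (chart i) (U i)"
      using pc[OF i] inj unfolding inj_on_def by (metis IntD1 IntD2 Int_iff comp_apply image_eqI vimageE)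
    then show "\<forall>x\<in>topspace ?X. inv_into (U i) (chart i) (chart i x) = x"
      using inv_into_f_f[OF \<open>inj_on (chart i) (U i)\<close>] by (auto simp: topspace_pullback_topology)
    show "\<forall>y\<in>topspace (top_of_set V). chart i (inv_into (U i) (chart i) y) = y"
      using inv_chart[OF i] cp[OF i] by simp
  qed
qed simp

lemma smooth_manifold: "smooth_manifold mfd"
  unfolding smooth_manifold_def
proof (intro conjI)
  have hs: "mtop mfd homeomorphic_space top_of_set (h ` G)"
    using homeomorphic_h homeomorphic_map_imp_homeomorphic_space by blast
  show "Hausdorff_space (mtop mfd)"
    using homeomorphic_Hausdorff_space[OF hs] Hausdorff_space_subtopology[OF Hausdorff_space_euclidean] by blast
  obtain \<B> :: "'a set set" where B: "countable \<B>" "\<And>C. C \<in> \<B> \<Longrightarrow> open C"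
       "\<And>S. open S \<Longrightarrow> \<exists>U. U \<subseteq> \<B> \<and> S = \<Union>U"
    using univ_second_countable by blast
  have "second_countable (euclidean :: 'a topology)"
    unfolding second_countable_def
  proof (intro exI conjI allI impI)
    fix S x assume "openin euclidean S \<and> (x :: 'a) \<in> S"
    then show "\<exists>C\<in>\<B>. x \<in> C \<and> C \<subseteq> S" using B(3)[of S] by auto
  qed (use B in auto)
  then show "second_countable (mtop mfd)"
    using homeomorphic_space_second_countability[OF hs] second_countable_subtopology by blast
  show "subspace (model mfd)" using V by simp
  show "\<forall>(U, \<psi>)\<in>atlas mfd. is_chart mfd U \<psi>" using is_chart by auto
  show "(\<Union>(U, \<psi>)\<in>atlas mfd. U) = topspace (mtop mfd)"
    using cover by (fastforce simp: topspace_pullback_topology)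
  show "\<forall>(U, \<psi>)\<in>atlas mfd. \<forall>(W, \<theta>)\<in>atlas mfd. smooth_on (\<psi> ` (U \<inter> W)) (\<theta> \<circ> inv_into U \<psi>)"
  proof -
    have "smooth_on (chart i ` (U i \<inter> U j)) (chart j \<circ> inv_into (U i) (chart i))"
      if i: "i \<in> I" and j: "j \<in> I" for i j
    proof -
      \<comment> \<open>In coordinates the change of charts is \<open>c j\<close> after
        \<open>p i\<close>, so its domain has to lie in the preimage of \<open>D j\<close> under
        \<open>p i\<close>.\<close>
      have sub: "chart i ` (U i \<inter> U j) \<subseteq> V \<inter> p i -` D j" using cV[OF i] pc[OF i] by auto
      have "smooth_on (V \<inter> p i -` D j) (\<lambda>v. c j (p i v))"
        by (rule smooth_on_compose[OF smooth_on_subset[OF p[OF i]] c[OF j]]) auto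
      then have "smooth_on (chart i ` (U i \<inter> U j)) (\<lambda>v. c j (p i v))"
        by (rule smooth_on_subset[OF _ sub])
      then show ?thesis
      proof (rule smooth_on_cong)
        fix v assume "v \<in> chart i ` (U i \<inter> U j)"
        then have "v \<in> V" using sub by blast
        then show "c j (p i v) = (chart j \<circ> inv_into (U i) (chart i)) v" using inv_chart(2)[OF i] by simp
      qed
    qed
    then show ?thesis by auto
  qed
qed

end

text \<open>In charts the inclusion reads \<open>c2 j\<close> after \<open>p1 i\<close>. The smooth
  map \<open>c1 i\<close> after \<open>p2 j\<close> undoes it, so its differential is injective
  along \<open>V1\<close>.\<close>

lemma param_atlas_smooth_immersion_id:
  assumes "param_atlas S1 id V1 I1 D1 c1 p1" "param_atlas S2 id V2 I2 D2 c2 p2" "S1 \<subseteq> S2"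
  shows "smooth_immersion (param_manifold S1 id V1 I1 D1 c1) (param_manifold S2 id V2 I2 D2 c2) id"
proof -
  interpret A: param_atlas S1 id V1 I1 D1 c1 p1 by fact
  interpret B: param_atlas S2 id V2 I2 D2 c2 p2 by fact
  let ?M = "param_manifold S1 id V1 I1 D1 c1" and ?N = "param_manifold S2 id V2 I2 D2 c2"
  have cont: "continuous_map (mtop ?M) (mtop ?N) id"
    unfolding param_manifold_simps pullback_topology_id
    using assms(3) by (auto simp: continuous_map_in_subtopology intro: continuous_on_id)
  have main: "smooth_on (A.chart i ` (A.U i \<inter> id -` B.U j)) (B.chart j \<circ> id \<circ> inv_into (A.U i) (A.chart i))"
     "\<And>x. x \<in> A.U i \<inter> id -` B.U j \<Longrightarrow>
      \<exists>D. differential_in_charts id x (A.U i, A.chart i) (B.U j, B.chart j) D \<and> inj_on D V1"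
    if i: "i \<in> I1" and j: "j \<in> I2" for i j
  proof -
    let ?X = "A.chart i ` (A.U i \<inter> id -` B.U j)" and ?f = "B.chart j \<circ> id \<circ> inv_into (A.U i) (A.chart i)"
    \<comment> \<open>This form of the chart domain shows that it is relatively open in
      \<open>V1\<close>, which the uniqueness of derivatives along \<open>V1\<close>
      requires.\<close>
    have XV: "?X = V1 \<inter> p1 i -` D2 j"
    proof
      show "?X \<subseteq> V1 \<inter> p1 i -` D2 j" using A.cV[OF i] A.pc[OF i] by auto
      show "V1 \<inter> p1 i -` D2 j \<subseteq> ?X"
      proof
        fix v assume "v \<in> V1 \<inter> p1 i -` D2 j"
        then show "v \<in> ?X" using A.pD[OF i] A.cp[OF i] assms(3)
          by (intro image_eqI[of _ _ "p1 i v"]) auto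
      qed
    qed
    have f: "?f v = c2 j (p1 i v)" if "v \<in> V1" for v using A.inv_chart[OF i that] by simp
    have "smooth_on ?X (\<lambda>v. c2 j (p1 i v))"
      unfolding XV by (rule smooth_on_compose[OF smooth_on_subset[OF A.p[OF i]] B.c[OF j]]) auto
    then show sm: "smooth_on ?X ?f" by (rule smooth_on_cong) (use XV f in auto)
    fix x assume x: "x \<in> A.U i \<inter> id -` B.U j"
    then have x': "A.chart i x \<in> ?X" by blast
    obtain D where D: "(?f has_derivative D) (at (A.chart i x) within ?X)"
      using smooth_on_has_derivative[OF sm x'] by blast
    have sub: "subspace V1" "openin (top_of_set V1) ?X"
      unfolding XV using A.V B.D[OF j] continuous_openin_preimage_gen[OF smooth_on_imp_continuous_on[OF A.p[OF i]]]
      by auto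
    have fX: "?f ` ?X \<subseteq> V2 \<inter> p2 j -` D1 i"
    proof
      fix y assume "y \<in> ?f ` ?X"
      then obtain v where v: "v \<in> V1" "p1 i v \<in> D2 j" "y = c2 j (p1 i v)" unfolding XV using f by auto
      have q: "p1 i v \<in> S1 \<inter> D1 i" using A.pD[OF i v(1)] by simp
      then show "y \<in> V2 \<inter> p2 j -` D1 i" using B.cV[OF j] B.pc[OF j] v assms(3) by auto
    qed
    have gf: "c1 i (p2 j (?f v)) = v" if "v \<in> ?X" for v
    proof -
      from that have v: "v \<in> V1" "p1 i v \<in> D2 j" unfolding XV by auto
      have q: "p1 i v \<in> S1 \<inter> D1 i" using A.pD[OF i v(1)] by simp
      then show ?thesis using B.pc[OF j] v assms(3) f[OF v(1)] A.cp[OF i v(1)] by auto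
    qed
    have "smooth_on (V2 \<inter> p2 j -` D1 i) (\<lambda>v. c1 i (p2 j v))"
      by (rule smooth_on_compose[OF smooth_on_subset[OF B.p[OF j]] A.c[OF i]]) auto
    then have "smooth_on (?f ` ?X) (\<lambda>v. c1 i (p2 j v))" by (rule smooth_on_subset[OF _ fX])
    then obtain E where E: "((\<lambda>v. c1 i (p2 j v)) has_derivative E) (at (?f (A.chart i x)) within ?f ` ?X)"
      by (rule smooth_on_has_derivative) (use x' in blast)
    have "E (D v) = v" if "v \<in> V1" for v
      by (rule has_derivative_left_inverse[OF sub x' D E gf that])
    then have "inj_on D V1" by (metis inj_onI)
    then show "\<exists>D. differential_in_charts id x (A.U i, A.chart i) (B.U j, B.chart j) D \<and> inj_on D V1"
      using D unfolding differential_in_charts_def by auto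
  qed
  show ?thesis
    unfolding smooth_immersion_def smooth_map_def
    using cont main by auto
qed

lemma param_atlas_UNIV: "param_atlas UNIV id UNIV {()} (\<lambda>_. UNIV) (\<lambda>_. id) (\<lambda>_. id)"
  by unfold_locales (auto simp: smooth_on_ident id_def)

text \<open>Presents the ambient matrix space as a one-chart instance, so that the inclusion lemma
  for parametrized atlases also covers the orthogonal group.\<close>

lemma open_manifold_UNIV:
  "open_manifold (UNIV :: 'a::euclidean_space set) = param_manifold UNIV id UNIV {()} (\<lambda>_. UNIV) (\<lambda>_. id)"
  by (simp add: open_manifold_def param_manifold_def pullback_topology_id)

lemma param_atlas_embedded_submanifold:
  assumes "param_atlas S1 id V1 I1 D1 c1 p1" "param_atlas S2 id V2 I2 D2 c2 p2" "S1 \<subseteq> S2"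
  shows "embedded_submanifold (param_manifold S2 id V2 I2 D2 c2) S1 (param_manifold S1 id V1 I1 D1 c1)"
proof -
  interpret A: param_atlas S1 id V1 I1 D1 c1 p1 by fact
  show ?thesis
    unfolding embedded_submanifold_def
    using A.smooth_manifold param_atlas_smooth_immersion_id[OF assms] assms(3)
    by (simp add: topspace_pullback_topology pullback_topology_id subtopology_subtopology Int_absorb1)
qed

section \<open>Charts of submanifolds and quotient manifolds\<close>

lemma smooth_on_localI:
  assumes "\<And>x. x \<in> S \<Longrightarrow> \<exists>T g. open T \<and> x \<in> T \<and> smooth_on T g \<and> (\<forall>y\<in>S \<inter> T. g y = f y)"
  shows "smooth_on S f"
  unfolding smooth_on_def
proof
  fix x assume "x \<in> S"
  then obtain T g where "open T" "x \<in> T" "smooth_on T g" "\<forall>y\<in>S \<inter> T. g y = f y" using assms by blast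
  then show "\<exists>T g. open T \<and> x \<in> T \<and> (\<forall>m. Cm_on m T g) \<and> (\<forall>y\<in>S \<inter> T. g y = f y)"
    using smooth_on_open_iff by blast
qed

lemma smooth_on_local:
  assumes "\<And>x. x \<in> S \<Longrightarrow> \<exists>T. open T \<and> x \<in> T \<and> smooth_on (S \<inter> T) f"
  shows "smooth_on S f"
  unfolding smooth_on_def
proof
  fix x assume x: "x \<in> S"
  obtain T where T: "open T" "x \<in> T" "smooth_on (S \<inter> T) f" using assms[OF x] by blast
  have "x \<in> S \<inter> T" using x T(2) by blast
  then obtain U g where U: "open U" "x \<in> U" "Cinf_on U g" "\<forall>y\<in>S \<inter> T \<inter> U. g y = f y"
    using T(3) unfolding smooth_on_def by blast
  have "Cm_on m (T \<inter> U) g" for m using U(3) Cm_on_subset by blast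
  moreover have "open (T \<inter> U)" "x \<in> T \<inter> U" "\<forall>y\<in>S \<inter> (T \<inter> U). g y = f y" using T U by auto
  ultimately show "\<exists>T g. open T \<and> x \<in> T \<and> (\<forall>m. Cm_on m T g) \<and> (\<forall>y\<in>S \<inter> T. g y = f y)" by blast
qed

section \<open>Elementary facts about one chart of a smooth manifold\<close>

context
  fixes M :: "('p, 'e::euclidean_space) manifold" and U :: "'p set" and \<psi> :: "'p \<Rightarrow> 'e"
  assumes M: "smooth_manifold M" and chart: "(U, \<psi>) \<in> atlas M"
begin

lemma chart_is_chart: "is_chart M U \<psi>"
  using M chart unfolding smooth_manifold_def by blast

lemma chart_openin: "openin (mtop M) U"
  using chart_is_chart unfolding is_chart_def by blast

lemma chart_homeomorphic: "homeomorphic_map (subtopology (mtop M) U) (top_of_set (\<psi> ` U)) \<psi>"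
  using chart_is_chart unfolding is_chart_def by blast

lemma chart_inj_on: "inj_on \<psi> U"
  using homeomorphic_imp_injective_map[OF chart_homeomorphic] openin_subset[OF chart_openin]
  by (simp add: Int_absorb1)

lemma chart_image_openin:
  assumes "openin (mtop M) X" "X \<subseteq> U"
  shows "openin (top_of_set (model M)) (\<psi> ` X)"
proof -
  have "openin (subtopology (mtop M) U) X"
    using assms chart_openin openin_open_subtopology by blast
  then have "openin (top_of_set (\<psi> ` U)) (\<psi> ` X)"
    using homeomorphic_imp_open_map[OF chart_homeomorphic] by (simp add: open_map_def)
  moreover have "openin (top_of_set (model M)) (\<psi> ` U)"
    using chart_is_chart unfolding is_chart_def by blast
  ultimately show ?thesis using openin_trans by blast
qed

lemma chart_preimage_openin:
  assumes "open T"
  shows "openin (mtop M) {x \<in> U. \<psi> x \<in> T}"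
proof -
  have "continuous_map (subtopology (mtop M) U) euclidean \<psi>"
    using homeomorphic_imp_continuous_map[OF chart_homeomorphic] continuous_map_in_subtopology by blast
  then have "openin (subtopology (mtop M) U) {x \<in> topspace (subtopology (mtop M) U). \<psi> x \<in> T}"
    using assms by (simp add: continuous_map_def)
  moreover have "{x \<in> topspace (subtopology (mtop M) U). \<psi> x \<in> T} = {x \<in> U. \<psi> x \<in> T}"
    using openin_subset[OF chart_openin] by auto
  ultimately show ?thesis using openin_trans_full[OF _ chart_openin] by simp
qed

lemma chart_inverse: "x \<in> U \<Longrightarrow> inv_into U \<psi> (\<psi> x) = x"
  using chart_inj_on by simp

end

lemma manifold_chart_at:
  assumes "smooth_manifold M" "x \<in> topspace (mtop M)"
  obtains U \<psi> where "(U, \<psi>) \<in> atlas M" "x \<in> U"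
  using assms unfolding smooth_manifold_def by blast

section \<open>Charts of an embedded submanifold against charts of the ambient manifold\<close>

context
  fixes M :: "('p, 'e::euclidean_space) manifold" and N :: "('p, 'f::euclidean_space) manifold"
    and S W V :: "'p set" and \<theta> :: "'p \<Rightarrow> 'f" and \<eta> :: "'p \<Rightarrow> 'e"
  assumes emb: "embedded_submanifold M S N"
    and W: "(W, \<theta>) \<in> atlas N" and V: "(V, \<eta>) \<in> atlas M" and openV: "openin (mtop M) V"
begin

lemma embedded_overlap_openin: "openin (mtop N) (W \<inter> V)"
proof -
  have N: "smooth_manifold N" "mtop N = subtopology (mtop M) S"
    using emb by (auto simp: embedded_submanifold_def)
  have "openin (mtop N) W" by (rule chart_openin[OF N(1) W])
  moreover from this have "W \<subseteq> S" using N(2) openin_subset by fastforce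
  moreover have "openin (mtop N) (V \<inter> S)" unfolding N(2) using openV openin_subtopology_Int by blast
  ultimately have "openin (mtop N) (W \<inter> (V \<inter> S))" by blast
  moreover have "W \<inter> (V \<inter> S) = W \<inter> V" using \<open>W \<subseteq> S\<close> by blast
  ultimately show ?thesis by simp
qed

lemma embedded_transition_smooth: "smooth_on (\<theta> ` (W \<inter> V)) (\<eta> \<circ> inv_into W \<theta>)"
  using emb W V unfolding embedded_submanifold_def smooth_immersion_def smooth_map_def by fastforce

text \<open>The inclusion read in the two charts is an immersion, so it has a smooth local left
  inverse \<open>r\<close>, and \<open>r\<close> recovers the inner coordinate
  \<open>\<theta>\<close> from the outer coordinate \<open>\<eta>\<close>. The set \<open>X\<close>
  collects the points near \<open>Q\<close> where this holds.\<close>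

lemma embedded_chart_extension:
  assumes Q: "Q \<in> W \<inter> V"
  obtains T r X where "open T" "smooth_on T r" "openin (mtop N) X" "Q \<in> X" "X \<subseteq> W \<inter> V"
    "\<And>x. x \<in> X \<Longrightarrow> \<eta> x \<in> T \<and> r (\<eta> x) = \<theta> x"
proof -
  have N: "smooth_manifold N" using emb by (simp add: embedded_submanifold_def)
  then have sub: "subspace (model N)" by (simp add: smooth_manifold_def)
  let ?Y = "\<theta> ` (W \<inter> V)"
  have op: "openin (top_of_set (model N)) ?Y"
    by (rule chart_image_openin[OF N W embedded_overlap_openin]) simp
  have "\<exists>D. differential_in_charts id Q (W, \<theta>) (V, \<eta>) D \<and> inj_on D (model N)"
    using emb W V Q unfolding embedded_submanifold_def smooth_immersion_def by fastforce
  then obtain D where D: "((\<eta> \<circ> inv_into W \<theta>) has_derivative D) (at (\<theta> Q) within ?Y)" "inj_on D (model N)"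
    by (auto simp: differential_in_charts_def)
  have "\<theta> Q \<in> ?Y" using Q by blast
  then show ?thesis
  proof (rule immersion_local_left_inverse[OF sub op _ embedded_transition_smooth D])
    fix T r B
    assume T: "open T" "smooth_on T r" "open B" "\<theta> Q \<in> B"
      "\<And>x. x \<in> ?Y \<inter> B \<Longrightarrow> (\<eta> \<circ> inv_into W \<theta>) x \<in> T \<and> r ((\<eta> \<circ> inv_into W \<theta>) x) = x"
    let ?X = "(W \<inter> V) \<inter> {x \<in> W. \<theta> x \<in> B}"
    show thesis
    proof (rule that[OF T(1,2), of ?X])
      show "openin (mtop N) ?X"
        by (rule openin_Int[OF embedded_overlap_openin chart_preimage_openin[OF N W T(3)]])
      show "\<eta> x \<in> T \<and> r (\<eta> x) = \<theta> x" if "x \<in> ?X" for x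
      proof -
        have "inv_into W \<theta> (\<theta> x) = x" by (rule chart_inverse[OF N W]) (use that in blast)
        moreover have "\<theta> x \<in> ?Y \<inter> B" using that by blast
        ultimately show ?thesis using T(5)[of "\<theta> x"] by simp
      qed
    qed (use Q T(4) in auto)
  qed
qed

end

section \<open>Two nested embeddings: a submanifold of a submanifold of Euclidean space\<close>

context
  fixes On :: "('a::euclidean_space, 'e::euclidean_space) manifold" and Inv :: "('a, 'f::euclidean_space) manifold"
    and Y S :: "'a set"
  assumes On: "embedded_submanifold (open_manifold UNIV) Y On" and Inv: "embedded_submanifold On S Inv"
begin

lemma submanifold_topology: "mtop Inv = top_of_set S"
proof -
  have "mtop On = top_of_set Y" using On by (simp add: embedded_submanifold_def open_manifold_def)
  then show ?thesis
    using Inv by (auto simp: embedded_submanifold_def subtopology_subtopology Int_absorb1)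
qed

text \<open>The inverse of \<open>\<theta>\<close> factors as the transition from
  \<open>\<theta>\<close> to \<open>\<eta>\<close> followed by the inverse of \<open>\<eta>\<close>;
  each factor is smooth because it is an inclusion read in charts.\<close>

lemma submanifold_chart_inverse_smooth:
  assumes W: "(W, \<theta>) \<in> atlas Inv"
  shows "smooth_on (\<theta> ` W) (inv_into W \<theta>)"
proof (rule smooth_on_local)
  fix x assume "x \<in> \<theta> ` W"
  then obtain Q where Q: "Q \<in> W" "x = \<theta> Q" by blast
  have mOn: "smooth_manifold On" and mInv: "smooth_manifold Inv" and SOn: "S \<subseteq> topspace (mtop On)"
    using On Inv by (auto simp: embedded_submanifold_def)
  have "W \<subseteq> S" using chart_openin[OF mInv W] openin_subset submanifold_topology by fastforce
  then obtain V \<eta> where V: "(V, \<eta>) \<in> atlas On" "Q \<in> V" using manifold_chart_at[OF mOn] SOn Q by blast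
  have "openin (top_of_set (model Inv)) (\<theta> ` (W \<inter> V))"
    by (rule chart_image_openin[OF mInv W embedded_overlap_openin[OF Inv W V(1) chart_openin[OF mOn V(1)]]]) simp
  then obtain T where T: "open T" "\<theta> ` (W \<inter> V) = model Inv \<inter> T" by (auto simp: openin_open)
  have "\<theta> ` W \<subseteq> model Inv"
    using chart_image_openin[OF mInv W chart_openin[OF mInv W]] openin_subset by fastforce
  then have eq: "\<theta> ` W \<inter> T = \<theta> ` (W \<inter> V)" using T(2) by blast
  \<comment> \<open>The ambient space has the identity as its chart, so here the inclusion read in
    charts is the inverse of \<open>\<eta>\<close>.\<close>
  have "smooth_on (\<eta> ` (V \<inter> UNIV)) (id \<circ> inv_into V \<eta>)"
    by (rule embedded_transition_smooth[OF On V(1)]) (auto simp: open_manifold_def)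
  then have "smooth_on (\<theta> ` (W \<inter> V)) (\<lambda>x. (id \<circ> inv_into V \<eta>) ((\<eta> \<circ> inv_into W \<theta>) x))"
    by (rule smooth_on_compose[OF embedded_transition_smooth[OF Inv W V(1) chart_openin[OF mOn V(1)]]])
      (use chart_inverse[OF mInv W] in auto)
  then have "smooth_on (\<theta> ` (W \<inter> V)) (inv_into W \<theta>)"
    by (rule smooth_on_cong) (use chart_inverse[OF mInv W] chart_inverse[OF mOn V(1)] in auto)
  moreover have "x \<in> T" using Q V T(2) by blast
  ultimately show "\<exists>T. open T \<and> x \<in> T \<and> smooth_on (\<theta> ` W \<inter> T) (inv_into W \<theta>)"
    using T(1) eq by metis
qed

text \<open>The extension lemma is used twice: \<open>r1\<close> extends \<open>\<eta>\<close> to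
  the Euclidean space, \<open>r2\<close> turns \<open>\<eta>\<close> into \<open>\<theta>\<close>,
  and the composition extends \<open>\<theta>\<close>.\<close>

lemma submanifold_chart_extension:
  assumes W: "(W, \<theta>) \<in> atlas Inv" and Q: "Q \<in> W"
  obtains T r where "open T" "Q \<in> T" "smooth_on T r" "\<And>x. x \<in> S \<inter> T \<Longrightarrow> x \<in> W \<and> r x = \<theta> x"
proof -
  have mOn: "smooth_manifold On" and mInv: "smooth_manifold Inv" and SOn: "S \<subseteq> topspace (mtop On)"
    and tI: "mtop Inv = subtopology (mtop On) S"
    using On Inv by (auto simp: embedded_submanifold_def)
  have "W \<subseteq> S" using chart_openin[OF mInv W] openin_subset submanifold_topology by fastforce
  then obtain V \<eta> where V: "(V, \<eta>) \<in> atlas On" "Q \<in> V" using manifold_chart_at[OF mOn] SOn Q by blast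
  have "Q \<in> V \<inter> UNIV" using V by simp
  have "(UNIV, id) \<in> atlas (open_manifold UNIV)" "openin (mtop (open_manifold UNIV)) UNIV"
    by (auto simp: open_manifold_def)
  from embedded_chart_extension[OF On V(1) this \<open>Q \<in> V \<inter> UNIV\<close>]
  obtain T1 r1 X1 where 1: "open T1" "smooth_on T1 r1" "openin (mtop On) X1" "Q \<in> X1" "X1 \<subseteq> V \<inter> UNIV"
    "\<And>x. x \<in> X1 \<Longrightarrow> id x \<in> T1 \<and> r1 (id x) = \<eta> x" by metis
  have "Q \<in> W \<inter> V" using Q V by simp
  from embedded_chart_extension[OF Inv W V(1) chart_openin[OF mOn V(1)] this]
  obtain T2 r2 X2 where 2: "open T2" "smooth_on T2 r2" "openin (mtop Inv) X2" "Q \<in> X2" "X2 \<subseteq> W \<inter> V"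
    "\<And>x. x \<in> X2 \<Longrightarrow> \<eta> x \<in> T2 \<and> r2 (\<eta> x) = \<theta> x" by metis
  \<comment> \<open>\<open>X1\<close> is open in \<open>On\<close> and \<open>X2\<close> in
    \<open>Inv\<close>; the common part is open in \<open>S\<close> and is therefore cut out by an
    open set \<open>B\<close> of the Euclidean space.\<close>
  have "openin (mtop Inv) ((X1 \<inter> S) \<inter> X2)"
    using 1(3) 2(3) unfolding tI by (metis openin_Int openin_subtopology_Int)
  then obtain B where B: "open B" "(X1 \<inter> S) \<inter> X2 = S \<inter> B"
    unfolding submanifold_topology by (auto simp: openin_open)
  let ?T = "(T1 \<inter> r1 -` T2) \<inter> B"
  have "open (T1 \<inter> r1 -` T2)"
    using smooth_on_imp_continuous_on[OF 1(2)] 1(1) 2(1) continuous_open_preimage by blast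
  then have "open ?T" using B(1) by blast
  moreover have "smooth_on ?T (\<lambda>x. r2 (r1 x))"
    by (rule smooth_on_compose[OF smooth_on_subset[OF 1(2)] 2(2)]) auto
  moreover have "Q \<in> ?T" using 1(4) 1(6)[OF 1(4)] 2(4) 2(6)[OF 2(4)] B(2) Q \<open>W \<subseteq> S\<close> by auto
  moreover have "x \<in> W \<and> r2 (r1 x) = \<theta> x" if "x \<in> S \<inter> ?T" for x
  proof -
    have "x \<in> X1" "x \<in> X2" using that B(2) by auto
    then show ?thesis using 1(6) 2(5,6) by fastforce
  qed
  ultimately show ?thesis using that by blast
qed

end

section \<open>Charts of a quotient of an open set, and smooth choices of representatives\<close>

lemma quotient_preimage_open:
  assumes Gr: "quotient_manifold (open_manifold R) q Gr" and R: "open R"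
    and "openin (mtop Gr) X"
  shows "open (R \<inter> q -` X)"
proof -
  have "continuous_map (top_of_set R) (mtop Gr) q"
    using Gr quotient_imp_continuous_map by (fastforce simp: quotient_manifold_def open_manifold_def)
  then have "openin (top_of_set R) {x \<in> R. q x \<in> X}"
    using assms(3) by (simp add: continuous_map_def)
  moreover have "{x \<in> R. q x \<in> X} = R \<inter> q -` X" by auto
  ultimately show ?thesis using R openin_open_eq by metis
qed

context
  fixes Gr :: "('q, 'e::euclidean_space) manifold" and q :: "'a::euclidean_space \<Rightarrow> 'q" and R :: "'a set"
    and U :: "'q set" and \<psi> :: "'q \<Rightarrow> 'e"
  assumes Gr: "quotient_manifold (open_manifold R) q Gr" and R: "open R" and U: "(U, \<psi>) \<in> atlas Gr"
begin

lemma quotient_chart_smooth: "smooth_on (R \<inter> q -` U) (\<psi> \<circ> q)"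
proof -
  have "smooth_on (id ` (R \<inter> q -` U)) (\<psi> \<circ> q \<circ> inv_into R id)"
    using Gr U unfolding quotient_manifold_def smooth_submersion_def smooth_map_def open_manifold_def by fastforce
  then have "smooth_on (R \<inter> q -` U) (\<psi> \<circ> q \<circ> inv_into R id)" by simp
  then show ?thesis by (rule smooth_on_cong) (use inv_into_f_f[of id R] in auto)
qed

text \<open>Turns the inverse of a chart into a smooth choice \<open>\<sigma>\<close> of
  representatives through the prescribed \<open>a\<close>, so that a map on the quotient can be
  tested on representatives.\<close>

lemma quotient_local_section:
  assumes a: "a \<in> R \<inter> q -` U"
  obtains T \<sigma> where "open T" "\<psi> (q a) \<in> T" "smooth_on T \<sigma>" "\<sigma> ` T \<subseteq> R" "\<sigma> (\<psi> (q a)) = a"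
    "\<And>z. z \<in> T \<inter> \<psi> ` U \<Longrightarrow> inv_into U \<psi> z = q (\<sigma> z)"
proof -
  have mG: "smooth_manifold Gr" using Gr by (simp add: quotient_manifold_def)
  let ?S = "R \<inter> q -` U"
  have S: "open ?S" by (rule quotient_preimage_open[OF Gr R chart_openin[OF mG U]])
  have inv: "inv_into R id x = x" if "x \<in> R" for x using inv_into_f_f[of id R x] that by simp
  have "\<exists>D. differential_in_charts q a (R, id) (U, \<psi>) D \<and> range D = model Gr"
    using Gr U a unfolding quotient_manifold_def smooth_submersion_def open_manifold_def by fastforce
  then obtain D where D: "((\<psi> \<circ> q \<circ> inv_into R id) has_derivative D) (at a within ?S)" "range D = model Gr"
    by (auto simp: differential_in_charts_def)
  have "((\<psi> \<circ> q) has_derivative D) (at a within ?S)"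
    by (rule has_derivative_transform[OF a _ D(1)]) (simp add: inv)
  then have D': "((\<psi> \<circ> q) has_derivative D) (at a)" using at_within_open[OF a S] by simp
  have sub: "subspace (model Gr)" using mG by (simp add: smooth_manifold_def)
  have UV: "\<psi> ` U \<subseteq> model Gr"
    using chart_image_openin[OF mG U chart_openin[OF mG U]] openin_subset by fastforce
  then have "(\<psi> \<circ> q) ` ?S \<subseteq> model Gr" by auto
  from submersion_local_section[OF S quotient_chart_smooth sub this a D'] D(2)
  obtain T \<sigma> where T: "open T" "(\<psi> \<circ> q) a \<in> T" "smooth_on T \<sigma>" "\<sigma> ((\<psi> \<circ> q) a) = a" "\<sigma> ` T \<subseteq> ?S"
    "\<And>y. y \<in> T \<inter> model Gr \<Longrightarrow> (\<psi> \<circ> q) (\<sigma> y) = y" by blast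
  show ?thesis
  proof (rule that[OF T(1) _ T(3)])
    fix z assume z: "z \<in> T \<inter> \<psi> ` U"
    then have "\<psi> (q (\<sigma> z)) = z" using T(6) UV by auto
    moreover have "q (\<sigma> z) \<in> U" using T(5) z by auto
    ultimately show "inv_into U \<psi> z = q (\<sigma> z)" using chart_inverse[OF mG U] by metis
  qed (use T in auto)
qed

end

text \<open>Locally \<open>\<theta>\<close> after \<open>\<phi>\<close> after the inverse of
  \<open>\<psi>\<close> is \<open>r\<close> after \<open>F\<close> after \<open>\<sigma>\<close>,
  with \<open>r\<close> an ambient extension of \<open>\<theta>\<close> and \<open>\<sigma>\<close>
  a choice of representatives. In the other direction the coordinate map is
  \<open>\<psi> \<circ> q\<close> after \<open>s\<close> after the inverse of
  \<open>\<theta>\<close>.\<close>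

lemma diffeomorphism_from_quotient:
  fixes Gr :: "('q, 'e::euclidean_space) manifold" and q :: "'b::euclidean_space \<Rightarrow> 'q"
    and On :: "('a::euclidean_space, 'd::euclidean_space) manifold" and Inv :: "('a, 'f::euclidean_space) manifold"
  assumes Gr: "quotient_manifold (open_manifold R) q Gr" and R: "open R"
    and On: "embedded_submanifold (open_manifold UNIV) Y On" and Inv: "embedded_submanifold On S Inv"
    and F: "smooth_on R F" "F ` R \<subseteq> S" and \<phi>: "\<And>A. A \<in> R \<Longrightarrow> \<phi> (q A) = F A"
    and bij: "bij_betw \<phi> (q ` R) S"
    and sec: "\<And>Q. Q \<in> S \<Longrightarrow> \<exists>T s. open T \<and> Q \<in> T \<and> smooth_on T s \<and> s ` T \<subseteq> R \<and> (\<forall>P\<in>S \<inter> T. F (s P) = P)"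
  shows "diffeomorphism Gr Inv \<phi>"
proof -
  have mG: "smooth_manifold Gr" and qm: "quotient_map (top_of_set R) (mtop Gr) q"
    using Gr by (auto simp: quotient_manifold_def open_manifold_def)
  have tG: "topspace (mtop Gr) = q ` R" using quotient_imp_surjective_map[OF qm] by simp
  have mI: "smooth_manifold Inv" using Inv by (simp add: embedded_submanifold_def)
  have tI: "mtop Inv = top_of_set S" by (rule submanifold_topology[OF On Inv])
  let ?inv = "inv_into (q ` R) \<phi>"
  have inj: "inj_on \<phi> (q ` R)" using bij by (simp add: bij_betw_def)
  have invF: "?inv (F A) = q A" if "A \<in> R" for A
    using inv_into_f_f[OF inj, of "q A"] \<phi>[OF that] that by auto
  have UG: "U \<subseteq> q ` R" if "(U, \<psi>) \<in> atlas Gr" for U \<psi>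
    using chart_openin[OF mG that] openin_subset tG by metis
  have WS: "W \<subseteq> S" if "(W, \<theta>) \<in> atlas Inv" for W \<theta>
    using chart_openin[OF mI that] openin_subset tI by fastforce
  have forward: "smooth_map Gr Inv \<phi>"
    unfolding smooth_map_def
  proof (intro conjI)
    have "continuous_map (top_of_set R) (mtop Inv) F"
      using smooth_on_imp_continuous_on[OF F(1)] F(2) by (auto simp: tI continuous_map_in_subtopology)
    then have "continuous_map (top_of_set R) (mtop Inv) (\<phi> \<circ> q)"
      by (rule continuous_map_eq) (simp add: \<phi>)
    then show "continuous_map (mtop Gr) (mtop Inv) \<phi>"
      using continuous_compose_quotient_map[OF qm] by blast
    have "smooth_on (\<psi> ` (U \<inter> \<phi> -` W)) (\<theta> \<circ> \<phi> \<circ> inv_into U \<psi>)"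
      if U: "(U, \<psi>) \<in> atlas Gr" and W: "(W, \<theta>) \<in> atlas Inv" for U \<psi> W \<theta>
    proof (rule smooth_on_localI)
      fix z assume "z \<in> \<psi> ` (U \<inter> \<phi> -` W)"
      then obtain A where A: "A \<in> R \<inter> q -` U" "z = \<psi> (q A)" "F A \<in> W"
        using UG[OF U] \<phi> by (auto simp: subset_iff image_iff)
      obtain T \<sigma> where T: "open T" "\<psi> (q A) \<in> T" "smooth_on T \<sigma>" "\<sigma> ` T \<subseteq> R" "\<sigma> (\<psi> (q A)) = A"
        "\<And>z. z \<in> T \<inter> \<psi> ` U \<Longrightarrow> inv_into U \<psi> z = q (\<sigma> z)"
        using quotient_local_section[OF Gr R U A(1)] by blast
      obtain T' r where r: "open T'" "F A \<in> T'" "smooth_on T' r" "\<And>x. x \<in> S \<inter> T' \<Longrightarrow> x \<in> W \<and> r x = \<theta> x"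
        using submanifold_chart_extension[OF On Inv W A(3)] by blast
      have Fs: "smooth_on T (\<lambda>z. F (\<sigma> z))" by (rule smooth_on_compose[OF T(3) F(1) T(4)])
      let ?T = "T \<inter> (\<lambda>z. F (\<sigma> z)) -` T'"
      have "open ?T"
        by (rule continuous_open_preimage[OF smooth_on_imp_continuous_on[OF Fs] T(1) r(1)])
      moreover have "z \<in> ?T" using A T(2,5) r(2) by simp
      moreover have "smooth_on ?T (\<lambda>z. r (F (\<sigma> z)))"
        by (rule smooth_on_compose[OF smooth_on_subset[OF Fs] r(3)]) auto
      moreover have "r (F (\<sigma> y)) = (\<theta> \<circ> \<phi> \<circ> inv_into U \<psi>) y" if "y \<in> \<psi> ` (U \<inter> \<phi> -` W) \<inter> ?T" for y
      proof -
        have y: "y \<in> T" "y \<in> \<psi> ` U" "F (\<sigma> y) \<in> T'" using that by auto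
        have "\<sigma> y \<in> R" using y(1) T(4) by blast
        then have "\<phi> (inv_into U \<psi> y) = F (\<sigma> y)" "F (\<sigma> y) \<in> S" using T(6)[of y] y \<phi> F(2) by auto
        then show ?thesis using r(4) y by simp
      qed
      ultimately show "\<exists>T g. open T \<and> z \<in> T \<and> smooth_on T g \<and>
          (\<forall>y\<in>\<psi> ` (U \<inter> \<phi> -` W) \<inter> T. g y = (\<theta> \<circ> \<phi> \<circ> inv_into U \<psi>) y)" by blast
    qed
    then show "\<forall>(U, \<psi>)\<in>atlas Gr. \<forall>(W, \<theta>)\<in>atlas Inv.
        smooth_on (\<psi> ` (U \<inter> \<phi> -` W)) (\<theta> \<circ> \<phi> \<circ> inv_into U \<psi>)" by blast
  qed
  \<comment> \<open>A local section of \<open>F\<close> followed by \<open>q\<close> computes the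
    inverse of \<open>\<phi>\<close>.\<close>
  have loc: "\<exists>T s. open T \<and> Q \<in> T \<and> smooth_on T s \<and> s ` T \<subseteq> R \<and> (\<forall>P\<in>S \<inter> T. ?inv P = q (s P))"
    if Q: "Q \<in> S" for Q
  proof -
    obtain T s where T: "open T" "Q \<in> T" "smooth_on T s" "s ` T \<subseteq> R" "\<forall>P\<in>S \<inter> T. F (s P) = P"
      using sec[OF Q] by blast
    have "?inv P = q (s P)" if "P \<in> S \<inter> T" for P
      using invF[of "s P"] T(4,5) that by force
    then show ?thesis using T by blast
  qed
  have backward: "smooth_map Inv Gr ?inv"
    unfolding smooth_map_def
  proof (intro conjI)
    show "continuous_map (mtop Inv) (mtop Gr) ?inv"
      unfolding continuous_map_def tI tG
    proof (intro conjI allI impI)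
      show "?inv \<in> topspace (top_of_set S) \<rightarrow> q ` R"
        using bij by (auto simp: bij_betw_def intro: inv_into_into)
      fix X assume X: "openin (mtop Gr) X"
      show "openin (top_of_set S) {x \<in> topspace (top_of_set S). ?inv x \<in> X}"
      proof (subst openin_subopen, intro ballI)
        fix Q assume "Q \<in> {x \<in> topspace (top_of_set S). ?inv x \<in> X}"
        then have Q: "Q \<in> S" "?inv Q \<in> X" by auto
        obtain T s where T: "open T" "Q \<in> T" "smooth_on T s" "s ` T \<subseteq> R" "\<forall>P\<in>S \<inter> T. ?inv P = q (s P)"
          using loc[OF Q(1)] by blast
        let ?T = "T \<inter> s -` (R \<inter> q -` X)"
        have "open ?T"
          by (rule continuous_open_preimage[OF smooth_on_imp_continuous_on[OF T(3)] T(1)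
                quotient_preimage_open[OF Gr R X]])
        then have "openin (top_of_set S) (S \<inter> ?T)" by (simp add: openin_open_Int)
        moreover have "Q \<in> S \<inter> ?T" using Q T by auto
        moreover have "S \<inter> ?T \<subseteq> {x \<in> topspace (top_of_set S). ?inv x \<in> X}" using T(5) by auto
        ultimately show "\<exists>T. openin (top_of_set S) T \<and> Q \<in> T \<and>
            T \<subseteq> {x \<in> topspace (top_of_set S). ?inv x \<in> X}" by blast
      qed
    qed
    have "smooth_on (\<theta> ` (W \<inter> ?inv -` U)) (\<psi> \<circ> ?inv \<circ> inv_into W \<theta>)"
      if U: "(U, \<psi>) \<in> atlas Gr" and W: "(W, \<theta>) \<in> atlas Inv" for U \<psi> W \<theta>
    proof (rule smooth_on_local)
      let ?X = "\<theta> ` (W \<inter> ?inv -` U)" and ?e = "inv_into W \<theta>"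
      fix x assume "x \<in> ?X"
      then obtain Q where Q: "Q \<in> W" "?inv Q \<in> U" "x = \<theta> Q" by blast
      have e: "smooth_on (\<theta> ` W) ?e" by (rule submanifold_chart_inverse_smooth[OF On Inv W])
      have eQ: "?e (\<theta> P) = P" if "P \<in> W" for P by (rule chart_inverse[OF mI W that])
      have "Q \<in> S" using Q WS[OF W] by blast
      then obtain T s where T: "open T" "Q \<in> T" "smooth_on T s" "s ` T \<subseteq> R" "\<forall>P\<in>S \<inter> T. ?inv P = q (s P)"
        using loc by blast
      \<comment> \<open>\<open>B\<close> is a neighbourhood in the coordinates on which the
        corresponding points stay in the domain of the section \<open>s\<close>.\<close>
      obtain B where B: "open B" "\<theta> ` W \<inter> ?e -` T = \<theta> ` W \<inter> B"
        using continuous_openin_preimage_gen[OF smooth_on_imp_continuous_on[OF e] T(1)] by (auto simp: openin_open)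
      have XB: "P \<in> T \<and> ?inv P = q (s P) \<and> ?inv P \<in> U" if "y \<in> ?X \<inter> B" "P = ?e y" for y P
      proof -
        obtain P' where P': "P' \<in> W" "?inv P' \<in> U" "y = \<theta> P'" using \<open>y \<in> ?X \<inter> B\<close> by blast
        then have "P = P'" using that(2) eQ by simp
        moreover have "y \<in> \<theta> ` W \<inter> B" using P' that(1) by blast
        then have "P \<in> T" using B(2) that(2) by blast
        moreover have "P' \<in> S" using P' WS[OF W] by blast
        ultimately show ?thesis using T(5) P' by auto
      qed
      have 1: "smooth_on (?X \<inter> B) ?e" by (rule smooth_on_subset[OF e]) blast
      have 2: "smooth_on (?X \<inter> B) (\<lambda>y. s (?e y))"
        by (rule smooth_on_compose[OF 1 T(3)]) (use XB in blast)
      have "(\<lambda>y. s (?e y)) ` (?X \<inter> B) \<subseteq> R \<inter> q -` U"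
      proof (intro image_subsetI)
        fix y assume "y \<in> ?X \<inter> B"
        from XB[OF this refl] show "s (?e y) \<in> R \<inter> q -` U" using T(4) by auto
      qed
      from smooth_on_compose[OF 2 quotient_chart_smooth[OF Gr R U] this]
      have "smooth_on (?X \<inter> B) (\<psi> \<circ> ?inv \<circ> ?e)"
      proof (rule smooth_on_cong)
        fix y assume "y \<in> ?X \<inter> B"
        from XB[OF this refl] show "(\<psi> \<circ> q) (s (?e y)) = (\<psi> \<circ> ?inv \<circ> ?e) y" by simp
      qed
      moreover have "x \<in> B"
      proof -
        have "x \<in> \<theta> ` W \<inter> ?e -` T" using Q eQ T(2) by simp
        then show ?thesis using B(2) by blast
      qed
      ultimately show "\<exists>T. open T \<and> x \<in> T \<and> smooth_on (?X \<inter> T) (\<psi> \<circ> ?inv \<circ> ?e)"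
        using B(1) by blast
    qed
    then show "\<forall>(W, \<theta>)\<in>atlas Inv. \<forall>(U, \<psi>)\<in>atlas Gr.
        smooth_on (\<theta> ` (W \<inter> ?inv -` U)) (\<psi> \<circ> ?inv \<circ> inv_into W \<theta>)" by blast
  qed
  show ?thesis
    unfolding diffeomorphism_def using forward backward bij by (simp add: tG tI)
qed

text \<open>The pullback topology makes \<open>\<phi>\<close> a homeomorphism onto \<open>S\<close>.
  Local sections of \<open>F\<close> pull an open set of representatives back to an open subset of
  \<open>S\<close>, which is the converse of continuity that a quotient map demands.\<close>

lemma quotient_map_pullback_topology:
  assumes R: "open R" and F: "smooth_on R F" "F ` R = S" and \<phi>: "\<And>A. A \<in> R \<Longrightarrow> \<phi> (q A) = F A"
    and inj: "inj_on \<phi> (q ` R)"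
    and sec: "\<And>Q. Q \<in> S \<Longrightarrow> \<exists>T s. open T \<and> Q \<in> T \<and> smooth_on T s \<and> s ` T \<subseteq> R \<and> (\<forall>P\<in>S \<inter> T. F (s P) = P)"
  shows "quotient_map (top_of_set R) (pullback_topology (q ` R) \<phi> euclidean) q"
  unfolding quotient_map_def
proof (intro conjI allI impI iffI)
  show "q ` topspace (top_of_set R) = topspace (pullback_topology (q ` R) \<phi> euclidean)"
    by (simp add: topspace_pullback_topology)
  fix U
  assume "U \<subseteq> topspace (pullback_topology (q ` R) \<phi> euclidean)"
  then have U: "U \<subseteq> q ` R" by (simp add: topspace_pullback_topology)
  have eq: "{x \<in> topspace (top_of_set R). q x \<in> U} = R \<inter> q -` U" by auto
  {
    assume "openin (top_of_set R) {x \<in> topspace (top_of_set R). q x \<in> U}"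
    then have op: "open (R \<inter> q -` U)" unfolding eq using R openin_open_eq by blast
    have "openin (top_of_set S) (\<phi> ` U)"
    proof (subst openin_subopen, intro ballI)
      fix Q assume "Q \<in> \<phi> ` U"
      then obtain A where A: "A \<in> R" "q A \<in> U" "Q = F A" using U \<phi> by (auto simp: subset_iff image_iff)
      then have "Q \<in> S" using F(2) by blast
      from sec[OF this] obtain T s where T: "open T" "Q \<in> T" "smooth_on T s" "s ` T \<subseteq> R" "\<forall>P\<in>S \<inter> T. F (s P) = P"
        by blast
      let ?T = "T \<inter> s -` (R \<inter> q -` U)"
      have "open ?T"
        by (rule continuous_open_preimage[OF smooth_on_imp_continuous_on[OF T(3)] T(1) op])
      then have "openin (top_of_set S) (S \<inter> ?T)" by (simp add: openin_open_Int)
      moreover have "Q \<in> S \<inter> ?T"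
      proof -
        \<comment> \<open>The section need not pass through \<open>A\<close> itself;
          \<open>F (s Q) = F A\<close> and injectivity of \<open>\<phi>\<close> put
          \<open>s Q\<close> into the same class, and the set of representatives is
          saturated.\<close>
        have sQ: "s Q \<in> R" "F (s Q) = Q" using T \<open>Q \<in> S\<close> by auto
        then have "\<phi> (q (s Q)) = \<phi> (q A)" using \<phi> A by simp
        then have "q (s Q) = q A" using inj sQ(1) A(1) by (simp add: inj_on_def)
        then show ?thesis using T(2) \<open>Q \<in> S\<close> sQ A by simp
      qed
      moreover have "S \<inter> ?T \<subseteq> \<phi> ` U"
      proof
        fix P assume P: "P \<in> S \<inter> ?T"
        then have "P = \<phi> (q (s P))" using T(5) \<phi> by auto
        then show "P \<in> \<phi> ` U" using P by blast
      qed
      ultimately show "\<exists>T. openin (top_of_set S) T \<and> Q \<in> T \<and> T \<subseteq> \<phi> ` U" by blast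
    qed
    then obtain B where B: "open B" "\<phi> ` U = S \<inter> B" by (auto simp: openin_open)
    have "U = \<phi> -` B \<inter> q ` R"
    proof
      show "U \<subseteq> \<phi> -` B \<inter> q ` R" using B(2) U by blast
      show "\<phi> -` B \<inter> q ` R \<subseteq> U"
      proof
        fix x assume x: "x \<in> \<phi> -` B \<inter> q ` R"
        then have "\<phi> x \<in> S" using \<phi> F(2) by auto
        then have "\<phi> x \<in> \<phi> ` U" using B(2) x by blast
        then show "x \<in> U" using inj x U by (meson IntD2 inj_on_image_mem_iff)
      qed
    qed
    then show "openin (pullback_topology (q ` R) \<phi> euclidean) U"
      using B(1) by (auto simp: openin_pullback_topology)
  }
  {
    assume "openin (pullback_topology (q ` R) \<phi> euclidean) U"
    then obtain B where B: "open B" "U = \<phi> -` B \<inter> q ` R" by (auto simp: openin_pullback_topology)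
    have "q A \<in> U \<longleftrightarrow> F A \<in> B" if "A \<in> R" for A
      using B(2) \<phi>[OF that] that by (simp add: vimage_eq)
    then have "R \<inter> q -` U = R \<inter> F -` B" by blast
    moreover have "open (R \<inter> F -` B)"
      by (rule continuous_open_preimage[OF smooth_on_imp_continuous_on[OF F(1)] R B(1)])
    ultimately show "openin (top_of_set R) {x \<in> topspace (top_of_set R). q x \<in> U}"
      unfolding eq using openin_open_eq[OF R] by (simp only:) blast
  }
qed

text \<open>The lift \<open>l\<close> is a smooth choice of representatives over a whole chart that
  passes through a given \<open>A\<close>. Differentiating \<open>c i (F (l v)) = v\<close> there
  exhibits a right inverse of the differential, whence the submersion.\<close>

lemma param_atlas_quotient_manifold:
  assumes P: "param_atlas (q ` R) \<phi> V I D c p"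
    and R: "open R" and F: "smooth_on R F" and \<phi>: "\<And>A. A \<in> R \<Longrightarrow> \<phi> (q A) = F A"
    and sec: "\<And>Q. Q \<in> F ` R \<Longrightarrow> \<exists>T s. open T \<and> Q \<in> T \<and> smooth_on T s \<and> s ` T \<subseteq> R \<and> (\<forall>P\<in>F ` R \<inter> T. F (s P) = P)"
    and lift: "\<And>i A. i \<in> I \<Longrightarrow> A \<in> R \<Longrightarrow> F A \<in> D i \<Longrightarrow>
      \<exists>l. smooth_on V l \<and> l ` V \<subseteq> R \<and> l (c i (F A)) = A \<and> (\<forall>v\<in>V. F (l v) = p i v)"
  shows "quotient_manifold (open_manifold R) q (param_manifold (q ` R) \<phi> V I D c)"
proof -
  interpret param_atlas "q ` R" \<phi> V I D c p by fact
  have img: "\<phi> ` q ` R = F ` R" using \<phi> by (auto simp: image_image)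
  have qm: "quotient_map (mtop (open_manifold R)) (mtop mfd) q"
    using quotient_map_pullback_topology[OF R F refl \<phi> inj sec] by (simp add: open_manifold_def)
  have invR: "inv_into R id x = x" if "x \<in> R" for x using inv_into_f_f[of id R] that by simp
  have "smooth_on (id ` (R \<inter> q -` U i)) (chart i \<circ> q \<circ> inv_into R id)"
     "\<And>a. a \<in> R \<inter> q -` U i \<Longrightarrow> \<exists>E. differential_in_charts q a (R, id) (U i, chart i) E \<and> range E = V"
    if i: "i \<in> I" for i
  proof -
    let ?S = "R \<inter> q -` U i" and ?f = "\<lambda>A. c i (F A)"
    have "q A \<in> U i \<longleftrightarrow> F A \<in> D i" if "A \<in> R" for A
      using \<phi>[OF that] that by (simp add: vimage_eq)
    then have SF: "?S = R \<inter> F -` D i" by blast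
    have f: "(chart i \<circ> q \<circ> inv_into R id) A = ?f A" if "A \<in> R" for A using invR \<phi> that by simp
    have sm: "smooth_on ?S ?f"
      by (rule smooth_on_compose[OF smooth_on_subset[OF F] c[OF i]]) (use SF in auto)
    then have "smooth_on ?S (chart i \<circ> q \<circ> inv_into R id)"
      by (rule smooth_on_cong) (use f in auto)
    then show "smooth_on (id ` ?S) (chart i \<circ> q \<circ> inv_into R id)" by simp
    fix a assume a: "a \<in> ?S"
    have opS: "open ?S"
      unfolding SF by (rule continuous_open_preimage[OF smooth_on_imp_continuous_on[OF F] R D[OF i]])
    obtain E where E: "(?f has_derivative E) (at a within ?S)"
      using smooth_on_has_derivative[OF sm a] by blast
    have aF: "a \<in> R" "F a \<in> D i" using a SF by blast+
    obtain l where l: "smooth_on V l" "l ` V \<subseteq> R" "l (?f a) = a" "\<And>v. v \<in> V \<Longrightarrow> F (l v) = p i v"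
      using lift[OF i aF] by blast
    have fV: "?f x \<in> V" if "x \<in> ?S" for x
    proof -
      have "x \<in> R" "F x \<in> D i" using that SF by blast+
      then show ?thesis using cV[OF i, of "F x"] img by blast
    qed
    note faV = fV[OF a]
    have lS: "l ` V \<subseteq> ?S" unfolding SF using l pD[OF i] by auto
    have fl: "?f (l v) = v" if "v \<in> V" for v using l(4)[OF that] cp[OF i that] by simp
    obtain L where L: "(l has_derivative L) (at (?f a) within V)"
      using smooth_on_has_derivative[OF l(1) faV] by blast
    have E': "(?f has_derivative E) (at (l (?f a)) within l ` V)"
      unfolding l(3) by (rule has_derivative_subset[OF E lS])
    have "E (L v) = v" if "v \<in> V" for v
      by (rule has_derivative_left_inverse[OF V _ faV L E' fl that]) auto
    then have "V \<subseteq> range E" by (metis rangeI subsetI)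
    \<comment> \<open>\<open>?f\<close> takes its values in \<open>V\<close>, so it equals
      \<open>\<pi>\<close> after \<open>?f\<close>; differentiating gives
      \<open>E = \<pi> \<circ> E\<close>.\<close>
    moreover have "range E \<subseteq> V"
    proof -
      obtain \<pi> where pi: "linear \<pi>" "range \<pi> \<subseteq> V" "\<And>v. v \<in> V \<Longrightarrow> \<pi> v = v"
        using linear_exists_left_inverse_on[OF linear_id V] by auto
      have "bounded_linear \<pi>" using pi(1) linear_conv_bounded_linear by blast
      then have "((\<lambda>x. \<pi> (?f x)) has_derivative (\<lambda>v. \<pi> (E v))) (at a within ?S)"
        using E bounded_linear.has_derivative by blast
      then have "(?f has_derivative (\<lambda>v. \<pi> (E v))) (at a within ?S)"
      proof (rule has_derivative_transform[OF a, rotated])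
        show "?f x = \<pi> (?f x)" if "x \<in> ?S" for x using pi(3)[OF fV[OF that]] by simp
      qed
      then have "E = (\<lambda>v. \<pi> (E v))" using E at_within_open[OF a opS] has_derivative_unique by metis
      then show ?thesis using pi(2) by (metis image_subsetI rangeI subsetD)
    qed
    moreover have "((chart i \<circ> q \<circ> inv_into R id) has_derivative E) (at a within ?S)"
      by (rule has_derivative_transform[OF a _ E]) (use f in auto)
    ultimately show "\<exists>E. differential_in_charts q a (R, id) (U i, chart i) E \<and> range E = V"
      by (auto simp: differential_in_charts_def)
  qed
  then have "smooth_submersion (open_manifold R) mfd q"
    unfolding smooth_submersion_def smooth_map_def
    using quotient_imp_continuous_map[OF qm] by (auto simp: open_manifold_def)
  then show ?thesis
    unfolding quotient_manifold_def using smooth_manifold qm by blast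
qed

section \<open>Projections and reflections along column spaces\<close>

lemma smooth_on_bilinear:
  fixes f :: "'a::euclidean_space \<Rightarrow> 'b::euclidean_space" and g :: "'a \<Rightarrow> 'c::euclidean_space"
    and prd :: "'b \<Rightarrow> 'c \<Rightarrow> 'd::euclidean_space"
  assumes "bounded_bilinear prd" "smooth_on S f" "smooth_on S g"
  shows "smooth_on S (\<lambda>x. prd (f x) (g x))"
  unfolding smooth_on_def
proof
  fix x assume x: "x \<in> S"
  obtain T1 f1 where T1: "open T1" "x \<in> T1" "Cinf_on T1 f1" "\<forall>y\<in>S \<inter> T1. f1 y = f y"
    using assms(2) x unfolding smooth_on_def by blast
  obtain T2 g2 where T2: "open T2" "x \<in> T2" "Cinf_on T2 g2" "\<forall>y\<in>S \<inter> T2. g2 y = g y"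
    using assms(3) x unfolding smooth_on_def by blast
  have T: "open (T1 \<inter> T2)" using T1 T2 by blast
  have "Cm_on m (T1 \<inter> T2) (\<lambda>x. prd (f1 x) (g2 x))" for m
    by (rule Cm_on_bilinear[OF assms(1) T]) (use T1(3) T2(3) Cm_on_subset in blast)+
  moreover have "x \<in> T1 \<inter> T2" "\<forall>y\<in>S \<inter> (T1 \<inter> T2). prd (f1 y) (g2 y) = prd (f y) (g y)"
    using T1 T2 by auto
  ultimately show "\<exists>T g'. open T \<and> x \<in> T \<and> (\<forall>m. Cm_on m T g') \<and> (\<forall>y\<in>S \<inter> T. g' y = prd (f y) (g y))"
    using T by blast
qed

lemma smooth_on_const: "smooth_on S (\<lambda>x. c)"
  unfolding smooth_on_def using Cm_on_const open_UNIV by blast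

lemma smooth_on_linear_compose:
  fixes L :: "'b::euclidean_space \<Rightarrow> 'c::euclidean_space"
  assumes "linear L" "smooth_on S f"
  shows "smooth_on S (\<lambda>x. L (f x))"
  by (rule smooth_on_compose[OF assms(2) smooth_on_linear[OF assms(1), of UNIV]]) simp

lemma smooth_on_scaleR: "smooth_on S f \<Longrightarrow> smooth_on S (\<lambda>x. r *\<^sub>R f x)"
  by (rule smooth_on_bilinear[OF bounded_bilinear_scaleR smooth_on_const])

lemma smooth_on_add:
  assumes "smooth_on S f" "smooth_on S g"
  shows "smooth_on S (\<lambda>x. f x + g x)"
  unfolding smooth_on_def
proof
  fix x assume x: "x \<in> S"
  obtain T1 f1 where T1: "open T1" "x \<in> T1" "Cinf_on T1 f1" "\<forall>y\<in>S \<inter> T1. f1 y = f y"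
    using assms(1) x unfolding smooth_on_def by blast
  obtain T2 g2 where T2: "open T2" "x \<in> T2" "Cinf_on T2 g2" "\<forall>y\<in>S \<inter> T2. g2 y = g y"
    using assms(2) x unfolding smooth_on_def by blast
  have T: "open (T1 \<inter> T2)" using T1 T2 by blast
  have "Cm_on m (T1 \<inter> T2) (\<lambda>x. f1 x + g2 x)" for m
    by (rule Cm_on_add[OF T]) (use T1(3) T2(3) Cm_on_subset in blast)+
  moreover have "x \<in> T1 \<inter> T2" "\<forall>y\<in>S \<inter> (T1 \<inter> T2). f1 y + g2 y = f y + g y"
    using T1 T2 by auto
  ultimately show "\<exists>T g'. open T \<and> x \<in> T \<and> (\<forall>m. Cm_on m T g') \<and> (\<forall>y\<in>S \<inter> T. g' y = f y + g y)"
    using T by blast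
qed

lemma bounded_bilinear_matrix_mult:
  "bounded_bilinear ((**) :: real^'m^'n \<Rightarrow> real^'k^'m \<Rightarrow> real^'k^'n)"
  unfolding bilinear_conv_bounded_bilinear[symmetric] bilinear_def
  by (auto intro!: linearI simp: matrix_matrix_mult_def vec_eq_iff sum.distrib algebra_simps sum_distrib_left)

interpretation matmul: bounded_bilinear "(**) :: real^'m^'n \<Rightarrow> real^'k^'m \<Rightarrow> real^'k^'n"
  by (rule bounded_bilinear_matrix_mult)

lemma linear_transpose: "linear (transpose :: real^'m^'n \<Rightarrow> real^'n^'m)"
  by (auto intro!: linearI simp: transpose_def vec_eq_iff)

lemma transpose_add: "transpose (A + B) = transpose A + transpose (B :: real^'m^'n)"
  by (rule linear_add[OF linear_transpose])

lemma transpose_diff: "transpose (A - B) = transpose A - transpose (B :: real^'m^'n)"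
  by (rule linear_diff[OF linear_transpose])

lemma matrix_inv_works:
  assumes "invertible (A :: real^'n^'n)"
  shows "A ** matrix_inv A = mat 1" "matrix_inv A ** A = mat 1"
proof -
  have "\<exists>B. A ** B = mat 1 \<and> B ** A = mat 1" using assms by (simp add: invertible_def)
  then have "A ** matrix_inv A = mat 1 \<and> matrix_inv A ** A = mat 1"
    unfolding matrix_inv_def by (rule someI_ex)
  then show "A ** matrix_inv A = mat 1" "matrix_inv A ** A = mat 1" by auto
qed

lemma invertible_matrix_inv: "invertible (A :: real^'n^'n) \<Longrightarrow> invertible (matrix_inv A)"
  using matrix_inv_works invertible_def by blast

lemma matrix_inv_eqI:
  assumes "A ** B = mat 1"
  shows "matrix_inv (A :: real^'n^'n) = B"
proof -
  have "invertible A" using assms invertible_right_inverse by blast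
  then show ?thesis
    using assms matrix_inv_works by (metis matrix_mul_assoc matrix_mul_lid matrix_mul_rid)
qed

lemma open_invertible: "open {A :: real^'n^'n. invertible A}"
proof -
  have "continuous_on UNIV (det :: real^'n^'n \<Rightarrow> real)"
    unfolding det_def by (intro continuous_intros)
  then have "open (det -` (- {0}) :: (real^'n^'n) set)"
    by (intro open_vimage) auto
  moreover have "{A :: real^'n^'n. invertible A} = det -` (- {0})" by (auto simp: invertible_det_nz)
  ultimately show ?thesis by simp
qed

lemma smooth_on_matrix_inv: "smooth_on {A :: real^'n^'n. invertible A} matrix_inv"
  unfolding smooth_on_open_iff[OF open_invertible]
proof
  fix m
  \<comment> \<open>The matrix inverse is the value at \<open>mat 1\<close> of the inverse of the
    operator \<open>X \<mapsto> A ** X\<close>, so the result on inverse operators applies.\<close>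
  have "Cm_on m {A :: real^'n^'n. invertible A} (\<lambda>A. matrix_inv A ** mat 1)"
  proof (rule Cm_on_operator_inverse[OF open_invertible])
    show "Cm_on m {A :: real^'n^'n. invertible A} (\<lambda>A. A ** X)" for X :: "real^'n^'n"
      by (rule Cm_on_linear) (rule bounded_linear.linear[OF matmul.bounded_linear_left])
  qed (auto simp: matrix_mul_assoc matrix_inv_works intro!: bounded_linear.linear[OF matmul.bounded_linear_right])
  then show "Cm_on m {A :: real^'n^'n. invertible A} matrix_inv" by simp
qed

lemmas smooth_on_matrix_mult = smooth_on_bilinear[OF bounded_bilinear_matrix_mult]

lemma smooth_on_matrix_inv_compose:
  assumes "smooth_on S f" "\<And>x. x \<in> S \<Longrightarrow> invertible (f x :: real^'n^'n)"
  shows "smooth_on S (\<lambda>x. matrix_inv (f x))"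
  by (rule smooth_on_compose[OF assms(1) smooth_on_matrix_inv]) (use assms(2) in auto)

section \<open>Full rank, Gram matrices and orthogonal projections\<close>

lemma inner_matrix_vector_transpose: "(A *v x) \<bullet> y = x \<bullet> (transpose A *v y)"
  for A :: "real^'m^'n"
  by (metis dot_lmul_matrix transpose_matrix_vector inner_commute transpose_transpose)

lemma full_rank_iff_inj: "A \<in> full_rank_matrices \<longleftrightarrow> inj ((*v) A)"
  by (simp add: full_rank_matrices_def full_rank_injective)

lemma full_rank_left_inverse: "B ** A = mat 1 \<Longrightarrow> A \<in> full_rank_matrices"
  for A :: "real^'k^'n"
  unfolding full_rank_iff_inj by (metis inj_on_inverseI matrix_vector_mul_assoc matrix_vector_mul_lid)

lemma full_rank_iff_gram: "A \<in> full_rank_matrices \<longleftrightarrow> invertible (transpose A ** A)"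
  for A :: "real^'k^'n"
proof
  assume A: "A \<in> full_rank_matrices"
  have "x = 0" if "(transpose A ** A) *v x = 0" for x
  proof -
    have "(A *v x) \<bullet> (A *v x) = x \<bullet> ((transpose A ** A) *v x)"
      by (simp only: inner_matrix_vector_transpose matrix_vector_mul_assoc)
    then have "A *v x = A *v 0" using that by simp
    then show "x = 0" using A unfolding full_rank_iff_inj by (rule injD[rotated])
  qed
  then show "invertible (transpose A ** A)"
    using matrix_left_invertible_ker invertible_left_inverse by blast
next
  assume "invertible (transpose A ** A)"
  then show "A \<in> full_rank_matrices"
    using full_rank_left_inverse matrix_inv_works(2) by (metis matrix_mul_assoc)
qed

lemma full_rank_mult_iff:
  fixes A :: "real^'k^'n" and X :: "real^'k^'k"
  assumes "A \<in> full_rank_matrices"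
  shows "A ** X \<in> full_rank_matrices \<longleftrightarrow> invertible X"
proof -
  have A: "inj ((*v) A)" using assms full_rank_iff_inj by blast
  have "(*v) (A ** X) = (*v) A \<circ> (*v) X" by (auto simp: matrix_vector_mul_assoc)
  then have "A ** X \<in> full_rank_matrices \<longleftrightarrow> inj ((*v) X)"
    using inj_compose[OF A] inj_on_imageI2 unfolding full_rank_iff_inj by metis
  then show ?thesis using matrix_left_invertible_injective invertible_left_inverse by blast
qed

lemma open_full_rank: "open (full_rank_matrices :: (real^'k^'n) set)"
proof -
  have "smooth_on UNIV (\<lambda>A :: real^'k^'n. transpose A ** A)"
    by (rule smooth_on_matrix_mult[OF smooth_on_linear[OF linear_transpose] smooth_on_ident])
  then have "open ((\<lambda>A :: real^'k^'n. transpose A ** A) -` {B. invertible B})"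
    using smooth_on_imp_continuous_on open_vimage open_invertible by blast
  moreover have "(full_rank_matrices :: (real^'k^'n) set) = (\<lambda>A. transpose A ** A) -` {B. invertible B}"
    using full_rank_iff_gram by auto
  ultimately show ?thesis by simp
qed

lemma orthonormal_columns_iff: "orthonormal_columns Y \<longleftrightarrow> transpose Y ** Y = mat 1"
  for Y :: "real^'k^'n"
  by (simp add: orthonormal_columns_def vec_eq_iff matrix_mult_transpose_dot_column mat_def)

lemma orthonormal_full_rank: "orthonormal_columns Y \<Longrightarrow> Y \<in> full_rank_matrices"
  for Y :: "real^'k^'n"
  using full_rank_left_inverse orthonormal_columns_iff by blast

text \<open>The orthogonal projection onto the column space, written without choosing an orthonormal
  basis. The bracketing exposes the left factor \<open>A\<close>, so anything the projection
  produces is visibly of the form \<open>A ** W\<close>.\<close>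

definition column_projection :: "real^'k^'n \<Rightarrow> real^'n^'n" where
  "column_projection A = A ** (matrix_inv (transpose A ** A) ** transpose A)"

definition column_reflection :: "real^'k^'n \<Rightarrow> real^'n^'n" where
  "column_reflection A = 2 *\<^sub>R column_projection A - mat 1"

lemma matrix_inv_transpose:
  fixes A :: "real^'n^'n"
  assumes "invertible A"
  shows "transpose (matrix_inv A) = matrix_inv (transpose A)"
proof (rule matrix_inv_eqI[symmetric])
  show "transpose A ** transpose (matrix_inv A) = mat 1"
    by (metis assms matrix_inv_works(2) matrix_transpose_mul transpose_mat)
qed

lemma column_projection:
  fixes A :: "real^'k^'n"
  assumes "A \<in> full_rank_matrices"
  shows "transpose (column_projection A) = column_projection A"
    and "column_projection A ** A = A"
    and "column_projection A ** column_projection A = column_projection A"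
    and "trace (column_projection A) = real CARD('k)"
proof -
  have G: "invertible (transpose A ** A)" using assms full_rank_iff_gram by blast
  show "transpose (column_projection A) = column_projection A"
    by (simp add: column_projection_def matrix_transpose_mul matrix_inv_transpose[OF G] matrix_mul_assoc)
  show 1: "column_projection A ** A = A"
    using matrix_inv_works(2)[OF G] by (simp add: column_projection_def matrix_mul_assoc[symmetric])
  then show "column_projection A ** column_projection A = column_projection A"
    by (metis column_projection_def matrix_mul_assoc)
  have "trace (column_projection A) = trace (matrix_inv (transpose A ** A) ** transpose A ** A)"
    unfolding column_projection_def by (rule trace_mul_sym)
  also have "\<dots> = real CARD('k)"
    using matrix_inv_works(2)[OF G] by (simp add: matrix_mul_assoc[symmetric] trace_I)
  finally show "trace (column_projection A) = real CARD('k)" .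
qed

lemma column_projection_orthonormal:
  "orthonormal_columns Y \<Longrightarrow> column_projection Y = Y ** transpose Y" for Y :: "real^'k^'n"
  using matrix_inv_eqI[of "mat 1 :: real^'k^'k" "mat 1"]
  by (simp add: column_projection_def orthonormal_columns_iff)

text \<open>The two product hypotheses say that each matrix fixes the range of the other.
  Transposing the first gives \<open>P' ** P = P'\<close>, and the second says that this product is
  \<open>P\<close>.\<close>

lemma symmetric_projections_eq:
  fixes P P' :: "real^'n^'n"
  assumes "transpose P = P" "transpose P' = P'" "P ** P' = P'" "P' ** P = P"
  shows "P = P'"
  by (metis assms matrix_transpose_mul)

lemma column_projection_mult_right:
  fixes A :: "real^'k^'n" and X :: "real^'k^'k"
  assumes "A \<in> full_rank_matrices" "invertible X"
  shows "column_projection (A ** X) = column_projection A"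
proof (rule symmetric_projections_eq)
  let ?P = "column_projection A" and ?P' = "column_projection (A ** X)"
  have AX: "A ** X \<in> full_rank_matrices" using full_rank_mult_iff[OF assms(1)] assms(2) by simp
  show "transpose ?P = ?P" "transpose ?P' = ?P'" by (rule column_projection(1)[OF assms(1)], rule column_projection(1)[OF AX])
  obtain Z where Z: "?P' = A ** X ** Z" using column_projection_def by blast
  have "?P ** ?P' = (?P ** A) ** X ** Z" by (simp add: Z matrix_mul_assoc)
  then show "?P ** ?P' = ?P'" using column_projection(2)[OF assms(1)] Z by simp
  have "?P' ** (A ** X) ** matrix_inv X = A ** X ** matrix_inv X"
    using column_projection(2)[OF AX] by simp
  then have PA: "?P' ** A = A"
    using matrix_inv_works(1)[OF assms(2)] by (simp add: matrix_mul_assoc[symmetric])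
  obtain W where W: "?P = A ** W" using column_projection_def by blast
  show "?P' ** ?P = ?P" by (simp add: W matrix_mul_assoc PA)
qed

lemma column_reflection_mult_right:
  fixes A :: "real^'k^'n" and X :: "real^'k^'k"
  assumes "A \<in> full_rank_matrices" "invertible X"
  shows "column_reflection (A ** X) = column_reflection A"
  by (simp add: column_reflection_def column_projection_mult_right[OF assms])

lemma column_reflection_orthonormal:
  "orthonormal_columns Y \<Longrightarrow> column_reflection Y = 2 *\<^sub>R (Y ** transpose Y) - mat 1" for Y :: "real^'k^'n"
  by (simp add: column_reflection_def column_projection_orthonormal)

section \<open>Classes under right multiplication and their invariant\<close>

lemma gl_class_self: "A \<in> gl_class A"
  unfolding gl_class_def by (intro CollectI exI[of _ "mat 1"]) (auto simp: invertible_def intro: exI[of _ "mat 1"])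

lemma gl_class_full_rank: "A \<in> full_rank_matrices \<Longrightarrow> B \<in> gl_class A \<Longrightarrow> B \<in> full_rank_matrices"
  by (auto simp: gl_class_def full_rank_mult_iff)

lemma gl_class_mult_right:
  fixes A :: "real^'k^'n" and X :: "real^'k^'k"
  assumes "invertible X"
  shows "gl_class (A ** X) = gl_class A"
proof -
  have "A ** X ** Y \<in> gl_class A" if "invertible Y" for Y
    using invertible_mult[OF assms that] by (auto simp: gl_class_def matrix_mul_assoc[symmetric])
  moreover have "A ** Y \<in> gl_class (A ** X)" if "invertible Y" for Y
  proof -
    have "A ** Y = A ** X ** (matrix_inv X ** Y)"
      using matrix_inv_works(1)[OF assms] by (simp add: matrix_mul_assoc) (simp add: matrix_mul_assoc[symmetric])
    then show ?thesis
      using invertible_mult[OF invertible_matrix_inv[OF assms] that] by (auto simp: gl_class_def)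
  qed
  ultimately show ?thesis by (auto simp: gl_class_def)
qed

text \<open>Equal projections give \<open>A = column_projection B ** A\<close>. Splitting off the
  left factor \<open>B\<close> of the projection leaves \<open>X\<close>, which is invertible
  because \<open>A\<close> has full rank.\<close>

lemma column_reflection_eqD:
  fixes A B :: "real^'k^'n"
  assumes "A \<in> full_rank_matrices" "B \<in> full_rank_matrices" "column_reflection A = column_reflection B"
  obtains X :: "real^'k^'k" where "invertible X" "A = B ** X"
proof -
  have "column_projection A = column_projection B" using assms(3) by (simp add: column_reflection_def)
  then have "column_projection B ** A = A" using column_projection(2)[OF assms(1)] by simp
  then have "A = B ** ((matrix_inv (transpose B ** B) ** transpose B) ** A)"
    by (simp add: column_projection_def matrix_mul_assoc)
  moreover from this have "invertible ((matrix_inv (transpose B ** B) ** transpose B) ** A)"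
    using full_rank_mult_iff[OF assms(2)] assms(1) by metis
  ultimately show ?thesis using that by blast
qed

lemma gl_class_eq_iff:
  fixes A B :: "real^'k^'n"
  assumes "A \<in> full_rank_matrices" "B \<in> full_rank_matrices"
  shows "gl_class A = gl_class B \<longleftrightarrow> column_reflection A = column_reflection B"
proof
  assume "gl_class A = gl_class B"
  then have "A \<in> gl_class B" using gl_class_self by blast
  then show "column_reflection A = column_reflection B"
    using column_reflection_mult_right[OF assms(2)] by (auto simp: gl_class_def)
next
  assume "column_reflection A = column_reflection B"
  then show "gl_class A = gl_class B"
    using column_reflection_eqD[OF assms] gl_class_mult_right by metis
qed

text \<open>Both \<open>A\<close> and \<open>Y\<close> have full rank, so \<open>R\<close> is
  invertible and \<open>Y\<close> is an orthonormal representative of the class of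
  \<open>A\<close>.\<close>

lemma qr_column_reflection:
  assumes "A \<in> full_rank_matrices" "qr_factorization A Y R"
  shows "column_reflection A = 2 *\<^sub>R (Y ** transpose Y) - mat 1"
proof -
  have A: "A = Y ** R" and Y: "orthonormal_columns Y" using assms(2) by (auto simp: qr_factorization_def)
  have "invertible R" using full_rank_mult_iff[OF orthonormal_full_rank[OF Y]] assms(1) A by blast
  then show ?thesis
    using column_reflection_mult_right[OF orthonormal_full_rank[OF Y]] A column_reflection_orthonormal[OF Y] by simp
qed

lemma smooth_on_column_reflection: "smooth_on full_rank_matrices (column_reflection :: real^'k^'n \<Rightarrow> _)"
proof -
  have "smooth_on full_rank_matrices (\<lambda>A :: real^'k^'n. 2 *\<^sub>R (A ** (matrix_inv (transpose A ** A) ** transpose A)) + - mat 1)"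
    by (intro smooth_on_add smooth_on_scaleR smooth_on_matrix_mult smooth_on_matrix_inv_compose smooth_on_const
        smooth_on_ident smooth_on_linear linear_transpose) (simp add: full_rank_iff_gram)
  then show ?thesis
    by (rule smooth_on_cong) (simp add: column_reflection_def column_projection_def)
qed

lemma trace_scaleR: "trace (r *\<^sub>R A) = r * trace A" for A :: "real^'n^'n"
  by (simp add: trace_def sum_distrib_left)

lemma column_reflection_involution:
  fixes A :: "real^'k^'n"
  assumes "A \<in> full_rank_matrices"
  shows "column_reflection A \<in> involution_model CARD('k)"
proof -
  let ?P = "column_projection A"
  note P = column_projection[OF assms]
  have sym: "transpose (column_reflection A) = column_reflection A"
    by (simp add: column_reflection_def transpose_diff transpose_scalar P(1))
  have "column_reflection A ** column_reflection A = mat 1"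
    by (simp add: column_reflection_def matmul.diff_left matmul.diff_right matmul.scaleR_left
        matmul.scaleR_right P(3))
       (simp add: scaleR_2)
  moreover have "trace (column_reflection A) = 2 * real CARD('k) - real CARD('n)"
    using P(4) by (simp add: column_reflection_def trace_sub trace_I trace_scaleR)
  ultimately show ?thesis
    using sym by (simp add: involution_model_def orthogonal_group_def orthogonal_matrix_def)
qed

text \<open>For an orthogonal projection the trace equals the dimension of the range, so an
  orthonormal basis of the range can be indexed by \<open>'k\<close> and arranged as the columns of
  \<open>Y\<close>.\<close>

lemma symmetric_idempotent_decomposition:
  fixes P :: "real^'n^'n"
  assumes sym: "transpose P = P" and idem: "P ** P = P" and tr: "trace P = real CARD('k::finite)"
  obtains Y :: "real^'k^'n" where "orthonormal_columns Y" "P = Y ** transpose Y"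
proof -
  have "subspace (range ((*v) P))" by (simp add: linear_subspace_image)
  from orthonormal_basis_subspace[OF this]
  obtain B where B: "B \<subseteq> range ((*v) P)" "pairwise orthogonal B" "\<And>x. x \<in> B \<Longrightarrow> norm x = 1"
    "independent B" "card B = dim (range ((*v) P))" "span B = range ((*v) P)" by metis
  have fin: "finite B" using B(4) independent_imp_finite by blast
  have Pb: "P *v b = b" if b: "b \<in> range ((*v) P)" for b
    using b idem by (auto simp: matrix_vector_mul_assoc)
  have ip: "b \<bullet> c = (if b = c then 1 else 0)" if "b \<in> B" "c \<in> B" for b c
    using B(2,3) that by (auto simp: pairwise_def orthogonal_def dot_square_norm)
  \<comment> \<open>Symmetry moves \<open>P\<close> to the basis vector \<open>c\<close>, which it
    fixes, so the coefficients of \<open>P *v x\<close> are the inner products of \<open>x\<close>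
    with the basis.\<close>
  have exp: "P *v x = (\<Sum>b\<in>B. (x \<bullet> b) *\<^sub>R b)" for x
  proof -
    have "P *v x \<in> span B" using B(6) by simp
    then obtain u where u: "P *v x = (\<Sum>b\<in>B. u b *\<^sub>R b)" using span_finite[OF fin] by auto
    have "u c = x \<bullet> c" if c: "c \<in> B" for c
    proof -
      have "(P *v x) \<bullet> c = (\<Sum>b\<in>B. if b = c then u b else 0)"
        unfolding u inner_sum_left by (rule sum.cong) (use ip c in auto)
      also have "\<dots> = u c" using fin c by simp
      finally have "u c = (P *v x) \<bullet> c" by simp
      also have "\<dots> = x \<bullet> (P *v c)" by (simp add: inner_matrix_vector_transpose[of P x c] sym del: transpose_matrix_vector)
      also have "P *v c = c" by (rule Pb) (use c B(1) in blast)
      finally show ?thesis .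
    qed
    then show ?thesis using u by simp
  qed
  \<comment> \<open>Exchanging the two sums turns the trace into the sum of the squared norms of the
    basis vectors, each equal to 1.\<close>
  have "trace P = (\<Sum>i\<in>UNIV. axis i 1 \<bullet> (P *v axis i 1))"
    by (simp add: trace_def matrix_vector_mult_basis column_def inner_axis' )
  also have "\<dots> = (\<Sum>i\<in>UNIV. \<Sum>b\<in>B. (b $ i) * (b $ i))"
    by (simp add: exp inner_sum_right inner_axis inner_axis' )
  also have "\<dots> = (\<Sum>b\<in>B. \<Sum>i\<in>UNIV. (b $ i) * (b $ i))" by (rule sum.swap)
  also have "\<dots> = (\<Sum>b\<in>B. b \<bullet> b)" by (simp add: inner_vec_def)
  also have "\<dots> = real (card B)" using ip by simp
  finally have "card B = CARD('k)" using tr by simp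
  then obtain y where y: "bij_betw y (UNIV :: 'k set) B"
    using finite_same_card_bij[of "UNIV :: 'k set" B] fin by auto
  define Y :: "real^'k^'n" where "Y = (\<chi> i j. y j $ i)"
  have col: "column j Y = y j" for j by (simp add: column_def Y_def)
  have yB: "y j \<in> B" for j using y by (auto simp: bij_betw_def)
  have Y: "orthonormal_columns Y"
    unfolding orthonormal_columns_def col using ip[OF yB yB] y
    by (auto simp: bij_betw_def inj_eq)
  have "(Y ** transpose Y) *v x = P *v x" for x
  proof -
    have "(Y ** transpose Y) *v x = Y *v (transpose Y *v x)"
      by (simp only: matrix_vector_mul_assoc)
    also have "\<dots> = (\<Sum>j\<in>UNIV. (transpose Y *v x) $ j *\<^sub>R y j)"
      by (simp add: matrix_mult_sum col scalar_mult_eq_scaleR del: transpose_matrix_vector)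
    also have "\<dots> = (\<Sum>j\<in>UNIV. (x \<bullet> y j) *\<^sub>R y j)"
      by (simp add: matrix_vector_mul_component Y_def transpose_def inner_vec_def mult.commute del: transpose_matrix_vector)
    also have "\<dots> = P *v x" unfolding exp by (rule sum.reindex_bij_betw[OF y])
    finally show ?thesis .
  qed
  then have "P = Y ** transpose Y" by (simp add: matrix_eq)
  then show ?thesis using that Y by blast
qed

text \<open>\<open>P\<close> is the orthogonal projection onto the 1-eigenspace of \<open>Q\<close>;
  the trace condition on \<open>Q\<close> becomes the statement that this projection has trace
  \<open>m\<close>.\<close>

lemma involution_model_projection:
  fixes Q :: "real^'n^'n"
  assumes "Q \<in> involution_model m"
  defines "P \<equiv> (1/2) *\<^sub>R (mat 1 + Q)"
  shows "transpose P = P" "P ** P = P" "trace P = real m" "Q = 2 *\<^sub>R P - mat 1" "Q ** Q = mat 1"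
proof -
  have Q: "transpose Q = Q" "Q ** Q = mat 1" "trace Q = 2 * real m - real CARD('n)"
    using assms(1) by (auto simp: involution_model_def orthogonal_group_def orthogonal_matrix_def)
  show "transpose P = P" by (simp add: P_def transpose_scalar transpose_add Q)
  have "(mat 1 + Q) ** (mat 1 + Q) = 2 *\<^sub>R (mat 1 + Q)"
    by (simp add: matmul.add_left matmul.add_right Q scaleR_2 add_ac)
  then show "P ** P = P" by (simp add: P_def matmul.scaleR_left matmul.scaleR_right)
  show "trace P = real m" by (simp add: P_def trace_scaleR trace_add trace_I Q)
  show "Q = 2 *\<^sub>R P - mat 1" by (simp add: P_def)
  show "Q ** Q = mat 1" by (rule Q)
qed

lemma involution_model_decomposition:
  fixes Q :: "real^'n^'n"
  assumes "Q \<in> involution_model CARD('k::finite)"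
  obtains Y :: "real^'k^'n" where "orthonormal_columns Y" "Q = 2 *\<^sub>R (Y ** transpose Y) - mat 1"
  using symmetric_idempotent_decomposition[OF involution_model_projection(1-3)[OF assms]]
    involution_model_projection(4)[OF assms] by metis

lemma image_column_reflection:
  "(column_reflection :: real^'k^'n \<Rightarrow> _) ` full_rank_matrices = involution_model CARD('k)"
proof
  show "(column_reflection :: real^'k^'n \<Rightarrow> _) ` full_rank_matrices \<subseteq> involution_model CARD('k)"
    using column_reflection_involution by blast
  show "involution_model CARD('k) \<subseteq> (column_reflection :: real^'k^'n \<Rightarrow> _) ` full_rank_matrices"
  proof
    fix Q :: "real^'n^'n"
    assume "Q \<in> involution_model CARD('k)"
    then obtain Y :: "real^'k^'n" where "orthonormal_columns Y" "Q = 2 *\<^sub>R (Y ** transpose Y) - mat 1"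
      by (rule involution_model_decomposition)
    then show "Q \<in> (column_reflection :: real^'k^'n \<Rightarrow> _) ` full_rank_matrices"
      using column_reflection_orthonormal orthonormal_full_rank by (metis imageI)
  qed
qed

text \<open>\<open>s P\<close> projects the fixed frame \<open>Y\<close> onto the 1-eigenspace of
  \<open>P\<close>. As long as the result has full rank, its columns span that eigenspace for
  dimension reasons; at \<open>Q\<close> the frame \<open>Y\<close> is reproduced.\<close>

lemma column_reflection_local_section:
  fixes Q :: "real^'n^'n"
  assumes "Q \<in> involution_model CARD('k::finite)"
  obtains T and s :: "real^'n^'n \<Rightarrow> real^'k^'n" where "open T" "Q \<in> T" "smooth_on T s" "s ` T \<subseteq> full_rank_matrices"
    "\<And>P. P \<in> involution_model CARD('k) \<inter> T \<Longrightarrow> column_reflection (s P) = P"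
proof -
  obtain Y :: "real^'k^'n" where Y: "orthonormal_columns Y" "Q = 2 *\<^sub>R (Y ** transpose Y) - mat 1"
    using involution_model_decomposition[OF assms] .
  have YY: "transpose Y ** Y = mat 1" using Y(1) orthonormal_columns_iff by blast
  define s :: "real^'n^'n \<Rightarrow> real^'k^'n" where "s P = ((1/2) *\<^sub>R (mat 1 + P)) ** Y" for P
  have sm: "smooth_on UNIV s"
    unfolding s_def by (intro smooth_on_matrix_mult smooth_on_scaleR smooth_on_add smooth_on_const smooth_on_ident)
  have half: "(1/2) *\<^sub>R (mat 1 + (2 *\<^sub>R (Z ** transpose Z) - mat 1)) = Z ** transpose Z" for Z :: "real^'k^'n"
    by simp
  let ?T = "s -` full_rank_matrices"
  have "open ?T" using open_vimage[OF open_full_rank smooth_on_imp_continuous_on[OF sm]] .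
  moreover have "s Q = Y" unfolding s_def Y(2) half using YY by (simp add: matrix_mul_assoc[symmetric])
  then have "Q \<in> ?T" using orthonormal_full_rank[OF Y(1)] by simp
  moreover have "column_reflection (s P) = P" if P: "P \<in> involution_model CARD('k) \<inter> ?T" for P
  proof -
    obtain Z :: "real^'k^'n" where Z: "orthonormal_columns Z" "P = 2 *\<^sub>R (Z ** transpose Z) - mat 1"
      using involution_model_decomposition P by blast
    \<comment> \<open>In an orthonormal frame \<open>Z\<close> of the eigenspace of \<open>P\<close>
      the projected frame has the square coefficient matrix \<open>transpose Z ** Y\<close>, and
      full rank makes it invertible.\<close>
    have sP: "s P = Z ** (transpose Z ** Y)" unfolding s_def Z(2) half by (simp add: matrix_mul_assoc)
    then have "invertible (transpose Z ** Y)"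
      using P full_rank_mult_iff[OF orthonormal_full_rank[OF Z(1)], of "transpose Z ** Y"] by simp
    then show ?thesis
      unfolding sP using column_reflection_mult_right[OF orthonormal_full_rank[OF Z(1)]]
        column_reflection_orthonormal[OF Z(1)] Z(2) by simp
  qed
  ultimately show ?thesis using that[of ?T s] smooth_on_subset[OF sm] by blast
qed

lemma span_columns: "span (columns A) = range ((*v) A)" for A :: "real^'k^'n"
proof -
  have "range (\<lambda>i. axis i 1) = (Basis :: (real^'k) set)" by (auto simp: Basis_vec_def)
  then show ?thesis
    using linear_span_image[of "(*v) A" Basis] by (simp add: columns_image_basis)
qed

text \<open>Left to right, \<open>(I + Q) / 2\<close> and \<open>Y ** transpose Y\<close> are
  symmetric and each fixes the range of the other, since both ranges are the 1-eigenspace; hence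
  they agree.\<close>

lemma eigenspace_basis_reflection:
  fixes Q :: "real^'n^'n" and Y :: "real^'k^'n"
  assumes Q: "Q \<in> involution_model CARD('k)"
  shows "eigenspace_basis Q Y \<longleftrightarrow> orthonormal_columns Y \<and> Q = 2 *\<^sub>R (Y ** transpose Y) - mat 1"
proof
  assume R: "orthonormal_columns Y \<and> Q = 2 *\<^sub>R (Y ** transpose Y) - mat 1"
  then have YY: "transpose Y ** Y = mat 1" using orthonormal_columns_iff by blast
  have Qx: "Q *v x = 2 *\<^sub>R (Y *v (transpose Y *v x)) - x" for x
    using R by (simp add: matrix_vector_mult_diff_rdistrib scaleR_matrix_vector_assoc[symmetric]
        matrix_vector_mul_assoc del: transpose_matrix_vector)
  have "Q *v x = x \<longleftrightarrow> x \<in> range ((*v) Y)" for x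
  proof
    assume "Q *v x = x"
    then have "2 *\<^sub>R (Y *v (transpose Y *v x)) = 2 *\<^sub>R x" unfolding Qx by (simp add: scaleR_2 algebra_simps del: transpose_matrix_vector)
    then show "x \<in> range ((*v) Y)" by (metis rangeI scaleR_left_imp_eq zero_neq_numeral)
  next
    assume "x \<in> range ((*v) Y)"
    then obtain z where z: "x = Y *v z" by blast
    have "transpose Y *v x = z" unfolding z matrix_vector_mul_assoc YY by simp
    then show "Q *v x = x" unfolding Qx z by (simp add: scaleR_2 del: transpose_matrix_vector)
  qed
  moreover note span_columns[of Y]
  ultimately show "eigenspace_basis Q Y" using R by (auto simp: eigenspace_basis_def)
next
  assume E: "eigenspace_basis Q Y"
  then have Y: "orthonormal_columns Y" and sp: "span (columns Y) = {x. Q *v x = x}"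
    by (auto simp: eigenspace_basis_def)
  let ?P = "(1/2) *\<^sub>R (mat 1 + Q)" and ?R = "Y ** transpose Y"
  note P = involution_model_projection[OF Q]
  have YY: "transpose Y ** Y = mat 1" using Y orthonormal_columns_iff by blast
  note range = span_columns[of Y]
  have "?P ** ?R = ?R"
  proof -
    have "?P *v (Y *v z) = Y *v z" for z
    proof -
      have "Q *v (Y *v z) = Y *v z" using sp range by blast
      then show ?thesis
        by (simp add: scaleR_matrix_vector_assoc[symmetric] matrix_vector_mult_add_rdistrib)
    qed
    then have "?P ** Y = Y" by (simp add: matrix_eq matrix_vector_mul_assoc)
    then show ?thesis by (simp add: matrix_mul_assoc)
  qed
  moreover have "?R ** ?P = ?P"
  proof -
    have "?R *v (?P *v x) = ?P *v x" for x
    proof -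
      have "Q *v (?P *v x) = ?P *v x"
      proof -
        have "Q ** ?P = ?P"
          by (simp add: matmul.scaleR_right matmul.add_right P(5) add.commute)
        then show ?thesis by (simp only: matrix_vector_mul_assoc)
      qed
      then obtain z where z: "?P *v x = Y *v z" using sp range by blast
      show ?thesis unfolding z by (simp only: matrix_vector_mul_assoc matrix_mul_assoc[symmetric] YY matrix_mul_rid)
    qed
    then show ?thesis unfolding matrix_eq matrix_vector_mul_assoc by blast
  qed
  moreover have "transpose ?R = ?R" by (simp add: matrix_transpose_mul)
  ultimately have "?P = ?R" using symmetric_projections_eq P(1) by blast
  then show "orthonormal_columns Y \<and> Q = 2 *\<^sub>R (Y ** transpose Y) - mat 1" using Y P(4) by simp
qed

section \<open>QR factorizations and frames\<close>

text \<open>Indices are added in increasing order, so each \<open>a j\<close> needs only the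
  \<open>y i\<close> with \<open>i \<le> j\<close>; this becomes the triangular shape of
  \<open>R\<close>. The last clause keeps the projection \<open>s\<close> of a new vector in the
  span of the old ones, so that independence leaves a nonzero remainder \<open>w\<close>.\<close>

lemma gram_schmidt_flag:
  fixes a :: "'k::linorder \<Rightarrow> 'v::euclidean_space"
  assumes "finite J" and indep: "\<And>b I. b \<notin> I \<Longrightarrow> a b \<notin> span (a ` I)"
  shows "\<exists>y. (\<forall>i\<in>J. \<forall>j\<in>J. y i \<bullet> y j = (if i = j then 1 else 0)) \<and>
    (\<forall>j\<in>J. a j \<in> span (y ` {i \<in> J. i \<le> j})) \<and> (\<forall>j\<in>J. y j \<in> span (a ` J))"
  using assms(1)
proof (induction J rule: finite_linorder_max_induct)
  case empty
  then show ?case by simp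
next
  case (insert b J)
  then obtain y where y: "\<And>i j. i \<in> J \<Longrightarrow> j \<in> J \<Longrightarrow> y i \<bullet> y j = (if i = j then 1 else 0)"
    "\<And>j. j \<in> J \<Longrightarrow> a j \<in> span (y ` {i \<in> J. i \<le> j})" "\<And>j. j \<in> J \<Longrightarrow> y j \<in> span (a ` J)"
    by blast
  have b: "b \<notin> J" using insert.hyps by blast
  define s where "s = (\<Sum>i\<in>J. (a b \<bullet> y i) *\<^sub>R y i)"
  define w where "w = a b - s"
  have s_a: "s \<in> span (a ` J)" unfolding s_def by (intro span_sum span_scale y(3))
  have w0: "w \<noteq> 0" using indep[OF b] s_a by (auto simp: w_def)
  have wy: "w \<bullet> y j = 0" if "j \<in> J" for j
  proof -
    have "s \<bullet> y j = (\<Sum>i\<in>J. if i = j then a b \<bullet> y i else 0)"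
      unfolding s_def inner_sum_left by (rule sum.cong) (use y(1) that in auto)
    then show ?thesis using that insert.hyps(1) by (simp add: w_def inner_diff_left)
  qed
  define u where "u = w /\<^sub>R norm w"
  have uu: "u \<bullet> u = 1" using w0 by (simp add: u_def dot_square_norm power2_eq_square)
  have uy: "u \<bullet> y j = 0" "y j \<bullet> u = 0" if "j \<in> J" for j
    using wy[OF that] by (simp_all add: u_def inner_commute)
  let ?y = "y(b := u)"
  have "?y i \<bullet> ?y j = (if i = j then 1 else 0)" if "i \<in> insert b J" "j \<in> insert b J" for i j
    using that y(1) uu uy b by auto
  moreover have "a j \<in> span (?y ` {i \<in> insert b J. i \<le> j})" if j: "j \<in> insert b J" for j
  proof (cases "j = b")
    case True
    have "a b = s + norm w *\<^sub>R u" using w0 by (simp add: u_def w_def)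
    moreover have "s \<in> span (?y ` {i \<in> insert b J. i \<le> b})"
      unfolding s_def
    proof (intro span_sum span_scale span_base)
      fix i assume "i \<in> J"
      then show "y i \<in> ?y ` {i \<in> insert b J. i \<le> b}"
        using b insert.hyps(2) by (intro image_eqI[of _ _ i]) (auto simp: less_imp_le)
    qed
    moreover have "u \<in> span (?y ` {i \<in> insert b J. i \<le> b})"
      by (intro span_base image_eqI[of _ _ b]) auto
    ultimately show ?thesis using True span_add span_scale by metis
  next
    case False
    then have jJ: "j \<in> J" using j by simp
    have "y ` {i \<in> J. i \<le> j} \<subseteq> ?y ` {i \<in> insert b J. i \<le> j}" using b by force
    then show ?thesis using y(2)[OF jJ] span_mono by blast
  qed
  moreover have "?y j \<in> span (a ` insert b J)" if j: "j \<in> insert b J" for j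
  proof (cases "j = b")
    case True
    have "s \<in> span (a ` insert b J)" using s_a span_mono[of "a ` J" "a ` insert b J"] by blast
    moreover have "a b \<in> span (a ` insert b J)" by (intro span_base) simp
    ultimately have "w \<in> span (a ` insert b J)" unfolding w_def by (intro span_diff)
    then show ?thesis using True by (simp add: u_def span_scale)
  next
    case False
    then show ?thesis using y(3)[of j] j span_mono[of "a ` J" "a ` insert b J"] by auto
  qed
  ultimately show ?case by blast
qed

lemma qr_factorization_exists:
  fixes A :: "real^'k::{finite,linorder}^'n"
  assumes "A \<in> full_rank_matrices"
  shows "\<exists>Y R. qr_factorization A Y R"
proof -
  let ?a = "\<lambda>j. column j A"
  have "?a b \<notin> span (?a ` I)" if "b \<notin> I" for b I
  proof
    have col: "?a j = A *v axis j 1" for j by (simp add: matrix_vector_mult_basis)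
    have "?a ` I = (*v) A ` ((\<lambda>j. axis j 1) ` I)" by (auto simp: col image_image)
    then have "span (?a ` I) = (*v) A ` span ((\<lambda>j. axis j 1) ` I)"
      by (simp only: linear_span_image[OF matrix_vector_mul_linear])
    moreover assume "?a b \<in> span (?a ` I)"
    ultimately have "axis b 1 \<in> span ((\<lambda>j. axis j (1 :: real)) ` I)"
      using assms unfolding full_rank_iff_inj col by (auto dest: injD)
    \<comment> \<open>Injectivity of \<open>A\<close> has pulled the dependence back to unit
      vectors, and there the coordinate \<open>b\<close> of the others vanishes.\<close>
    moreover have "x $ b = 0" if "x \<in> span ((\<lambda>j. axis j (1 :: real)) ` I)" for x
      using that by (induction rule: span_induct) (use \<open>b \<notin> I\<close> in \<open>auto simp: subspace_def axis_def\<close>)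
    ultimately show False by fastforce
  qed
  then obtain y where "\<forall>i\<in>UNIV. \<forall>j\<in>UNIV. y i \<bullet> y j = (if i = j then 1 else 0)"
    "\<forall>j\<in>UNIV. ?a j \<in> span (y ` {i \<in> UNIV. i \<le> j})"
    using gram_schmidt_flag[of "UNIV :: 'k set" ?a] by auto
  then have y: "y i \<bullet> y j = (if i = j then 1 else 0)" "?a j \<in> span (y ` {i. i \<le> j})" for i j by auto
  define Y :: "real^'k::{finite,linorder}^'n" where "Y = (\<chi> i j. y j $ i)"
  have col: "column j Y = y j" for j by (simp add: column_def Y_def)
  have Y: "orthonormal_columns Y" using y(1) by (simp add: orthonormal_columns_def col)
  then have YY: "transpose Y ** Y = mat 1" using orthonormal_columns_iff by blast
  define R where "R = transpose Y ** A"
  have cY: "columns Y = range y" by (auto simp: columns_def col)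
  have "columns A \<subseteq> span (columns Y)"
    unfolding cY using y(2) span_mono[of "y ` {i. i \<le> j}" "range y" for j] by (auto simp: columns_def)
  then have sub: "span (columns A) \<subseteq> range ((*v) Y)" unfolding span_columns[symmetric] by (simp add: span_minimal)
  have "Y ** R *v x = A *v x" for x
  proof -
    have "A *v x \<in> range ((*v) Y)" using sub unfolding span_columns by blast
    then obtain z where z: "A *v x = Y *v z" by blast
    have "Y ** R *v x = Y ** transpose Y *v (A *v x)" by (simp add: R_def matrix_vector_mul_assoc matrix_mul_assoc)
    also have "\<dots> = Y *v z" unfolding z by (simp only: matrix_vector_mul_assoc matrix_mul_assoc[symmetric] YY matrix_mul_rid)
    finally show ?thesis using z by simp
  qed
  then have A: "A = Y ** R" by (simp add: matrix_eq)
  \<comment> \<open>The entry is the inner product of \<open>y i\<close> with column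
    \<open>j\<close>, which lies in the span of the \<open>y l\<close> with
    \<open>l \<le> j\<close>; all of these are orthogonal to \<open>y i\<close>.\<close>
  have "R $ i $ j = 0" if "j < i" for i j
  proof -
    have "y i \<bullet> x = 0" if "x \<in> span (y ` {l. l \<le> j})" for x
      using that by (induction rule: span_induct)
        (use y(1) \<open>j < i\<close> in \<open>auto simp: subspace_def inner_add_right\<close>)
    from this[OF y(2)] have "y i \<bullet> column j A = 0" .
    then show ?thesis
      by (simp add: R_def matrix_matrix_mult_def transpose_def Y_def inner_vec_def column_def)
  qed
  then show ?thesis using A Y by (auto simp: qr_factorization_def)
qed

text \<open>Justifies the definite description: some representative has a QR factorization, and
  every factorization of every representative gives the same reflection.\<close>

lemma phi4_gl_class:
  fixes A :: "real^'k::{finite,linorder}^'n"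
  assumes "A \<in> full_rank_matrices"
  shows "phi4 (gl_class A) = column_reflection A"
  unfolding phi4_def
proof (rule the_equality)
  obtain Y R where "qr_factorization A Y R" using qr_factorization_exists[OF assms] by blast
  then show "\<exists>B\<in>gl_class A. \<exists>Y R. qr_factorization B Y R \<and> column_reflection A = 2 *\<^sub>R (Y ** transpose Y) - mat 1"
    using gl_class_self qr_column_reflection[OF assms] by blast
next
  fix Q assume "\<exists>B\<in>gl_class A. \<exists>Y R. qr_factorization B Y R \<and> Q = 2 *\<^sub>R (Y ** transpose Y) - mat 1"
  then obtain B Y R where B: "B \<in> gl_class A" "qr_factorization B Y R" "Q = 2 *\<^sub>R (Y ** transpose Y) - mat 1"
    by blast
  have "Q = column_reflection B" using qr_column_reflection[OF gl_class_full_rank[OF assms B(1)] B(2)] B(3) by simp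
  also have "\<dots> = column_reflection A"
    using B(1) column_reflection_mult_right[OF assms] by (auto simp: gl_class_def)
  finally show "Q = column_reflection A" .
qed

text \<open>The column space of \<open>Y\<close> is mapped by \<open>E ** transpose Y\<close>, and
  its orthogonal complement by an isometry onto the complement of the column space of
  \<open>E\<close>; the complements have equal dimension. This moves any subspace of the right
  dimension to the reference one.\<close>

lemma orthonormal_frames_conjugate:
  fixes Y E :: "real^'k^'n"
  assumes "orthonormal_columns Y" "orthonormal_columns E"
  obtains P where "invertible P" "P ** Y = E"
proof -
  let ?S = "\<lambda>Z :: real^'k^'n. {x. transpose Z *v x = 0}"
  have dim: "dim (?S Z) + CARD('k) = CARD('n)" if "orthonormal_columns Z" for Z
  proof -
    have S: "?S Z = {y \<in> UNIV. \<forall>x\<in>range ((*v) Z). orthogonal x y}"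
      by (auto simp: orthogonal_def inner_matrix_vector_transpose simp del: transpose_matrix_vector)
         (metis inner_eq_zero_iff)
    have "dim {y \<in> UNIV. \<forall>x\<in>range ((*v) Z). orthogonal x y} + dim (range ((*v) Z)) = dim (UNIV :: (real^'n) set)"
      by (rule dim_subspace_orthogonal_to_vectors) (auto simp: linear_subspace_image)
    moreover have "dim (range ((*v) Z)) = CARD('k)"
      using orthonormal_full_rank[OF that] by (simp add: full_rank_matrices_def rank_dim_range)
    ultimately show ?thesis unfolding S by simp
  qed
  have sub: "subspace (?S Z)" for Z :: "real^'k^'n"
    by (auto simp: subspace_def matrix_vector_right_distrib matrix_vector_mult_scaleR simp del: transpose_matrix_vector)
  have "dim (?S Y) = dim (?S E)" using dim assms by (metis add_right_cancel)
  from isometries_subspaces[OF sub sub this]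
  obtain f g where f: "linear f" "f ` ?S Y = ?S E" "\<And>x. x \<in> ?S Y \<Longrightarrow> g (f x) = x" by metis
  have YY: "transpose Y ** Y = mat 1" and EE: "transpose E ** E = mat 1"
    using assms orthonormal_columns_iff by auto
  \<comment> \<open>The component of \<open>x\<close> orthogonal to the columns of
    \<open>Y\<close>.\<close>
  define r where "r x = x - Y *v (transpose Y *v x)" for x
  define h where "h x = E *v (transpose Y *v x) + f (r x)" for x
  have linr: "linear r"
    unfolding r_def by (intro linear_compose_sub linear_ident)
      (simp only: matrix_vector_mul_assoc matrix_vector_mul_linear)
  have "linear (\<lambda>x. f (r x))" using linear_compose[OF linr f(1)] by (simp add: o_def)
  then have linh: "linear h"
    unfolding h_def by (intro linear_compose_add) (simp_all only: matrix_vector_mul_assoc matrix_vector_mul_linear)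
  have cancel: "transpose Z *v (Z *v x) = x" if "transpose Z ** Z = mat 1" for Z :: "real^'k^'n" and x
    by (simp add: matrix_vector_mul_assoc that del: transpose_matrix_vector)
  have rS: "r x \<in> ?S Y" for x
    by (simp add: r_def matrix_vector_mult_diff_distrib cancel[OF YY] del: transpose_matrix_vector)
  have fS: "transpose E *v f (r x) = 0" for x using f(2) rS[of x] by blast
  have "inj h"
  proof (rule injI)
    fix x z assume e: "h x = h z"
    have Eh: "transpose E *v h x = transpose Y *v x" for x
      by (simp add: h_def matrix_vector_right_distrib cancel[OF EE] fS del: transpose_matrix_vector)
    then have 1: "transpose Y *v x = transpose Y *v z" using e by metis
    then have "f (r x) = f (r z)" using e by (simp add: h_def del: transpose_matrix_vector)
    then have "r x = r z" using f(3)[OF rS] by metis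
    then show "x = z" using 1 by (simp add: r_def del: transpose_matrix_vector)
  qed
  moreover have mh: "(*v) (matrix h) = h" by (rule matrix_vector_mul(2)[OF linh])
  ultimately have "invertible (matrix h)"
    by (metis invertible_left_inverse matrix_left_invertible_injective)
  moreover have "matrix h ** Y = E"
  proof -
    have "h (Y *v x) = E *v x" for x
      using linear_0[OF f(1)] by (simp add: h_def r_def cancel[OF YY] del: transpose_matrix_vector)
    then show ?thesis by (simp add: matrix_eq matrix_vector_mul_assoc[symmetric] mh)
  qed
  ultimately show ?thesis using that by blast
qed

text \<open>The bound on k enters here: distinct standard basis vectors are taken as
  columns.\<close>

lemma orthonormal_columns_exist:
  assumes "CARD('k::finite) \<le> CARD('n::finite)"
  obtains E :: "real^'k^'n" where "orthonormal_columns E"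
proof -
  obtain f :: "'k \<Rightarrow> 'n" where f: "inj f"
    using card_le_inj[of "UNIV :: 'k set" "UNIV :: 'n set"] assms by auto
  let ?E = "(\<chi> i j. if i = f j then 1 else 0) :: real^'k^'n"
  have "column j ?E = axis (f j) 1" for j by (simp add: column_def axis_def)
  then have "orthonormal_columns ?E"
    using f by (simp add: orthonormal_columns_def inner_axis_axis inj_eq)
  then show ?thesis using that by blast
qed

section \<open>Charts of the two models and of the orthogonal group\<close>

text \<open>Moves the model into another Euclidean space, since the structure on the involutions has
  its model among the n by n matrices while the graph charts use n by k matrices.\<close>

lemma param_atlas_linear_image:
  fixes j :: "'e::euclidean_space \<Rightarrow> 'f::euclidean_space"
  assumes "param_atlas G h V I D c p" "linear j" "linear l" and lj: "\<And>v. v \<in> V \<Longrightarrow> l (j v) = v"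
  shows "param_atlas G h (j ` V) I D (\<lambda>i x. j (c i x)) (\<lambda>i v. p i (l v))"
proof -
  interpret A: param_atlas G h V I D c p by fact
  show ?thesis
  proof
    fix i assume i: "i \<in> I"
    show "smooth_on (D i) (\<lambda>x. j (c i x))" by (rule smooth_on_linear_compose[OF assms(2) A.c[OF i]])
    show "smooth_on (j ` V) (\<lambda>v. p i (l v))"
      by (rule smooth_on_compose[OF smooth_on_linear[OF assms(3)] A.p[OF i]]) (auto simp: lj)
  qed (use A.inj A.V A.D A.cover A.cV A.pD A.cp A.pc lj linear_subspace_image[OF assms(2)] in auto)
qed

lemma param_atlas_transfer:
  assumes "param_atlas S id V I D c p" "inj_on h G" "h ` G = S"
  shows "param_atlas G h V I D c p"
  using assms unfolding param_atlas_def by simp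

text \<open>Linear maps from the column space of \<open>E\<close> to its orthogonal complement, a
  space of dimension k(n - k); the column space of \<open>E + H\<close> is the graph of such a
  map.\<close>

definition graph_model :: "real^'k^'n \<Rightarrow> (real^'k^'n) set" where
  "graph_model E = {H. transpose E ** H = 0}"

definition midprojection :: "real^'n^'n \<Rightarrow> real^'n^'n" where
  "midprojection Q = (1/2) *\<^sub>R (mat 1 + Q)"

text \<open>For a reflection \<open>Q\<close> along a k-dimensional subspace W this is invertible
  exactly when \<open>P\<close> maps W to a graph over the column space of \<open>E\<close>, that
  is, when W lies in the chart domain.\<close>

definition graph_gram :: "real^'k^'n \<Rightarrow> real^'n^'n \<Rightarrow> real^'n^'n \<Rightarrow> real^'k^'k" where
  "graph_gram E P Q = transpose E ** P ** midprojection Q ** transpose P ** E"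

definition graph_chart :: "real^'k^'n \<Rightarrow> real^'n^'n \<Rightarrow> real^'n^'n \<Rightarrow> real^'k^'n" where
  "graph_chart E P Q = P ** midprojection Q ** transpose P ** E ** matrix_inv (graph_gram E P Q) - E"

definition graph_frame :: "real^'k^'n \<Rightarrow> real^'n^'n \<Rightarrow> real^'k^'n \<Rightarrow> real^'k^'n" where
  "graph_frame E P H = matrix_inv P ** (E + H)"

lemma midprojection_column_reflection: "midprojection (column_reflection A) = column_projection A"
  by (simp add: midprojection_def column_reflection_def)

lemma subspace_graph_model: "subspace (graph_model E)"
  by (auto simp: subspace_def graph_model_def matmul.add_right matmul.scaleR_right matmul.zero_right)

lemma smooth_on_graph_gram: "smooth_on S (graph_gram E P)"
  unfolding graph_gram_def midprojection_def
  by (intro smooth_on_matrix_mult smooth_on_scaleR smooth_on_add smooth_on_const smooth_on_ident)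

context
  fixes E :: "real^'k^'n" and P :: "real^'n^'n"
  assumes E: "orthonormal_columns E" and P: "invertible P"
begin

lemma open_graph_domain: "open {Q. invertible (graph_gram E P Q)}"
  using open_vimage[OF open_invertible smooth_on_imp_continuous_on[OF smooth_on_graph_gram]]
  by (simp add: vimage_def)

lemma smooth_on_graph_chart: "smooth_on {Q. invertible (graph_gram E P Q)} (graph_chart E P)"
proof -
  have "smooth_on {Q. invertible (graph_gram E P Q)}
    (\<lambda>Q. P ** ((1/2) *\<^sub>R (mat 1 + Q)) ** transpose P ** E ** matrix_inv (graph_gram E P Q) + - E)"
    by (intro smooth_on_add smooth_on_matrix_mult smooth_on_scaleR smooth_on_const smooth_on_ident
        smooth_on_matrix_inv_compose smooth_on_graph_gram) simp
  then show ?thesis by (rule smooth_on_cong) (simp add: graph_chart_def midprojection_def)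
qed

lemma smooth_on_graph_frame: "smooth_on S (graph_frame E P)"
  unfolding graph_frame_def by (intro smooth_on_matrix_mult smooth_on_add smooth_on_const smooth_on_ident)

lemma graph_frame_normalized:
  assumes "H \<in> graph_model E"
  shows "transpose E ** P ** graph_frame E P H = mat 1" "graph_frame E P H \<in> full_rank_matrices"
proof -
  have "transpose E ** P ** graph_frame E P H = transpose E ** (P ** matrix_inv P) ** (E + H)"
    by (simp add: graph_frame_def matrix_mul_assoc)
  also have "\<dots> = transpose E ** E + transpose E ** H"
    by (simp add: matrix_inv_works(1)[OF P] matmul.add_right)
  finally show 1: "transpose E ** P ** graph_frame E P H = mat 1"
    using assms E by (simp add: graph_model_def orthonormal_columns_iff)
  show "graph_frame E P H \<in> full_rank_matrices" by (rule full_rank_left_inverse[OF 1])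
qed

text \<open>The frame \<open>A\<close> is normalized by
  \<open>transpose E ** P ** A = mat 1\<close>. This collapses \<open>graph_gram\<close> to the
  inverse Gram matrix of \<open>A\<close>, and the chart formula to
  \<open>P ** A - E = H\<close>.\<close>

lemma graph_chart_frame:
  assumes H: "H \<in> graph_model E"
  shows "invertible (graph_gram E P (column_reflection (graph_frame E P H)))"
    and "graph_chart E P (column_reflection (graph_frame E P H)) = H"
proof -
  define A where "A = graph_frame E P H"
  let ?G = "transpose A ** A"
  have EA: "transpose E ** P ** A = mat 1" and A: "A \<in> full_rank_matrices"
    using graph_frame_normalized[OF H] by (simp_all add: A_def)
  have G: "invertible ?G" using A full_rank_iff_gram by blast
  have AE: "transpose A ** transpose P ** E = mat 1"
    using arg_cong[OF EA, of transpose] by (simp add: matrix_transpose_mul matrix_mul_assoc)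
  have mp: "midprojection (column_reflection A) = A ** matrix_inv ?G ** transpose A"
    by (simp add: midprojection_column_reflection column_projection_def matrix_mul_assoc)
  have "graph_gram E P (column_reflection A) =
      (transpose E ** P ** A) ** matrix_inv ?G ** (transpose A ** transpose P ** E)"
    by (simp add: graph_gram_def mp matrix_mul_assoc)
  then have gram: "graph_gram E P (column_reflection A) = matrix_inv ?G" by (simp add: EA AE)
  then show "invertible (graph_gram E P (column_reflection (graph_frame E P H)))"
    using invertible_matrix_inv[OF G] by (simp add: A_def)
  have "graph_chart E P (column_reflection A) =
      P ** A ** matrix_inv ?G ** (transpose A ** transpose P ** E) ** matrix_inv (matrix_inv ?G) - E"
    by (simp add: graph_chart_def gram mp matrix_mul_assoc)
  also have "\<dots> = P ** A ** (matrix_inv ?G ** matrix_inv (matrix_inv ?G)) - E"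
    by (simp add: AE) (simp add: matrix_mul_assoc)
  also have "\<dots> = P ** A - E" using matrix_inv_works(1)[OF invertible_matrix_inv[OF G]] by simp
  also have "\<dots> = H" by (simp add: A_def graph_frame_def matrix_mul_assoc matrix_inv_works(1)[OF P])
  finally show "graph_chart E P (column_reflection (graph_frame E P H)) = H" by (simp add: A_def)
qed

lemma graph_frame_chart:
  assumes Z: "(Z :: real^'k^'n) \<in> full_rank_matrices" and inv: "invertible (graph_gram E P (column_reflection Z))"
  shows "graph_chart E P (column_reflection Z) \<in> graph_model E"
    and "column_reflection (graph_frame E P (graph_chart E P (column_reflection Z))) = column_reflection Z"
proof -
  let ?Q = "column_reflection Z" and ?g = "graph_gram E P (column_reflection Z)"
  \<comment> \<open>The right factor that turns \<open>Z\<close> into the normalized representative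
    of its class.\<close>
  define X where "X = (matrix_inv (transpose Z ** Z) ** transpose Z) ** transpose P ** E ** matrix_inv ?g"
  have PZX: "graph_chart E P ?Q = P ** (Z ** X) - E"
    by (simp add: graph_chart_def midprojection_column_reflection column_projection_def X_def matrix_mul_assoc)
  have "transpose E ** P ** (Z ** X) = ?g ** matrix_inv ?g"
    by (simp add: graph_gram_def midprojection_column_reflection column_projection_def X_def matrix_mul_assoc)
  then have EPZX: "transpose E ** P ** (Z ** X) = mat 1" using matrix_inv_works(1)[OF inv] by simp
  then show "graph_chart E P ?Q \<in> graph_model E"
    using E by (simp add: graph_model_def PZX matmul.diff_right orthonormal_columns_iff matrix_mul_assoc)
  have "invertible X" using full_rank_left_inverse[OF EPZX] full_rank_mult_iff[OF Z] by simp
  moreover have "graph_frame E P (graph_chart E P ?Q) = Z ** X"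
  proof -
    have "graph_frame E P (graph_chart E P ?Q) = (matrix_inv P ** P) ** (Z ** X)"
      by (simp add: graph_frame_def PZX matrix_mul_assoc)
    then show ?thesis by (simp add: matrix_inv_works(2)[OF P])
  qed
  ultimately show "column_reflection (graph_frame E P (graph_chart E P ?Q)) = ?Q"
    using column_reflection_mult_right[OF Z] by simp
qed

end

lemma graph_param_atlas:
  fixes E :: "real^'k^'n"
  assumes E: "orthonormal_columns E"
  shows "param_atlas (involution_model CARD('k)) id (graph_model E) {P. invertible P}
    (\<lambda>P. {Q. invertible (graph_gram E P Q)}) (graph_chart E)
    (\<lambda>P H. column_reflection (graph_frame E P H))"
proof
  show "id ` involution_model CARD('k) \<subseteq> (\<Union>P\<in>{P. invertible P}. {Q. invertible (graph_gram E P Q)})"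
  proof
    fix Q :: "real^'n^'n" assume "Q \<in> id ` involution_model CARD('k)"
    then obtain Y :: "real^'k^'n" where Y: "orthonormal_columns Y" "Q = 2 *\<^sub>R (Y ** transpose Y) - mat 1"
      using involution_model_decomposition[of Q] by auto
    then have Q: "Q = column_reflection Y" using column_reflection_orthonormal[OF Y(1)] by simp
    \<comment> \<open>With \<open>P ** Y = E\<close> the matrix \<open>graph_gram E P Q\<close> is
      the identity, so every \<open>Q\<close> lies in some chart domain.\<close>
    obtain P where P: "invertible P" "P ** Y = E" using orthonormal_frames_conjugate[OF Y(1) E] .
    have "transpose Y ** transpose P = transpose E" using P(2) matrix_transpose_mul by metis
    then have "graph_gram E P Q = (transpose E ** (P ** Y)) ** (transpose Y ** transpose P ** E)"
      by (simp add: graph_gram_def Q midprojection_column_reflection column_projection_orthonormal[OF Y(1)]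
          matrix_mul_assoc[symmetric])
    also have "\<dots> = mat 1"
      using E \<open>transpose Y ** transpose P = transpose E\<close> by (simp add: P(2) orthonormal_columns_iff)
    finally have "invertible (graph_gram E P Q)" by (simp add: invertible_def exI[of _ "mat 1"])
    then show "Q \<in> (\<Union>P\<in>{P. invertible P}. {Q. invertible (graph_gram E P Q)})" using P(1) by blast
  qed
  fix P :: "real^'n^'n" assume "P \<in> {P. invertible P}"
  then have P: "invertible P" by simp
  show "open {Q. invertible (graph_gram E P Q)}" by (rule open_graph_domain[OF E P])
  show "smooth_on {Q. invertible (graph_gram E P Q)} (graph_chart E P)" by (rule smooth_on_graph_chart[OF E P])
  show "smooth_on (graph_model E) (\<lambda>H. column_reflection (graph_frame E P H))"
    by (rule smooth_on_compose[OF smooth_on_graph_frame[OF E P] smooth_on_column_reflection])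
      (use graph_frame_normalized(2)[OF E P] in blast)
  fix H assume H: "H \<in> graph_model E"
  show "graph_chart E P (column_reflection (graph_frame E P H)) = H" by (rule graph_chart_frame(2)[OF E P H])
  show "column_reflection (graph_frame E P H) \<in> id ` involution_model CARD('k) \<inter> {Q. invertible (graph_gram E P Q)}"
    using graph_chart_frame(1)[OF E P H] column_reflection_involution[OF graph_frame_normalized(2)[OF E P H]] by simp
next
  fix P Q :: "real^'n^'n"
  assume "P \<in> {P. invertible P}" and Q: "Q \<in> id ` involution_model CARD('k) \<inter> {Q. invertible (graph_gram E P Q)}"
  then have P: "invertible P" by simp
  have "Q \<in> (column_reflection :: real^'k^'n \<Rightarrow> _) ` full_rank_matrices" using Q image_column_reflection by auto
  then obtain Z :: "real^'k^'n" where Z: "Z \<in> full_rank_matrices" "Q = column_reflection Z" by blast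
  have "invertible (graph_gram E P (column_reflection Z))" using Q Z by simp
  from graph_frame_chart[OF E P Z(1) this]
  show "graph_chart E P Q \<in> graph_model E" "column_reflection (graph_frame E P (graph_chart E P Q)) = Q"
    using Z(2) by auto
qed (auto simp: subspace_graph_model)

section \<open>The Cayley transform and charts of the orthogonal group\<close>

definition cayley :: "real^'n^'n \<Rightarrow> real^'n^'n" where
  "cayley M = (mat 1 - M) ** matrix_inv (mat 1 + M)"

text \<open>With \<open>N\<close> the inverse of \<open>mat 1 + M\<close>, the matrices
  \<open>mat 1 + cayley M\<close> and \<open>mat 1 - cayley M\<close> are twice \<open>N\<close> and
  twice \<open>M ** N\<close>; their quotient is \<open>M\<close>.\<close>

lemma cayley_involutive:
  assumes "invertible (mat 1 + M)"
  shows "invertible (mat 1 + cayley M)" "cayley (cayley M) = M"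
proof -
  let ?N = "matrix_inv (mat 1 + M)"
  have N: "(mat 1 + M) ** ?N = mat 1" "?N ** (mat 1 + M) = mat 1"
    using matrix_inv_works[OF assms] by auto
  have p: "mat 1 + cayley M = 2 *\<^sub>R ?N"
  proof -
    have "mat 1 + cayley M = ((mat 1 + M) + (mat 1 - M)) ** ?N"
      by (simp only: matmul.add_left[of "mat 1 + M"] N cayley_def)
    also have "(mat 1 + M) + (mat 1 - M) = 2 *\<^sub>R mat 1" by (simp add: scaleR_2)
    finally show ?thesis by (simp add: matmul.scaleR_left)
  qed
  have m: "mat 1 - cayley M = 2 *\<^sub>R (M ** ?N)"
  proof -
    have "mat 1 - cayley M = ((mat 1 + M) - (mat 1 - M)) ** ?N"
      by (simp only: matmul.diff_left[of "mat 1 + M"] N cayley_def)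
    also have "(mat 1 + M) - (mat 1 - M) = 2 *\<^sub>R M" by (simp add: scaleR_2)
    finally show ?thesis by (simp add: matmul.scaleR_left)
  qed
  have inv: "(mat 1 + cayley M) ** ((1/2) *\<^sub>R (mat 1 + M)) = mat 1"
    unfolding p by (simp add: matmul.scaleR_left matmul.scaleR_right N del: matmul.add_right)
  then show "invertible (mat 1 + cayley M)" using invertible_right_inverse by blast
  have "cayley (cayley M) = (2 *\<^sub>R (M ** ?N)) ** ((1/2) *\<^sub>R (mat 1 + M))"
    unfolding cayley_def[of "cayley M"] m matrix_inv_eqI[OF inv] ..
  also have "\<dots> = M ** (?N ** (mat 1 + M))"
    by (simp add: matmul.scaleR_left matmul.scaleR_right matrix_mul_assoc)
  finally show "cayley (cayley M) = M" by (simp add: N)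
qed

text \<open>For skew \<open>M\<close> the product of \<open>x\<close> with \<open>M *v x\<close> is
  0, so a kernel vector of \<open>mat 1 + M\<close> has norm 0. Orthogonality follows because
  \<open>mat 1 + M\<close> and \<open>mat 1 - M\<close> commute.\<close>

lemma cayley_skew:
  assumes "transpose M = - M"
  shows "invertible (mat 1 + M)" "orthogonal_matrix (cayley M)"
proof -
  have "x = 0" if "(mat 1 + M) *v x = 0" for x
  proof -
    have "x + M *v x = 0" using that by (simp add: matrix_vector_mult_add_rdistrib)
    then have "x \<bullet> x + x \<bullet> (M *v x) = 0" by (metis inner_add_right inner_zero_right)
    moreover have "x \<bullet> (M *v x) = - (x \<bullet> (M *v x))"
    proof -
      have "(M *v x) \<bullet> x = x \<bullet> ((- M) *v x)" unfolding inner_matrix_vector_transpose assms ..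
      also have "\<dots> = - (x \<bullet> (M *v x))"
        using matrix_vector_mult_diff_rdistrib[of 0 M x] by simp
      finally show ?thesis by (simp add: inner_commute)
    qed
    ultimately show "x = 0" by simp
  qed
  then show inv: "invertible (mat 1 + M)" using matrix_left_invertible_ker invertible_left_inverse by blast
  let ?N = "matrix_inv (mat 1 + M)"
  have N: "(mat 1 + M) ** ?N = mat 1" using matrix_inv_works(1)[OF inv] .
  have t: "transpose (mat 1 + M) = mat 1 - M" "transpose (mat 1 - M) = mat 1 + M"
    by (simp_all add: transpose_add transpose_diff assms)
  have N': "transpose ?N ** (mat 1 - M) = mat 1"
    using arg_cong[OF N, of transpose] unfolding matrix_transpose_mul t by simp
  have comm: "(mat 1 + M) ** (mat 1 - M) = (mat 1 - M) ** (mat 1 + M)"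
    by (simp add: matmul.add_left matmul.add_right matmul.diff_left matmul.diff_right)
  have "transpose (cayley M) ** cayley M = transpose ?N ** ((mat 1 + M) ** (mat 1 - M)) ** ?N"
    by (simp add: cayley_def matrix_transpose_mul t matrix_mul_assoc)
  also have "\<dots> = (transpose ?N ** (mat 1 - M)) ** ((mat 1 + M) ** ?N)"
    unfolding comm by (simp only: matrix_mul_assoc)
  finally show "orthogonal_matrix (cayley M)" using N N' by (simp add: orthogonal_matrix)
qed

lemma cayley_orthogonal:
  assumes "orthogonal_matrix M" "invertible (mat 1 + M)"
  shows "transpose (cayley M) = - cayley M"
proof -
  let ?N = "matrix_inv (mat 1 + M)"
  have N: "(mat 1 + M) ** ?N = mat 1" using matrix_inv_works(1)[OF assms(2)] .
  have t: "transpose (mat 1 + M) = mat 1 + transpose M" "transpose (mat 1 - M) = mat 1 - transpose M"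
    by (simp_all add: transpose_add transpose_diff)
  have N': "transpose ?N ** (mat 1 + transpose M) = mat 1"
    using arg_cong[OF N, of transpose] unfolding matrix_transpose_mul t by simp
  \<comment> \<open>Because \<open>M\<close> is orthogonal, the left product reduces to
    \<open>M - transpose M\<close> and the right one, before negation, to its negative.\<close>
  have e: "(mat 1 - transpose M) ** (mat 1 + M) = - ((mat 1 + transpose M) ** (mat 1 - M))"
    using assms(1) by (simp add: matmul.add_left matmul.add_right matmul.diff_left matmul.diff_right orthogonal_matrix)
  have "transpose (cayley M) = transpose ?N ** (mat 1 - transpose M) ** ((mat 1 + M) ** ?N)"
    by (simp add: cayley_def matrix_transpose_mul t N)
  also have "\<dots> = transpose ?N ** ((mat 1 - transpose M) ** (mat 1 + M)) ** ?N"
    by (simp only: matrix_mul_assoc)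
  also have "\<dots> = - ((transpose ?N ** (mat 1 + transpose M)) ** (mat 1 - M) ** ?N)"
    unfolding e by (simp add: matmul.minus_left matmul.minus_right matrix_mul_assoc)
  finally show ?thesis by (simp add: N' cayley_def)
qed

lemma smooth_on_cayley: "smooth_on {M. invertible (mat 1 + M)} cayley"
proof -
  have "smooth_on {M :: real^'n^'n. invertible (mat 1 + M)} (\<lambda>M. (mat 1 + (-1) *\<^sub>R M) ** matrix_inv (mat 1 + M))"
    by (intro smooth_on_matrix_mult smooth_on_matrix_inv_compose smooth_on_add smooth_on_scaleR
        smooth_on_const smooth_on_ident) simp
  then show ?thesis by (rule smooth_on_cong) (simp add: cayley_def)
qed

lemma cayley_param_atlas:
  "param_atlas (orthogonal_group :: (real^'n^'n) set) id {S. transpose S = - S} {U. orthogonal_matrix U}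
    (\<lambda>U. {Q. invertible (mat 1 + transpose U ** Q)}) (\<lambda>U Q. cayley (transpose U ** Q)) (\<lambda>U S. U ** cayley S)"
proof
  show "subspace {S :: real^'n^'n. transpose S = - S}"
    by (auto simp: subspace_def transpose_add transpose_scalar linear_0[OF linear_transpose])
  show "id ` orthogonal_group \<subseteq> (\<Union>U\<in>{U. orthogonal_matrix U}. {Q :: real^'n^'n. invertible (mat 1 + transpose U ** Q)})"
  proof
    fix Q :: "real^'n^'n" assume "Q \<in> id ` orthogonal_group"
    then have Q: "orthogonal_matrix Q" by (simp add: orthogonal_group_def)
    \<comment> \<open>The translate by \<open>U = Q\<close> contains \<open>Q\<close>, since there
      the matrix to be inverted is twice the identity.\<close>
    then have "(mat 1 + transpose Q ** Q) ** ((1/2) *\<^sub>R mat 1) = mat 1"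
      by (simp add: orthogonal_matrix scaleR_2[symmetric] matmul.scaleR_right matmul.add_left)
    then have "invertible (mat 1 + transpose Q ** Q)" using invertible_right_inverse by blast
    then show "Q \<in> (\<Union>U\<in>{U. orthogonal_matrix U}. {Q. invertible (mat 1 + transpose U ** Q)})" using Q by blast
  qed
  fix U :: "real^'n^'n" assume "U \<in> {U. orthogonal_matrix U}"
  then have U: "orthogonal_matrix U" "transpose U ** U = mat 1" "U ** transpose U = mat 1"
    by (auto simp: orthogonal_matrix_def)
  have sm: "smooth_on T (\<lambda>Q. transpose U ** Q)" for T
    by (intro smooth_on_matrix_mult smooth_on_const smooth_on_ident)
  have "smooth_on UNIV (\<lambda>Q. mat 1 + transpose U ** Q)" by (intro smooth_on_add smooth_on_const sm)
  from open_vimage[OF open_invertible smooth_on_imp_continuous_on[OF this]]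
  show "open {Q. invertible (mat 1 + transpose U ** Q)}" by (simp add: vimage_def)
  show "smooth_on {Q. invertible (mat 1 + transpose U ** Q)} (\<lambda>Q. cayley (transpose U ** Q))"
    by (rule smooth_on_compose[OF sm smooth_on_cayley]) auto
  show "smooth_on {S. transpose S = - S} (\<lambda>S. U ** cayley S)"
    by (intro smooth_on_matrix_mult smooth_on_const smooth_on_subset[OF smooth_on_cayley]) (use cayley_skew in auto)
  have UU: "transpose U ** (U ** M) = M" "U ** (transpose U ** M) = M" for M by (simp_all add: matrix_mul_assoc U)
  {
    fix Q assume Q: "Q \<in> id ` orthogonal_group \<inter> {Q. invertible (mat 1 + transpose U ** Q)}"
    then have UQ: "orthogonal_matrix (transpose U ** Q)" "invertible (mat 1 + transpose U ** Q)"
      using U(1) by (auto simp: orthogonal_group_def intro: orthogonal_matrix_mul)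
    show "cayley (transpose U ** Q) \<in> {S. transpose S = - S}" using cayley_orthogonal[OF UQ] by simp
    show "U ** cayley (cayley (transpose U ** Q)) = Q" by (simp add: cayley_involutive(2)[OF UQ(2)] UU)
  }
  {
    fix S :: "real^'n^'n" assume "S \<in> {S. transpose S = - S}"
    then have S: "transpose S = - S" by simp
    show "U ** cayley S \<in> id ` orthogonal_group \<inter> {Q. invertible (mat 1 + transpose U ** Q)}"
      using cayley_skew[OF S] cayley_involutive(1)[OF cayley_skew(1)[OF S]] U(1)
      by (simp add: UU orthogonal_group_def orthogonal_matrix_mul)
    show "cayley (transpose U ** (U ** cayley S)) = S"
      by (simp add: UU cayley_involutive(2)[OF cayley_skew(1)[OF S]])
  }
qed simp

section \<open>The diffeomorphism\<close>

lemma phi4_image: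
  "phi4 ` gl_class ` (full_rank_matrices :: (real^'k::{finite,linorder}^'n) set) = involution_model CARD('k)"
  unfolding image_column_reflection[symmetric, where 'k = 'k] by (auto simp: image_image phi4_gl_class)

lemma phi4_inj_on: "inj_on phi4 (gl_class ` (full_rank_matrices :: (real^'k::{finite,linorder}^'n) set))"
  by (auto simp: inj_on_def phi4_gl_class gl_class_eq_iff)

lemma column_reflection_sections:
  assumes "Q \<in> involution_model CARD('k::finite)"
  shows "\<exists>T (s :: real^'n^'n \<Rightarrow> real^'k^'n). open T \<and> Q \<in> T \<and> smooth_on T s \<and> s ` T \<subseteq> full_rank_matrices \<and>
    (\<forall>P\<in>involution_model CARD('k) \<inter> T. column_reflection (s P) = P)"
  using column_reflection_local_section[OF assms] by metis

text \<open>The chart inverse already has the smooth lift \<open>graph_frame E P\<close>.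
  Multiplying it by the constant invertible \<open>X\<close> that relates its value to the given
  \<open>A\<close> makes it pass through \<open>A\<close> and leaves the classes unchanged.\<close>

lemma grassmannian_quotient_manifold:
  assumes "CARD('k::{finite,linorder}) \<le> CARD('n::finite)"
  shows "\<exists>Gr :: (('n, 'k) rmat set, ('n, 'k) rmat) manifold.
    quotient_manifold (open_manifold full_rank_matrices) gl_class Gr"
proof -
  obtain E :: "('n, 'k) rmat" where E: "orthonormal_columns E" using orthonormal_columns_exist[OF assms] .
  let ?I = "{P :: real^'n^'n. invertible P}" and ?D = "\<lambda>P. {Q. invertible (graph_gram E P Q)}"
    and ?p = "\<lambda>P H. column_reflection (graph_frame E P H)"
  have atlas: "param_atlas (gl_class ` (full_rank_matrices :: ('n, 'k) rmat set)) phi4 (graph_model E) ?I ?D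
      (graph_chart E) ?p"
    by (rule param_atlas_transfer[OF graph_param_atlas[OF E] phi4_inj_on phi4_image])
  have "quotient_manifold (open_manifold full_rank_matrices) gl_class
      (param_manifold (gl_class ` (full_rank_matrices :: ('n, 'k) rmat set)) phi4 (graph_model E) ?I ?D (graph_chart E))"
  proof (rule param_atlas_quotient_manifold[OF atlas open_full_rank smooth_on_column_reflection phi4_gl_class])
    fix P :: "real^'n^'n" and A :: "('n, 'k) rmat"
    assume "P \<in> ?I" and A: "A \<in> full_rank_matrices" and "column_reflection A \<in> ?D P"
    then have P: "invertible P" and gram: "invertible (graph_gram E P (column_reflection A))" by auto
    let ?H = "graph_chart E P (column_reflection A)"
    note H = graph_frame_chart[OF E P A gram]
    obtain X where X: "invertible X" "A = graph_frame E P ?H ** X"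
      using column_reflection_eqD[OF A graph_frame_normalized(2)[OF E P H(1)] H(2)[symmetric]] .
    let ?l = "\<lambda>H. graph_frame E P H ** X"
    have "smooth_on (graph_model E) ?l"
      by (intro smooth_on_matrix_mult smooth_on_graph_frame[OF E P] smooth_on_const)
    moreover have "?l K \<in> full_rank_matrices \<and> column_reflection (?l K) = ?p P K" if K: "K \<in> graph_model E" for K
      using full_rank_mult_iff[OF graph_frame_normalized(2)[OF E P K]]
        column_reflection_mult_right[OF graph_frame_normalized(2)[OF E P K] X(1)] X(1) by simp
    ultimately show "\<exists>l. smooth_on (graph_model E) l \<and> l ` graph_model E \<subseteq> full_rank_matrices \<and>
        l ?H = A \<and> (\<forall>v\<in>graph_model E. column_reflection (l v) = ?p P v)"
      using X(2) by (intro exI[of _ ?l]) auto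
  next
    fix Q assume "Q \<in> (column_reflection :: ('n, 'k) rmat \<Rightarrow> _) ` full_rank_matrices"
    then show "\<exists>T (s :: _ \<Rightarrow> ('n, 'k) rmat). open T \<and> Q \<in> T \<and> smooth_on T s \<and> s ` T \<subseteq> full_rank_matrices \<and>
        (\<forall>P\<in>(column_reflection :: ('n, 'k) rmat \<Rightarrow> _) ` full_rank_matrices \<inter> T. column_reflection (s P) = P)"
      unfolding image_column_reflection by (rule column_reflection_sections)
  qed
  then show ?thesis by blast
qed

lemma involution_embedded_submanifold:
  assumes "CARD('k::finite) \<le> CARD('n::finite)"
  shows "\<exists>(On :: (('n, 'n) rmat, ('n, 'n) rmat) manifold) (Inv :: (('n, 'n) rmat, ('n, 'n) rmat) manifold).
    embedded_submanifold (open_manifold UNIV) orthogonal_group On \<and>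
    embedded_submanifold On (involution_model CARD('k)) Inv"
proof -
  obtain E :: "real^'k^'n" where E: "orthonormal_columns E" using orthonormal_columns_exist[OF assms] .
  have lin: "linear (\<lambda>H :: real^'k^'n. H ** transpose E)" "linear (\<lambda>K :: real^'n^'n. K ** E)"
    using matmul.bounded_linear_left bounded_linear.linear by blast+
  \<comment> \<open>Right multiplication by \<open>transpose E\<close> embeds the n by k model into
    the n by n matrices, and right multiplication by \<open>E\<close> undoes it.\<close>
  have "H ** transpose E ** E = H" for H :: "real^'k^'n"
    using E by (simp add: matrix_mul_assoc[symmetric] orthonormal_columns_iff)
  from param_atlas_linear_image[OF graph_param_atlas[OF E] lin this]
  have inv: "param_atlas (involution_model CARD('k)) id ((\<lambda>H. H ** transpose E) ` graph_model E) {P. invertible P}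
    (\<lambda>P. {Q. invertible (graph_gram E P Q)}) (\<lambda>P Q. graph_chart E P Q ** transpose E)
    (\<lambda>P K. column_reflection (graph_frame E P (K ** E)))" .
  show ?thesis
    using param_atlas_embedded_submanifold[OF cayley_param_atlas param_atlas_UNIV]
      param_atlas_embedded_submanifold[OF inv cayley_param_atlas]
    unfolding open_manifold_UNIV by (auto simp: involution_model_def)
qed

lemma phi4_diffeomorphism:
  fixes Gr :: "(('n::finite, 'k::{finite,linorder}) rmat set, ('n, 'k) rmat) manifold"
    and On Inv :: "(('n, 'n) rmat, ('n, 'n) rmat) manifold"
  assumes "quotient_manifold (open_manifold full_rank_matrices) gl_class Gr"
    and "embedded_submanifold (open_manifold UNIV) orthogonal_group On"
    and "embedded_submanifold On (involution_model CARD('k)) Inv"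
  shows "diffeomorphism Gr Inv phi4"
  by (rule diffeomorphism_from_quotient[OF assms(1) open_full_rank assms(2,3) smooth_on_column_reflection _
        phi4_gl_class _ column_reflection_sections])
    (auto simp: image_column_reflection bij_betw_def phi4_inj_on phi4_image)

lemma phi4_inverse:
  fixes Q :: "('n::finite, 'n) rmat" and Y :: "('n, 'k::{finite,linorder}) rmat"
  assumes "Q \<in> involution_model CARD('k)" "eigenspace_basis Q Y"
  shows "Y \<in> full_rank_matrices" "inv_into (gl_class ` full_rank_matrices) phi4 Q = gl_class Y"
proof -
  have Y: "orthonormal_columns Y" "Q = column_reflection Y"
    using assms eigenspace_basis_reflection column_reflection_orthonormal by metis+
  show fr: "Y \<in> full_rank_matrices" by (rule orthonormal_full_rank[OF Y(1)])
  have "inv_into (gl_class ` full_rank_matrices) phi4 (phi4 (gl_class Y)) = gl_class Y"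
    by (rule inv_into_f_f[OF phi4_inj_on]) (use fr in blast)
  then show "inv_into (gl_class ` full_rank_matrices) phi4 Q = gl_class Y"
    using phi4_gl_class[OF fr] Y(2) by simp
qed

theorem proposition2p5:
  assumes "CARD('k::{finite,linorder}) \<le> CARD('n::finite)"
  shows
    "(\<forall>A\<in>full_rank_matrices :: ('n, 'k) rmat set.
        (\<exists>Y R. qr_factorization A Y R) \<and>
        (\<forall>Y R. qr_factorization A Y R \<longrightarrow>
           phi4 (gl_class A) = 2 *\<^sub>R (Y ** transpose Y) - mat 1))
   \<and> (\<exists>Gr :: (('n, 'k) rmat set, ('n, 'k) rmat) manifold.
        quotient_manifold (open_manifold full_rank_matrices) gl_class Gr)
   \<and> (\<exists>(On :: (('n, 'n) rmat, ('n, 'n) rmat) manifold) (Inv :: (('n, 'n) rmat, ('n, 'n) rmat) manifold).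
        embedded_submanifold (open_manifold UNIV) orthogonal_group On \<and>
        embedded_submanifold On (involution_model CARD('k)) Inv)
   \<and> (\<forall>(Gr :: (('n, 'k) rmat set, ('n, 'k) rmat) manifold)
       (On :: (('n, 'n) rmat, ('n, 'n) rmat) manifold) (Inv :: (('n, 'n) rmat, ('n, 'n) rmat) manifold).
        quotient_manifold (open_manifold full_rank_matrices) gl_class Gr \<and>
        embedded_submanifold (open_manifold UNIV) orthogonal_group On \<and>
        embedded_submanifold On (involution_model CARD('k)) Inv \<longrightarrow>
        diffeomorphism Gr Inv phi4)
   \<and> (\<forall>Q\<in>involution_model CARD('k) :: ('n, 'n) rmat set.
        (\<exists>Y :: ('n, 'k) rmat. eigenspace_basis Q Y) \<and>
        (\<forall>Y :: ('n, 'k) rmat. eigenspace_basis Q Y \<longrightarrow>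
           Y \<in> full_rank_matrices \<and>
           inv_into (gl_class ` full_rank_matrices) phi4 Q = gl_class Y))"
proof (intro conjI ballI allI impI)
  fix A :: "('n, 'k) rmat" assume A: "A \<in> full_rank_matrices"
  show "\<exists>Y R. qr_factorization A Y R" by (rule qr_factorization_exists[OF A])
  show "phi4 (gl_class A) = 2 *\<^sub>R (Y ** transpose Y) - mat 1" if "qr_factorization A Y R" for Y R
    using phi4_gl_class[OF A] qr_column_reflection[OF A that] by simp
next
  show "\<exists>Gr :: (('n, 'k) rmat set, ('n, 'k) rmat) manifold.
      quotient_manifold (open_manifold full_rank_matrices) gl_class Gr"
    by (rule grassmannian_quotient_manifold[OF assms])
next
  show "\<exists>(On :: (('n, 'n) rmat, ('n, 'n) rmat) manifold) (Inv :: (('n, 'n) rmat, ('n, 'n) rmat) manifold).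
      embedded_submanifold (open_manifold UNIV) orthogonal_group On \<and>
      embedded_submanifold On (involution_model CARD('k)) Inv"
    by (rule involution_embedded_submanifold[OF assms])
next
  fix Gr :: "(('n, 'k) rmat set, ('n, 'k) rmat) manifold"
    and On Inv :: "(('n, 'n) rmat, ('n, 'n) rmat) manifold"
  assume "quotient_manifold (open_manifold full_rank_matrices) gl_class Gr \<and>
      embedded_submanifold (open_manifold UNIV) orthogonal_group On \<and>
      embedded_submanifold On (involution_model CARD('k)) Inv"
  then show "diffeomorphism Gr Inv phi4" using phi4_diffeomorphism by blast
next
  fix Q :: "('n, 'n) rmat" assume Q: "Q \<in> involution_model CARD('k)"
  obtain Y :: "('n, 'k) rmat" where "orthonormal_columns Y" "Q = 2 *\<^sub>R (Y ** transpose Y) - mat 1"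
    using involution_model_decomposition[OF Q] .
  then show "\<exists>Y :: ('n, 'k) rmat. eigenspace_basis Q Y" using eigenspace_basis_reflection[OF Q] by blast
  fix Y :: "('n, 'k) rmat" assume Y: "eigenspace_basis Q Y"
  show "Y \<in> full_rank_matrices" by (rule phi4_inverse(1)[OF Q Y])
  show "inv_into (gl_class ` full_rank_matrices) phi4 Q = gl_class Y" by (rule phi4_inverse(2)[OF Q Y])
qed

end
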